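(* Let $X$ be a nonzero complex Banach space with open unit ball $\mathbb{B}$, and let $\Phi(\zeta)=1+B_1\zeta+B_2\zeta^2+B_3\zeta^3+\cdots$ be an admissible function (see context). Put $$q_1=-\frac{3B_1^2+2B_2}{2B_1},\quad q_2=-\frac{2B_1^4+3B_1^2B_2-2B_1B_3+3B_2^2}{2B_1^2},\quad q_3=\frac{3B_1^2+4B_2}{2B_1},\quad q_4=\frac{B_1^3+3B_1B_2+2B_3}{2B_1},$$ and assume $(q_1,q_2)\in\bigcup_{i=3}^{7}\Theta_i$ and $(q_3,q_4)\in\bigcup_{i=5}^{7}\Theta_i$. Let $f:\mathbb{B}\to\mathbb{C}$ be holomorphic with $f(0)=1$, define $F(z)=zf(z)$ for $z\in\mathbb{B}$, and suppose that the mapping $z\mapsto (DF(z))^{-1}F(z)$ belongs to $\mathcal{M}_\Phi$. Then for every $z\in X\setminus\{0\}$ and $l_z\in T(z)$, $$\left|A_2^3-2A_2A_3^2-A_2A_4^2+2A_3^2A_4\right|\le \frac{\left(B_1^3+3B_1B_2+2B_3+6B_1\right)\left|2B_1^4+3B_1^2B_2+6B_1^2-2B_1B_3+3B_2^2\right|}{36},$$ where $$A_2=\frac{l_z(D^2F(0)(z^2))}{2!\,\|z\|^2},\quad A_3=\frac{l_z(D^3F(0)(z^3))}{3!\,\|z\|^3},\quad A_4=\frac{l_z(D^4F(0)(z^4))}{4!\,\|z\|^4}.$$ Moreover, the estimate is sharp.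
   Context: $\mathbb{U}=\{\zeta\in\mathbb{C}:|\zeta|<1\}$. For $z\in X\setminus\{0\}$, $T(z)=\{l_z\in L(X,\mathbb{C}): l_z(z)=\|z\|,\ \|l_z\|=1\}$, where $L(X,\mathbb{C})$ is the space of continuous linear functionals on $X$. $\mathcal{H}(\mathbb{B})$ is the set of holomorphic mappings $\mathbb{B}\to X$; $D^nF(0)$ is the $n$-th Fréchet derivative at $0$ (a bounded symmetric $n$-linear mapping) and $D^nF(0)(z^n)=D^nF(0)(z,\dots,z)$. Admissible function: $\Phi:\mathbb{U}\to\mathbb{C}$ is biholomorphic onto its image, $\Phi(0)=1$, $\operatorname{Re}\Phi(\zeta)>0$ on $\mathbb{U}$, $\Phi'(0)>0$, and $\Phi(\mathbb{U})$ is symmetric with respect to the real axis. Its Taylor coefficients $B_i$ are then real and $B_1>0$. $\mathcal{M}_\Phi$ is the set of $p\in\mathcal{H}(\mathbb{B})$ with $p(0)=0$, $Dp(0)=I$ and $\dfrac{\|z\|}{l_z(p(z))}\in\Phi(\mathbb{U})$ for all $z\in\mathbb{B}\setminus\{0\}$, $l_z\in T(z)$. The hypothesis $(DF(z))^{-1}F(z)\in\mathcal{M}_\Phi$ includes that $DF(z)$ is invertible with bounded inverse for every $z\in\mathbb{B}$. Subsets of $\mathbb{R}^2$ (points written $(a,b)$): $\Theta_3=\{|a|\le\frac12,\ b\le-1\}$; $\Theta_4=\{|a|\ge\frac12,\ b\le-\frac23(|a|+1)\}$; $\Theta_5=\{|a|\le2,\ b\ge1\}$; $\Theta_6=\{2\le|a|\le4,\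 b\ge\frac1{12}(a^2+8)\}$; $\Theta_7=\{|a|\ge4,\ b\ge\frac23(|a|-1)\}$. "Sharp" means: for each such $X$ and $\Phi$, there exist an $f$ satisfying all the hypotheses and a $z\in X\setminus\{0\}$, $l_z\in T(z)$ for which equality holds. *)

theory Defs
  imports "HOL-Complex_Analysis.Complex_Analysis"
begin

class complex_normed_vector = real_normed_vector +
  fixes scaleC :: "complex \<Rightarrow> 'a \<Rightarrow> 'a"  (infixr "*\<^sub>C" 75)
  assumes scaleC_add_right: "c *\<^sub>C (x + y) = c *\<^sub>C x + c *\<^sub>C y"
    and scaleC_add_left: "(c + d) *\<^sub>C x = c *\<^sub>C x + d *\<^sub>C x"
    and scaleC_scaleC: "c *\<^sub>C (d *\<^sub>C x) = (c * d) *\<^sub>C x"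
    and scaleC_one: "1 *\<^sub>C x = x"
    and scaleC_of_real: "complex_of_real r *\<^sub>C x = r *\<^sub>R x"
    and norm_scaleC: "norm (c *\<^sub>C x) = cmod c * norm x"

class complex_banach = complex_normed_vector + banach

instantiation complex :: complex_banach
begin
definition scaleC_complex_def: "c *\<^sub>C x = c * (x :: complex)"
instance
  by standard (simp_all add: scaleC_complex_def algebra_simps norm_mult scaleR_conv_of_real)
end

definition complex_homogeneous ::
    "('a::complex_normed_vector \<Rightarrow> 'b::complex_normed_vector) \<Rightarrow> bool"
  where "complex_homogeneous h \<longleftrightarrow> (\<forall>c x. h (c *\<^sub>C x) = c *\<^sub>C h x)"

text \<open>The type of bounded operators consists of real-linear maps, so complex linearity
  has to be required separately; the operator norm is the same in both readings.\<close>

definition support_functionals ::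
    "'a::complex_normed_vector \<Rightarrow> ('a \<Rightarrow>\<^sub>L complex) set"
  where "support_functionals z =
    {l. complex_homogeneous (blinfun_apply l) \<and>
        blinfun_apply l z = complex_of_real (norm z) \<and> norm l = 1}"

definition holomorphic_on_ball ::
    "('a::complex_normed_vector \<Rightarrow> 'b::complex_normed_vector) \<Rightarrow> bool"
  where "holomorphic_on_ball F \<longleftrightarrow>
    (\<forall>z\<in>ball 0 1. \<exists>L. (F has_derivative L) (at z) \<and> complex_homogeneous L)"

text \<open>The derivative as a point of the operator space. The definition can be iterated,
  with the operator norm topology on each space of values; for instance
  \<open>frechet (frechet F) 0 :: 'a \<Rightarrow>\<^sub>L 'a \<Rightarrow>\<^sub>L 'b\<close> is the second derivative at \<open>0\<close>.\<close>

definition frechet ::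
    "('a::real_normed_vector \<Rightarrow> 'b::real_normed_vector) \<Rightarrow> 'a \<Rightarrow> 'a \<Rightarrow>\<^sub>L 'b"
  where "frechet F z = Blinfun (frechet_derivative F (at z))"

definition D2_diag ::
    "('a::real_normed_vector \<Rightarrow> 'b::real_normed_vector) \<Rightarrow> 'a \<Rightarrow> 'b"
  where "D2_diag F z =
    blinfun_apply (blinfun_apply (frechet (frechet F) 0) z) z"

definition D3_diag ::
    "('a::real_normed_vector \<Rightarrow> 'b::real_normed_vector) \<Rightarrow> 'a \<Rightarrow> 'b"
  where "D3_diag F z =
    blinfun_apply (blinfun_apply (blinfun_apply (frechet (frechet (frechet F)) 0) z) z) z"

definition D4_diag ::
    "('a::real_normed_vector \<Rightarrow> 'b::real_normed_vector) \<Rightarrow> 'a \<Rightarrow> 'b"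
  where "D4_diag F z =
    blinfun_apply (blinfun_apply (blinfun_apply (blinfun_apply
      (frechet (frechet (frechet (frechet F))) 0) z) z) z) z"

definition boundedly_invertible :: "('a::real_normed_vector \<Rightarrow>\<^sub>L 'b::real_normed_vector) \<Rightarrow> bool"
  where "boundedly_invertible L \<longleftrightarrow>
    (\<exists>G. G o\<^sub>L L = id_blinfun \<and> L o\<^sub>L G = id_blinfun)"

definition admissible :: "(complex \<Rightarrow> complex) \<Rightarrow> bool"
  where "admissible \<Phi> \<longleftrightarrow>
    \<Phi> holomorphic_on ball 0 1 \<and>
    (\<exists>\<Psi>. \<Psi> holomorphic_on (\<Phi> ` ball 0 1) \<and> (\<forall>\<zeta>\<in>ball 0 1. \<Psi> (\<Phi> \<zeta>) = \<zeta>)) \<and>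
    \<Phi> 0 = 1 \<and>
    (\<forall>\<zeta>\<in>ball 0 1. Re (\<Phi> \<zeta>) > 0) \<and>
    deriv \<Phi> 0 \<in> \<real> \<and> Re (deriv \<Phi> 0) > 0 \<and>
    cnj ` (\<Phi> ` ball 0 1) = \<Phi> ` ball 0 1"

text \<open>For admissible \<open>\<Phi>\<close> the Taylor coefficients at \<open>0\<close> are real, so that the real part
  discards nothing.\<close>

definition taylor_coeff :: "(complex \<Rightarrow> complex) \<Rightarrow> nat \<Rightarrow> real"
  where "taylor_coeff \<Phi> n = Re ((deriv ^^ n) \<Phi> 0 / fact n)"

text \<open>If \<open>l (p z) = 0\<close>, the quotient below is \<open>0\<close> by convention, which does not lie
  in the image of an admissible \<open>\<Phi>\<close>; hence membership forces \<open>l (p z) \<noteq> 0\<close>.\<close>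

definition class_M :: "(complex \<Rightarrow> complex) \<Rightarrow> ('a::complex_banach \<Rightarrow> 'a) set"
  where "class_M \<Phi> =
    {p. holomorphic_on_ball p \<and> p 0 = 0 \<and> frechet p 0 = id_blinfun \<and>
        (\<forall>z\<in>ball 0 1 - {0}. \<forall>l\<in>support_functionals z.
           complex_of_real (norm z) / blinfun_apply l (p z) \<in> \<Phi> ` ball 0 1)}"

definition one_dim_type :: "('a::complex_normed_vector \<Rightarrow> complex) \<Rightarrow> 'a \<Rightarrow> 'a"
  where "one_dim_type f z = f z *\<^sub>C z"

definition starlike_factor ::
    "(complex \<Rightarrow> complex) \<Rightarrow> ('a::complex_banach \<Rightarrow> complex) \<Rightarrow> bool"
  where "starlike_factor \<Phi> f \<longleftrightarrow>
    holomorphic_on_ball f \<and> f 0 = 1 \<and>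
    (\<forall>z\<in>ball 0 1. boundedly_invertible (frechet (one_dim_type f) z)) \<and>
    (\<lambda>z. inv (blinfun_apply (frechet (one_dim_type f) z)) (one_dim_type f z)) \<in> class_M \<Phi>"

definition A2 :: "('a::complex_banach \<Rightarrow> 'a) \<Rightarrow> ('a \<Rightarrow>\<^sub>L complex) \<Rightarrow> 'a \<Rightarrow> complex"
  where "A2 F l z = blinfun_apply l (D2_diag F z) / (fact 2 * complex_of_real (norm z) ^ 2)"

definition A3 :: "('a::complex_banach \<Rightarrow> 'a) \<Rightarrow> ('a \<Rightarrow>\<^sub>L complex) \<Rightarrow> 'a \<Rightarrow> complex"
  where "A3 F l z = blinfun_apply l (D3_diag F z) / (fact 3 * complex_of_real (norm z) ^ 3)"

definition A4 :: "('a::complex_banach \<Rightarrow> 'a) \<Rightarrow> ('a \<Rightarrow>\<^sub>L complex) \<Rightarrow> 'a \<Rightarrow> complex"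
  where "A4 F l z = blinfun_apply l (D4_diag F z) / (fact 4 * complex_of_real (norm z) ^ 4)"

definition coeff_functional ::
    "('a::complex_banach \<Rightarrow> 'a) \<Rightarrow> ('a \<Rightarrow>\<^sub>L complex) \<Rightarrow> 'a \<Rightarrow> complex"
  where "coeff_functional F l z =
    A2 F l z ^ 3 - 2 * A2 F l z * A3 F l z ^ 2 - A2 F l z * A4 F l z ^ 2
      + 2 * A3 F l z ^ 2 * A4 F l z"

definition Theta3 :: "(real \<times> real) set"
  where "Theta3 = {(a, b). \<bar>a\<bar> \<le> 1/2 \<and> b \<le> -1}"

definition Theta4 :: "(real \<times> real) set"
  where "Theta4 = {(a, b). \<bar>a\<bar> \<ge> 1/2 \<and> b \<le> -(2/3) * (\<bar>a\<bar> + 1)}"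

definition Theta5 :: "(real \<times> real) set"
  where "Theta5 = {(a, b). \<bar>a\<bar> \<le> 2 \<and> b \<ge> 1}"

definition Theta6 :: "(real \<times> real) set"
  where "Theta6 = {(a, b). 2 \<le> \<bar>a\<bar> \<and> \<bar>a\<bar> \<le> 4 \<and> b \<ge> 1/12 * (a^2 + 8)}"

definition Theta7 :: "(real \<times> real) set"
  where "Theta7 = {(a, b). \<bar>a\<bar> \<ge> 4 \<and> b \<ge> 2/3 * (\<bar>a\<bar> - 1)}"

end

theory Submission
  imports Defs
begin

text \<open>
  The functional factors as
  \<open>(A\<^sub>2 - A\<^sub>4) (A\<^sub>2\<^sup>2 - 2 A\<^sub>3\<^sup>2 + A\<^sub>2 A\<^sub>4)\<close>, and its two factors are bounded separately.

  On the complex line through a unit vector \<open>u\<close> the mapping \<open>F(z) = f(z) z\<close> is \<open>\<zeta> g(\<zeta>) u\<close> with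
  \<open>g(\<zeta>) = f(\<zeta> u)\<close>, so \<open>A\<^sub>2, A\<^sub>3, A\<^sub>4\<close> are the Taylor coefficients of \<open>g\<close> of order one to three
  (\<open>coefficients_of_one_dim_type\<close>). Since \<open>DF(z)\<close> maps the line through \<open>z\<close> to itself,
  the hypothesis on \<open>DF\<close> becomes \<open>1 + \<zeta> g'(\<zeta>) / g(\<zeta>) = \<Phi>(w(\<zeta>))\<close> with a Schwarz function
  \<open>w = c\<^sub>1 \<zeta> + c\<^sub>2 \<zeta>\<^sup>2 + c\<^sub>3 \<zeta>\<^sup>3 + \<dots>\<close> (\<open>starlike_factor_on_slice\<close>,
  \<open>starlike_coefficients\<close>). Comparison of coefficients gives
  \<open>A\<^sub>2 = B\<^sub>1 c\<^sub>1\<close>, \<open>A\<^sub>4 = B\<^sub>1/3 (c\<^sub>3 + q\<^sub>3 c\<^sub>1 c\<^sub>2 + q\<^sub>4 c\<^sub>1\<^sup>3)\<close> and, for the second factor,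
  \<open>B\<^sub>1\<^sup>2 (c\<^sub>1\<^sup>2 - c\<^sub>2\<^sup>2/2 + c\<^sub>1/3 (c\<^sub>3 + q\<^sub>1 c\<^sub>1 c\<^sub>2 + q\<^sub>2 c\<^sub>1\<^sup>3))\<close>
  (\<open>coefficient_product_identities\<close>). The inequality of Prokhorov and Szynal,
  \<open>\<bar>c\<^sub>3 + \<mu> c\<^sub>1 c\<^sub>2 + \<nu> c\<^sub>1\<^sup>3\<bar> \<le> \<bar>\<nu>\<bar>\<close> for \<open>(\<mu>, \<nu>)\<close> in one of the regions \<open>\<Theta>\<^sub>3, \<dots>, \<Theta>\<^sub>7\<close>
  (\<open>prokhorov_szynal\<close>), then bounds the factors by \<open>B\<^sub>1 (1 + \<bar>q\<^sub>4\<bar>/3)\<close> and \<open>B\<^sub>1\<^sup>2 (1 + \<bar>q\<^sub>2\<bar>/3)\<close>.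

  The stated bound equals \<open>B\<^sub>1 (1 + q\<^sub>4/3) \<cdot> B\<^sub>1\<^sup>2 \<bar>1 - q\<^sub>2/3\<bar>\<close>, so the signs of \<open>q\<^sub>4\<close> and \<open>q\<^sub>2\<close> matter.
  The regions for \<open>(q\<^sub>3, q\<^sub>4)\<close> give \<open>q\<^sub>4 \<ge> 1\<close>. For \<open>q\<^sub>2\<close> the univalence of \<open>\<Phi>\<close> is essential: because
  \<open>Re \<Phi> > 0\<close>, the function \<open>\<Phi> - 1/\<Phi>\<close> is univalent too, and the consequence
  \<open>\<bar>(a\<^sub>2/a\<^sub>1)^2 - a\<^sub>3/a\<^sub>1\<bar> \<le> 1\<close> of Gronwall's area theorem (\<open>area_theorem\<close>,
  \<open>fekete_szego_univalent\<close>) applied to it yields \<open>q\<^sub>2 < 1\<close> (\<open>admissible_q2_less_1\<close>). This leaves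
  \<open>\<Theta>\<^sub>3\<close> and \<open>\<Theta>\<^sub>4\<close>, where \<open>q\<^sub>2 \<le> -1\<close>.

  Equality holds for \<open>w(\<zeta>) = \<i> \<zeta>\<close>: there \<open>A\<^sub>2\<close> and \<open>-A\<^sub>4\<close> point in the direction of \<open>\<i>\<close>, while
  \<open>c\<^sub>1\<^sup>2 = -1\<close> and \<open>c\<^sub>1\<^sup>4 = 1\<close> make the terms of the second factor, with \<open>q\<^sub>2 < 0\<close>, add up. The corresponding \<open>f\<close> is
  \<open>g \<circ> l\<close> with a norming functional \<open>l\<close> of \<open>u\<close>, supplied by the Hahn--Banach theorem
  (\<open>complex_norming_functional\<close>).

  The Frechet derivatives of order up to four exist because the derivative of a complex
  differentiable map is again complex differentiable as a map into the space of operators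
  (\<open>complex_diff_on_frechet\<close>).
\<close>

section \<open>The inequality of Prokhorov and Szynal\<close>

text \<open>After squaring and division by \<open>1 - A\<close> the inequality on the curve \<open>3\<nu> = 4\<tau>\<^sup>2 + 2\<close>
  (that is, \<open>\<mu> = 4\<tau>\<close>, \<open>\<nu> = (\<mu>^2 + 8)/12\<close>) becomes this polynomial inequality, with
  \<open>A = \<bar>c\<^sub>1\<bar>\<^sup>2\<close>, \<open>R = \<bar>x\<bar>\<^sup>2\<close> and \<open>t = Re x\<close>. It is quadratic in \<open>t\<close>; completing the square leaves the
  factor \<open>(1 - A) (\<nu> - 1)\<close> times a form \<open>Q\<close> that is concave in \<open>R\<close> and nonnegative at \<open>R = 0\<close>
  and \<open>R = 1\<close>.\<close>

lemma prokhorov_szynal_polynomial: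
  fixes A R t \<tau> \<nu> :: real
  assumes "3 * \<nu> = 4 * \<tau>^2 + 2" "1 \<le> \<nu>" "0 \<le> A" "A \<le> 1" "0 \<le> R" "R \<le> 1"
  shows "0 \<le> \<nu>^2 * (1 + A + A^2) - 2 * \<nu> * (1 - R) + (1 - A) * (1 - R)^2
      - 2 * \<nu> * A^2 * (4 * \<tau> * t - 2 * t^2 + R) - A * (1 - A) * R * (16 * \<tau>^2 - 8 * \<tau> * t + R)"
    (is "0 \<le> ?G")
proof -
  define Q where "Q = \<nu> * (\<nu> - 1) + 2 * A * \<nu>^2 + 2 * \<nu> * (1 - 2 * A) * R - 2 * (1 - A) * R^2"
  have "Q = (1 - R) * (\<nu> * (\<nu> - 1) + 2 * A * \<nu>^2)
      + R * ((\<nu> + 2) * (\<nu> - 1) + 2 * A * (\<nu> - 1)^2) + 2 * (1 - A) * R * (1 - R)"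
    unfolding Q_def by algebra
  also have "\<dots> \<ge> 0" using assms by (intro add_nonneg_nonneg mult_nonneg_nonneg) auto
  finally have Q: "Q \<ge> 0" .
  have "\<nu> * ?G = 4 * (\<nu> * A * t - \<tau> * (\<nu> * A - (1 - A) * R))^2 + (1 - A) * (\<nu> - 1) * Q"
    using assms(1) unfolding Q_def by algebra
  also have "\<dots> \<ge> 0" using assms Q by simp
  finally show ?thesis using assms(2) by (simp add: zero_le_mult_iff)
qed

lemma prokhorov_szynal_curve_normalized:
  fixes a \<tau> \<nu> :: real and x :: complex
  assumes "3 * \<nu> = 4 * \<tau>^2 + 2" "1 \<le> \<nu>" "0 \<le> a" "a \<le> 1" "cmod x \<le> 1"
  shows "cmod (of_real (\<nu> * a ^ 3) + of_real (a * (1 - a\<^sup>2)) * (of_real (4 * \<tau>) * x - x\<^sup>2))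
    \<le> \<nu> - (1 - a\<^sup>2) * (1 - (cmod x)^2)"
proof (rule power2_le_imp_le)
  define A R t s where "A = a^2" and "R = (cmod x)^2" and "t = Re x" and "s = Im x"
  have R: "R = t^2 + s^2" by (simp add: R_def t_def s_def cmod_power2)
  have *: "0 \<le> A" "A \<le> 1" "0 \<le> R" "R \<le> 1"
    using assms by (auto simp: A_def R_def power_le_one abs_square_le_1)
  have "(1 - A) * (1 - R) \<le> 1 * 1" using * by (intro mult_mono) auto
  then show "0 \<le> \<nu> - (1 - a\<^sup>2) * (1 - (cmod x)^2)"
    using assms(2) by (simp add: A_def R_def)
  let ?w = "of_real (\<nu> * a ^ 3) + of_real (a * (1 - a\<^sup>2)) * (of_real (4 * \<tau>) * x - x\<^sup>2)"
  have re: "Re ?w = \<nu> * a ^ 3 + a * (1 - A) * (4 * \<tau> * t - (t^2 - s\<^sup>2))"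
    and im: "Im ?w = a * (1 - A) * (4 * \<tau> * s - 2 * t * s)"
    by (simp_all add: A_def t_def s_def power2_eq_square power3_eq_cube)
  have "(\<nu> - (1 - A) * (1 - R))^2 - (cmod ?w)^2
    = (1 - A) * (\<nu>^2 * (1 + A + A^2) - 2 * \<nu> * (1 - R) + (1 - A) * (1 - R)^2
      - 2 * \<nu> * A^2 * (4 * \<tau> * t - 2 * t^2 + R) - A * (1 - A) * R * (16 * \<tau>^2 - 8 * \<tau> * t + R))"
    unfolding cmod_power2 re im R using A_def by algebra
  also have "\<dots> \<ge> 0" using prokhorov_szynal_polynomial[OF assms(1,2) *, of t] * by simp
  finally show "(cmod ?w)^2 \<le> (\<nu> - (1 - a\<^sup>2) * (1 - (cmod x)^2))^2" by (simp add: A_def R_def)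
qed

text \<open>The Schur parametrization of the coefficients \<open>c\<^sub>1, c\<^sub>2, c\<^sub>3\<close> of a Schwarz function. In contrast to
  the two inequalities between the coefficients that express it when \<open>\<bar>c\<^sub>1\<bar> < 1\<close>, it also forces
  \<open>c\<^sub>2 = c\<^sub>3 = 0\<close> when \<open>\<bar>c\<^sub>1\<bar> = 1\<close>.\<close>

definition schwarz_triple :: "complex \<Rightarrow> complex \<Rightarrow> complex \<Rightarrow> bool"
  where "schwarz_triple c1 c2 c3 \<longleftrightarrow> cmod c1 \<le> 1 \<and>
    (\<exists>x y. cmod x \<le> 1 \<and> cmod y \<le> 1 \<and> c2 = of_real (1 - (cmod c1)^2) * x \<and>
       c3 = of_real (1 - (cmod c1)^2) * (of_real (1 - (cmod x)^2) * y - cnj c1 * x^2))"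

text \<open>A rotation \<open>\<zeta> \<mapsto> w(v \<zeta>)\<close> with \<open>\<bar>v\<bar> = 1\<close> does not change the modulus, so \<open>c\<^sub>1 = a \<ge> 0\<close> may be
  assumed; the free parameter \<open>y\<close> contributes at most \<open>(1 - a\<^sup>2) (1 - \<bar>x\<bar>\<^sup>2)\<close>.\<close>

lemma schwarz_triple_bound:
  fixes \<mu> \<nu> K :: real
  assumes "schwarz_triple c1 c2 c3"
    and bound: "\<And>a x. 0 \<le> a \<Longrightarrow> a \<le> 1 \<Longrightarrow> cmod x \<le> 1 \<Longrightarrow>
      cmod (of_real (\<nu> * a ^ 3) + of_real (a * (1 - a\<^sup>2)) * (of_real \<mu> * x - x\<^sup>2))
        \<le> K - (1 - a\<^sup>2) * (1 - (cmod x)^2)"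
  shows "cmod (c3 + of_real \<mu> * c1 * c2 + of_real \<nu> * c1 ^ 3) \<le> K"
proof -
  define a where "a = cmod c1"
  obtain x y where a: "0 \<le> a" "a \<le> 1" and xy: "cmod x \<le> 1" "cmod y \<le> 1"
    and c2: "c2 = of_real (1 - a\<^sup>2) * x"
    and c3: "c3 = of_real (1 - a\<^sup>2) * (of_real (1 - (cmod x)^2) * y - cnj c1 * x^2)"
    using assms(1) by (auto simp: schwarz_triple_def a_def)
  define u where "u = cis (Arg c1)"
  have u: "cmod u = 1" "u * cnj u = 1" by (simp_all add: u_def cis_mult cis_cnj)
  have c1: "c1 = of_real a * u" using rcis_cmod_Arg[of c1] by (simp add: a_def u_def rcis_def)
  define x' where "x' = (cnj u)^2 * x"
  have x: "x = u^2 * x'" using u(2) unfolding x'_def by algebra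
  have nx: "cmod x' = cmod x" using u(1) by (simp add: x norm_mult norm_power)
  let ?w = "of_real (\<nu> * a ^ 3) + of_real (a * (1 - a\<^sup>2)) * (of_real \<mu> * x' - x'\<^sup>2)"
  have cc1: "cnj c1 = of_real a * cnj u" by (simp add: c1)
  have "c3 + of_real \<mu> * c1 * c2 + of_real \<nu> * c1 ^ 3
     = of_real ((1 - a\<^sup>2) * (1 - (cmod x)^2)) * y + u ^ 3 * ?w"
  proof -
    have alg: "b * (d * y - \<alpha> * v * (u^2 * x')^2) + m * (\<alpha> * u) * (b * (u^2 * x')) + n * (\<alpha> * u) ^ 3
       = b * d * y + u ^ 3 * (n * \<alpha> ^ 3 + \<alpha> * b * (m * x' - x'\<^sup>2))"
      if "u * v = 1" for b d \<alpha> v m n :: complex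
      using that by algebra
    show ?thesis
      using alg[OF u(2), of "of_real (1 - a\<^sup>2)" "of_real (1 - (cmod x)^2)" "of_real a" "of_real \<mu>" "of_real \<nu>"]
      unfolding c3 c2 cc1 by (simp only: c1 x[symmetric] of_real_mult of_real_power)
  qed
  also have "cmod \<dots> \<le> \<bar>(1 - a\<^sup>2) * (1 - (cmod x)^2)\<bar> * cmod y + cmod ?w"
    by (rule norm_triangle_le) (simp only: norm_mult norm_power norm_of_real u power_one mult_1 order_refl)
  also have "\<bar>(1 - a\<^sup>2) * (1 - (cmod x)^2)\<bar> = (1 - a\<^sup>2) * (1 - (cmod x)^2)"
    using a xy by (intro abs_of_nonneg mult_nonneg_nonneg) (auto simp: power_le_one)
  also have "\<dots> * cmod y \<le> (1 - a\<^sup>2) * (1 - (cmod x)^2) * 1"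
    using a xy by (intro mult_left_mono mult_nonneg_nonneg) (auto simp: power_le_one)
  also have "\<dots> + cmod ?w \<le> K" using bound[of a x'] a xy nx by simp
  finally show ?thesis by simp
qed

text \<open>At the corner \<open>(\<plusminus>1/2, -1)\<close> the triangle inequality suffices. Division by \<open>1 - a\<close> leaves a
  quadratic polynomial in \<open>r = \<bar>x\<bar>\<close>: its discriminant is nonpositive for \<open>a \<le> 4/5\<close>, and for larger \<open>a\<close> it
  decreases on \<open>[0, 1]\<close> and is nonnegative at \<open>r = 1\<close>.\<close>

lemma prokhorov_szynal_corner_normalized:
  fixes a \<mu> :: real and x :: complex
  assumes "\<bar>\<mu>\<bar> = 1/2" "0 \<le> a" "a \<le> 1" "cmod x \<le> 1"
  shows "cmod (of_real (-1 * a ^ 3) + of_real (a * (1 - a\<^sup>2)) * (of_real \<mu> * x - x\<^sup>2))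
    \<le> 1 - (1 - a\<^sup>2) * (1 - (cmod x)^2)"
proof -
  define r where "r = cmod x"
  have r: "0 \<le> r" "r \<le> 1" using assms by (auto simp: r_def)
  have "cmod (of_real \<mu> * x - x\<^sup>2) \<le> r / 2 + r^2"
    by (rule order_trans[OF norm_triangle_ineq4]) (simp add: norm_mult norm_power assms r_def)
  moreover have "0 \<le> a * (1 - a\<^sup>2)" using assms by (auto simp: power_le_one)
  ultimately have *: "a * (1 - a\<^sup>2) * cmod (of_real \<mu> * x - x\<^sup>2) \<le> a * (1 - a\<^sup>2) * (r / 2 + r^2)"
    by (intro mult_left_mono)
  have "cmod (of_real (-1 * a ^ 3) + of_real (a * (1 - a\<^sup>2)) * (of_real \<mu> * x - x\<^sup>2))
     \<le> a ^ 3 + a * (1 - a\<^sup>2) * (r / 2 + r^2)"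
    apply (rule order_trans[OF norm_triangle_ineq])
    unfolding norm_mult norm_of_real abs_of_nonneg[OF \<open>0 \<le> a * (1 - a\<^sup>2)\<close>]
    using * assms(2) by (simp add: abs_mult)
  also have "\<dots> \<le> 1 - (1 - a\<^sup>2) * (1 - r\<^sup>2)"
  proof -
    have q: "0 \<le> a^2 - (1 + a) * a * r / 2 + (1 - a\<^sup>2) * r^2"
    proof (cases "a \<le> 4/5")
      case True
      have "4 * (a^2 - (1 + a) * a * r / 2 + (1 - a\<^sup>2) * r^2)
          = (2 * a - (1 + a) * r / 2)^2 + (1 + a) * (15 - 17 * a) / 4 * r^2" by algebra
      also have "\<dots> \<ge> 0" using True assms by simp
      finally show ?thesis by (simp only: zero_le_mult_iff) simp
    next
      case False
      have "2 * (a^2 - (1 + a) * a * r / 2 + (1 - a\<^sup>2) * r^2)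
         = (1 - a) * (2 + a) + (1 + a) * (1 - r) * ((5 * a - 4) + 2 * (1 - a) * (1 - r))" by algebra
      also have "\<dots> \<ge> 0" using False assms r by simp
      finally show ?thesis by (simp only: zero_le_mult_iff) simp
    qed
    have "1 - (1 - a\<^sup>2) * (1 - r\<^sup>2) - (a ^ 3 + a * (1 - a\<^sup>2) * (r / 2 + r^2))
        = (1 - a) * (a^2 - (1 + a) * a * r / 2 + (1 - a\<^sup>2) * r^2)" by algebra
    moreover have "\<dots> \<ge> 0" using q assms by simp
    ultimately show ?thesis by linarith
  qed
  finally show ?thesis by (simp add: r_def)
qed

text \<open>The two boundary rays of \<open>\<Theta>\<^sub>4\<close> and of \<open>\<Theta>\<^sub>7\<close> have the directions \<open>(\<plusminus>3, -2)\<close> and \<open>(\<plusminus>3, 2)\<close>; along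
  them the right-hand side grows by \<open>2\<close> per step and the left-hand side by at most \<open>2\<close>.\<close>

lemma prokhorov_szynal_direction:
  fixes \<sigma> \<rho> :: real
  assumes "schwarz_triple c1 c2 c3" "\<bar>\<sigma>\<bar> = 1" "\<bar>\<rho>\<bar> = 1"
  shows "cmod (of_real (3 * \<sigma>) * c1 * c2 + of_real (2 * \<rho>) * c1 ^ 3) \<le> 2"
proof -
  define a where "a = cmod c1"
  obtain x where a: "0 \<le> a" "a \<le> 1" and x: "cmod x \<le> 1" and c2: "c2 = of_real (1 - a\<^sup>2) * x"
    using assms(1) by (auto simp: schwarz_triple_def a_def)
  have b: "0 \<le> 1 - a\<^sup>2" using a by (simp add: power_le_one)
  have "cmod c2 \<le> 1 - a\<^sup>2" unfolding c2 norm_mult norm_of_real using b x by (simp add: mult_left_le)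
  then have *: "a * cmod c2 \<le> a * (1 - a\<^sup>2)" using a by (intro mult_left_mono)
  have "cmod (of_real (3 * \<sigma>) * c1 * c2 + of_real (2 * \<rho>) * c1 ^ 3)
    \<le> 3 * (a * cmod c2) + 2 * a ^ 3"
    by (rule order_trans[OF norm_triangle_ineq])
       (use assms in \<open>simp add: norm_mult norm_power a_def abs_mult\<close>)
  also have "\<dots> \<le> 3 * (a * (1 - a\<^sup>2)) + 2 * a ^ 3" using * by linarith
  also have "\<dots> = 2 - (1 - a)^2 * (2 + a)" by algebra
  also have "\<dots> \<le> 2" using a by simp
  finally show ?thesis .
qed

lemma schwarz_triple_cube:
  assumes "schwarz_triple c1 c2 c3" "0 \<le> s"
  shows "cmod (of_real s * c1 ^ 3) \<le> s"
proof -
  have "cmod c1 ^ 3 \<le> 1" using assms(1) by (simp add: schwarz_triple_def power_le_one)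
  then show ?thesis using assms(2) by (simp add: norm_mult norm_power mult_left_le)
qed

lemma prokhorov_szynal_curve:
  assumes "schwarz_triple c1 c2 c3" "2 \<le> \<bar>\<mu>\<bar>"
  shows "cmod (c3 + of_real \<mu> * c1 * c2 + of_real ((\<mu>^2 + 8) / 12) * c1 ^ 3) \<le> (\<mu>^2 + 8) / 12"
proof (rule schwarz_triple_bound[OF assms(1)])
  have "2\<^sup>2 \<le> \<bar>\<mu>\<bar>\<^sup>2" using assms(2) by (intro power_mono) auto
  then have "3 * ((\<mu>^2 + 8) / 12) = 4 * (\<mu> / 4)^2 + 2" "1 \<le> (\<mu>^2 + 8) / 12"
    by (simp_all add: power_divide)
  from prokhorov_szynal_curve_normalized[OF this] show "cmod (of_real ((\<mu>^2 + 8) / 12 * a ^ 3) + of_real (a * (1 - a\<^sup>2)) * (of_real \<mu> * x - x\<^sup>2))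
        \<le> (\<mu>^2 + 8) / 12 - (1 - a\<^sup>2) * (1 - (cmod x)^2)" if "0 \<le> a" "a \<le> 1" "cmod x \<le> 1" for a x
    using that by simp
qed

lemma prokhorov_szynal_corner:
  assumes "schwarz_triple c1 c2 c3" "\<bar>\<mu>\<bar> = 1/2"
  shows "cmod (c3 + of_real \<mu> * c1 * c2 + of_real (-1) * c1 ^ 3) \<le> 1"
  by (rule schwarz_triple_bound[OF assms(1)]) (rule prokhorov_szynal_corner_normalized[OF assms(2)])

text \<open>The set of \<open>(\<mu>, \<nu>)\<close> for which the modulus is at most \<open>K\<close> is convex.\<close>

lemma prokhorov_szynal_segment:
  fixes c1 c2 c3 :: complex and m \<mu> \<nu> K :: real
  assumes "\<And>\<sigma>. \<bar>\<sigma>\<bar> = m \<Longrightarrow> cmod (c3 + of_real \<sigma> * c1 * c2 + of_real \<nu> * c1 ^ 3) \<le> K"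
    and "\<bar>\<mu>\<bar> \<le> m" "0 < m"
  shows "cmod (c3 + of_real \<mu> * c1 * c2 + of_real \<nu> * c1 ^ 3) \<le> K"
proof -
  define p where "p = (m + \<mu>) / (2 * m)"
  have p: "0 \<le> p" "0 \<le> 1 - p" "\<mu> = p * m + (1 - p) * (- m)"
    using assms(2,3) by (auto simp: p_def field_simps)
  let ?P = "\<lambda>\<sigma>. c3 + of_real \<sigma> * c1 * c2 + of_real \<nu> * c1 ^ 3"
  have "?P \<mu> = of_real p * ?P m + of_real (1 - p) * ?P (- m)"
    unfolding p(3) by (simp add: algebra_simps)
  also have "cmod \<dots> \<le> p * cmod (?P m) + (1 - p) * cmod (?P (- m))"
    by (rule order_trans[OF norm_triangle_ineq]) (simp only: norm_mult norm_of_real abs_of_nonneg p(1,2) order_refl)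
  also have "\<dots> \<le> p * K + (1 - p) * K"
    using assms(3) by (intro add_mono mult_left_mono assms(1) p) auto
  finally show ?thesis by (simp add: algebra_simps)
qed

text \<open>The regions are swept out by their boundary curve \<open>\<nu> = (\<mu>^2 + 8)/12\<close>, by the corners
  \<open>(\<plusminus>1/2, -1)\<close>, by the segments between symmetric points and by the boundary rays; moving away
  vertically by \<open>s\<close> adds \<open>s\<close> to the right-hand side and at most \<open>s\<close> to the left-hand side.\<close>

theorem prokhorov_szynal:
  assumes c: "schwarz_triple c1 c2 c3"
    and "(\<mu>, \<nu>) \<in> Theta3 \<union> Theta4 \<union> Theta5 \<union> Theta6 \<union> Theta7"
  shows "cmod (c3 + of_real \<mu> * c1 * c2 + of_real \<nu> * c1 ^ 3) \<le> \<bar>\<nu>\<bar>"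
proof -
  let ?P = "\<lambda>\<mu> \<nu>. c3 + of_real \<mu> * c1 * c2 + of_real \<nu> * c1 ^ 3"
  have vertical: "cmod (?P \<mu> \<nu>) \<le> K + \<bar>\<nu> - \<nu>0\<bar>" if "cmod (?P \<mu> \<nu>0) \<le> K" for \<mu> \<nu> \<nu>0 K :: real
  proof -
    have "?P \<mu> \<nu> = ?P \<mu> \<nu>0 + of_real (\<nu> - \<nu>0) * c1 ^ 3" by (simp add: algebra_simps)
    also have "cmod \<dots> \<le> K + cmod (of_real (\<nu> - \<nu>0) * c1 ^ 3)"
      using that by (intro norm_triangle_le) simp
    also have "cmod (of_real (\<nu> - \<nu>0) * c1 ^ 3) \<le> \<bar>\<nu> - \<nu>0\<bar>"
      using schwarz_triple_cube[OF c, of "\<bar>\<nu> - \<nu>0\<bar>"]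
      by (simp only: norm_mult norm_of_real) simp
    finally show ?thesis by simp
  qed
  have ray: "cmod (?P \<mu> (\<nu>0 + 2 * \<rho> * ((\<bar>\<mu>\<bar> - m) / 3))) \<le> K + 2 * ((\<bar>\<mu>\<bar> - m) / 3)"
    if K: "\<And>\<sigma>. \<bar>\<sigma>\<bar> = m \<Longrightarrow> cmod (?P \<sigma> \<nu>0) \<le> K" and m: "m \<le> \<bar>\<mu>\<bar>" "0 < m" and \<rho>: "\<bar>\<rho>\<bar> = 1"
    for \<mu> \<nu>0 m K \<rho> :: real
  proof -
    define s where "s = (\<bar>\<mu>\<bar> - m) / 3"
    have s: "0 \<le> s" using m by (simp add: s_def)
    have \<mu>: "\<mu> = sgn \<mu> * m + 3 * sgn \<mu> * s" using m by (simp add: s_def sgn_if abs_if split: if_splits)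
    have sg: "\<bar>sgn \<mu>\<bar> = 1" using m by (auto simp: sgn_if)
    have "?P \<mu> (\<nu>0 + 2 * \<rho> * s) = ?P (sgn \<mu> * m) \<nu>0
       + of_real s * (of_real (3 * sgn \<mu>) * c1 * c2 + of_real (2 * \<rho>) * c1 ^ 3)"
      by (subst \<mu>) (simp add: algebra_simps)
    also have "cmod \<dots> \<le> K + s * 2"
    proof (rule order_trans[OF norm_triangle_ineq], rule add_mono)
      show "cmod (?P (sgn \<mu> * m) \<nu>0) \<le> K" using sg m by (intro K) (simp add: abs_mult)
      show "cmod (of_real s * (of_real (3 * sgn \<mu>) * c1 * c2 + of_real (2 * \<rho>) * c1 ^ 3)) \<le> s * 2"
        unfolding norm_mult[of "of_real s"] norm_of_real abs_of_nonneg[OF s]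
        using prokhorov_szynal_direction[OF c sg \<rho>] s by (intro mult_left_mono) auto
    qed
    finally show ?thesis by (simp add: s_def mult.commute)
  qed
  consider "(\<mu>, \<nu>) \<in> Theta3" | "(\<mu>, \<nu>) \<in> Theta4" | "(\<mu>, \<nu>) \<in> Theta5" | "(\<mu>, \<nu>) \<in> Theta6"
    | "(\<mu>, \<nu>) \<in> Theta7" using assms(2) by blast
  then show ?thesis
  proof cases
    case 1
    have "cmod (?P \<mu> (-1)) \<le> 1"
      by (rule prokhorov_szynal_segment[where m = "1/2"], erule prokhorov_szynal_corner[OF c])
         (use 1 in \<open>auto simp: Theta3_def\<close>)
    from vertical[OF this, of \<nu>] show ?thesis using 1 by (simp add: Theta3_def)
  next
    case 2
    have ge: "1/2 \<le> \<bar>\<mu>\<bar>" "\<nu> \<le> -(2/3) * (\<bar>\<mu>\<bar> + 1)" using 2 by (auto simp: Theta4_def)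
    have "cmod (?P \<mu> (-1 + 2 * (-1) * ((\<bar>\<mu>\<bar> - 1/2) / 3))) \<le> 1 + 2 * ((\<bar>\<mu>\<bar> - 1/2) / 3)"
      by (rule ray, erule prokhorov_szynal_corner[OF c]) (use 2 in \<open>auto simp: Theta4_def\<close>)
    note vertical[OF this, of \<nu>]
    moreover have "\<bar>\<nu> - (-1 + 2 * (-1) * ((\<bar>\<mu>\<bar> - 1/2) / 3))\<bar>
        = (-1 + 2 * (-1) * ((\<bar>\<mu>\<bar> - 1/2) / 3)) - \<nu>" "\<bar>\<nu>\<bar> = - \<nu>"
      using ge by argo+
    ultimately show ?thesis using ge by argo
  next
    case 3
    have "cmod (?P \<mu> 1) \<le> 1"
    proof (rule prokhorov_szynal_segment[where m = 2])
      show "cmod (?P \<sigma> 1) \<le> 1" if "\<bar>\<sigma>\<bar> = 2" for \<sigma>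
        using prokhorov_szynal_curve[OF c, of \<sigma>] power2_abs[of \<sigma>, symmetric] that by simp
    qed (use 3 in \<open>auto simp: Theta5_def\<close>)
    from vertical[OF this, of \<nu>] show ?thesis using 3 by (simp add: Theta5_def)
  next
    case 4
    have "cmod (?P \<mu> ((\<mu>^2 + 8) / 12)) \<le> (\<mu>^2 + 8) / 12"
      by (rule prokhorov_szynal_curve[OF c]) (use 4 in \<open>auto simp: Theta6_def\<close>)
    from vertical[OF this, of \<nu>] show ?thesis using 4
      by (simp add: Theta6_def) 
  next
    case 5
    have "cmod (?P \<mu> (2 + 2 * 1 * ((\<bar>\<mu>\<bar> - 4) / 3))) \<le> 2 + 2 * ((\<bar>\<mu>\<bar> - 4) / 3)"
    proof (rule ray)
      show "cmod (?P \<sigma> 2) \<le> 2" if "\<bar>\<sigma>\<bar> = 4" for \<sigma>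
        using prokhorov_szynal_curve[OF c, of \<sigma>] power2_abs[of \<sigma>, symmetric] that by simp
    qed (use 5 in \<open>auto simp: Theta7_def\<close>)
    note vertical[OF this, of \<nu>]
    moreover have "4 \<le> \<bar>\<mu>\<bar>" "\<nu> \<ge> 2/3 * (\<bar>\<mu>\<bar> - 1)" using 5 by (auto simp: Theta7_def)
    ultimately show ?thesis by argo
  qed
qed


section \<open>Area of holomorphic images\<close>

text \<open>The plane as \<open>real ^ 2\<close>, where linear maps have matrices and determinants.\<close>

definition to_vec :: "complex \<Rightarrow> real ^ 2"
  where "to_vec z = vector [Re z, Im z]"

definition of_vec :: "real ^ 2 \<Rightarrow> complex"
  where "of_vec v = Complex (v $ 1) (v $ 2)"

lemma to_vec_nth [simp]: "to_vec z $ 1 = Re z" "to_vec z $ 2 = Im z"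
  by (simp_all add: to_vec_def)

lemma of_vec_sel [simp]: "Re (of_vec v) = v $ 1" "Im (of_vec v) = v $ 2"
  by (simp_all add: of_vec_def)

lemma complex_vec_inverse [simp]:
  "of_vec (to_vec z) = z" "to_vec (of_vec v) = v"
  by (simp_all add: complex_eq_iff vec_eq_iff forall_2)

lemma bounded_linear_to_vec: "bounded_linear to_vec"
  by (unfold linear_conv_bounded_linear[symmetric], rule linearI) (simp_all add: vec_eq_iff forall_2)

lemma bounded_linear_of_vec: "bounded_linear of_vec"
  by (unfold linear_conv_bounded_linear[symmetric], rule linearI) (simp_all add: complex_eq_iff)

lemma to_vec_cbox: "to_vec ` cbox a b = cbox (to_vec a) (to_vec b)"
proof
  show "to_vec ` cbox a b \<subseteq> cbox (to_vec a) (to_vec b)"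
    by (auto simp: in_cbox_complex_iff mem_box_cart forall_2)
  show "cbox (to_vec a) (to_vec b) \<subseteq> to_vec ` cbox a b"
    by (auto simp: in_cbox_complex_iff mem_box_cart forall_2
        intro!: image_eqI[where x = "of_vec x" for x])
qed

lemma of_vec_cbox: "of_vec ` cbox u v = cbox (of_vec u) (of_vec v)"
proof -
  have "of_vec ` to_vec ` cbox (of_vec u) (of_vec v)
      = cbox (of_vec u) (of_vec v)"
    by (simp add: image_image)
  then show ?thesis by (simp add: to_vec_cbox)
qed

lemma content_to_vec: "measure lborel (to_vec ` cbox a b) = measure lborel (cbox a b)"
proof (cases "cbox a b = {}")
  case False
  then have "cbox (to_vec a) (to_vec b) \<noteq> {}"
    by (metis to_vec_cbox image_is_empty)
  then show ?thesis
    using False unfolding to_vec_cbox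
    by (simp add: content_cbox_cart content_cbox' UNIV_2 Basis_complex_def inner_complex_def)
qed simp

lemma isCont_to_vec: "isCont to_vec z" "isCont of_vec v"
  using bounded_linear_to_vec bounded_linear_of_vec
  by (auto intro: linear_continuous_at)

lemma has_integral_to_vec:
  fixes f :: "complex \<Rightarrow> real"
  assumes "bounded S"
  shows "((\<lambda>v. f (of_vec v)) has_integral i) (to_vec ` S) \<longleftrightarrow> (f has_integral i) S"
proof -
  obtain a b where S: "S \<subseteq> cbox a b" using bounded_subset_cbox_symmetric[OF assms] by blast
  have S': "to_vec ` S \<subseteq> to_vec ` cbox a b" using S by blast
  have mem: "v \<in> to_vec ` S \<longleftrightarrow> of_vec v \<in> S" for v
    by (metis complex_vec_inverse image_iff)
  let ?F = "\<lambda>z. if z \<in> S then f z else 0"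
  have content': "measure lborel (of_vec ` cbox u v) = 1 * measure lborel (cbox u v)" for u v
    using content_to_vec[of "of_vec u" "of_vec v"]
    by (simp add: to_vec_cbox of_vec_cbox)
  have *: "((\<lambda>v. ?F (of_vec v)) has_integral i) (to_vec ` cbox a b)
      \<longleftrightarrow> (?F has_integral i) (cbox a b)" (is "?l \<longleftrightarrow> ?r")
  proof
    assume ?r
    have "((\<lambda>v. ?F (of_vec v)) has_integral (1 / 1) *\<^sub>R i) (to_vec ` cbox a b)"
      by (rule has_integral_twiddle[OF _ _ _ _ _ _ content' \<open>?r\<close>])
        (auto simp: to_vec_cbox of_vec_cbox isCont_to_vec)
    then show ?l by simp
  next
    assume l: ?l
    have "((\<lambda>z. ?F (of_vec (to_vec z))) has_integral (1 / 1) *\<^sub>R i)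
      (of_vec ` cbox (to_vec a) (to_vec b))"
      by (rule has_integral_twiddle[where f = "\<lambda>v. ?F (of_vec v)"])
        (use l content_to_vec in \<open>simp_all add: to_vec_cbox of_vec_cbox isCont_to_vec, blast+\<close>)
    then show ?r unfolding of_vec_cbox complex_vec_inverse by simp
  qed
  show ?thesis
    using * unfolding has_integral_restrict[OF S] has_integral_restrict[OF S', of "\<lambda>v. f (of_vec v)", symmetric]
    by (simp add: mem)
qed

text \<open>The Jacobian determinant of a holomorphic map is \<open>\<bar>g'\<bar>\<^sup>2\<close>. The additional stretching of the axes by
  \<open>s\<close> and \<open>t\<close> serves to turn an ellipse that contains the image into a disc.\<close>

lemma area_stretched_holomorphic_image:
  fixes s t :: real
  assumes S: "open S" "bounded S" and g: "g holomorphic_on S" "inj_on g S" "bounded (g ` S)"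
    and st: "s \<noteq> 0" "t \<noteq> 0"
  defines "T \<equiv> \<lambda>w. Complex (s * Re w) (t * Im w)"
  shows "((\<lambda>z. \<bar>s * t\<bar> * (cmod (deriv g z))^2) has_integral measure lebesgue (T ` g ` S)) S"
proof -
  have lT: "linear T" unfolding T_def by (rule linearI) (simp_all add: complex_eq_iff algebra_simps)
  then have blT: "bounded_linear T" by (simp add: linear_conv_bounded_linear)
  have injT: "inj T" unfolding T_def using st by (auto intro!: injI simp: complex_eq_iff)
  have opg: "open (g ` S)" by (rule open_mapping_thm3[OF g(1) S(1) g(2)])
  have bT: "bounded (T ` g ` S)" by (rule bounded_linear_image[OF g(3) blT])
  have "open (T ` g ` S)"
    by (rule open_surjective_linear_image[OF opg lT])
       (metis linear_injective_imp_surjective lT injT)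
  then have meas: "T ` g ` S \<in> lmeasurable" using bT by (rule lmeasurable_open[rotated])
  define G where "G = (\<lambda>v. to_vec (T (g (of_vec v))))"
  define G' where "G' = (\<lambda>v h. to_vec (T (deriv g (of_vec v) * of_vec h)))"
  let ?V = "to_vec ` S"
  have opV: "open ?V"
    by (rule open_surjective_linear_image[OF S(1) bounded_linear.linear[OF bounded_linear_to_vec]])
       (metis complex_vec_inverse(2) surjI)
  have "G ` ?V \<in> lmeasurable \<and> measure lebesgue (G ` ?V) = measure lebesgue (T ` g ` S)
     \<longleftrightarrow> ((\<lambda>x. \<bar>det (matrix (G' x))\<bar>) has_integral measure lebesgue (T ` g ` S)) ?V"
  proof (rule has_measure_differentiable_image)
    show "?V \<in> sets lebesgue" using opV by (simp add: borel_open)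
    show "inj_on G ?V"
      using g(2) injT by (auto simp: inj_on_def G_def) (metis complex_vec_inverse(1))
    show "(G has_derivative G' v) (at v within ?V)" if "v \<in> ?V" for v
    proof -
      have z: "of_vec v \<in> S" using that by auto
      have "(g has_derivative (\<lambda>h. deriv g (of_vec v) * h)) (at (of_vec v))"
        using holomorphic_derivI[OF g(1) S(1) z] by (simp add: has_field_derivative_def)
      from has_derivative_compose[OF bounded_linear_imp_has_derivative[OF bounded_linear_of_vec] this]
      have "((\<lambda>v. g (of_vec v)) has_derivative (\<lambda>h. deriv g (of_vec v) * of_vec h)) (at v within ?V)" .
      from bounded_linear.has_derivative[OF bounded_linear_to_vec bounded_linear.has_derivative[OF blT this]]
      show ?thesis unfolding G_def G'_def .
    qed
  qed
  moreover have GV: "G ` ?V = to_vec ` T ` g ` S" by (simp add: G_def image_image)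
  moreover have "((\<lambda>v. 1::real) has_integral measure lebesgue (T ` g ` S)) (to_vec ` T ` g ` S)"
    unfolding has_integral_to_vec[OF bT, of "\<lambda>_. 1"] lmeasure_integral[OF meas]
    using meas by (simp add: lmeasurable_iff_integrable_on integrable_integral)
  moreover have "\<bar>det (matrix (G' v))\<bar> = \<bar>s * t\<bar> * (cmod (deriv g (of_vec v)))^2" for v
  proof -
    have "det (matrix (G' v)) = s * t * (cmod (deriv g (of_vec v)))^2"
      unfolding cmod_power2
      by (simp add: det_2 matrix_def G'_def T_def axis_def power2_eq_square algebra_simps)
    then show ?thesis by (simp add: abs_mult)
  qed
  ultimately have "((\<lambda>v. \<bar>s * t\<bar> * (cmod (deriv g (of_vec v)))^2) has_integral measure lebesgue (T ` g ` S)) ?V"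
    by (simp add: has_integral_iff lmeasurable_iff_integrable_on lmeasure_integral)
  then show ?thesis
    using has_integral_to_vec[OF S(2), of "\<lambda>z. \<bar>s * t\<bar> * (cmod (deriv g z))^2"] by simp
qed


section \<open>Gronwall's area theorem\<close>

lemma sum_roots_of_unity_power:
  fixes N n :: nat
  assumes "0 < n" "n < N"
  shows "(\<Sum>j<N. exp (2 * of_real pi * \<i> * of_nat j / of_nat N) ^ n) = 0"
proof -
  define w where "w = exp (2 * of_real pi * \<i> * of_nat n / of_nat N)"
  have "w \<noteq> 1"
    using assms complex_root_unity_eq_1[of N n] by (auto simp: w_def dest: nat_dvd_not_less)
  moreover have "w ^ N = 1"
    using assms by (simp add: w_def complex_root_unity)
  ultimately have "(\<Sum>j<N. w ^ j) = 0" by (simp add: geometric_sum)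
  moreover have "exp (2 * of_real pi * \<i> * of_nat j / of_nat N) ^ n = w ^ j" for j
    by (simp add: w_def exp_of_nat_mult[symmetric] mult_ac)
  ultimately show ?thesis by simp
qed

text \<open>Averaging over the \<open>N\<close>-th roots of unity annihilates \<open>z\<^sup>n\<close> for \<open>0 < n < N\<close>, so that only the tail of
  the power series remains. These averages take the place of the integral over a circle.\<close>

lemma roots_of_unity_mean:
  fixes q :: "complex \<Rightarrow> complex" and r \<delta> :: real
  assumes q: "q holomorphic_on ball 0 1" "q 0 = 0" and r: "0 < r" "r < 1" and "0 < \<delta>"
  shows "\<forall>\<^sub>F N in sequentially. \<forall>z. cmod z \<le> r \<longrightarrow>
    cmod (\<Sum>j<N. q (exp (2 * of_real pi * \<i> * of_nat j / of_nat N) * z)) \<le> \<delta> * N"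
proof -
  define c where "c n = (deriv ^^ n) q 0 / fact n" for n
  have sums: "(\<lambda>n. c n * z ^ n) sums q z" if "cmod z < 1" for z
    using holomorphic_power_series[OF q(1), of z] that by (simp add: c_def)
  have c0: "c 0 = 0" using q(2) by (simp add: c_def)
  \<comment> \<open>a radius between \<open>r\<close> and \<open>1\<close>, for absolute convergence on the circle of radius \<open>r\<close>\<close>
  define R where "R = (1 + r) / 2"
  have R: "r < R" "R < 1" using r by (auto simp: R_def)
  have "summable (\<lambda>n. c n * of_real R ^ n)"
    using sums[of "of_real R"] R r by (auto intro: sums_summable)
  then have "summable (\<lambda>n. norm (c n * of_real r ^ n))"
    by (rule powser_insidea) (use r R in auto)
  then have sm: "summable (\<lambda>n. cmod (c n) * r ^ n)" using r by (simp add: norm_mult norm_power)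
  obtain M where M: "\<And>n. n \<ge> M \<Longrightarrow> norm (\<Sum>i. cmod (c (i + n)) * r ^ (i + n)) < \<delta>"
    using suminf_exist_split[OF \<open>0 < \<delta>\<close> sm] by blast
  have "cmod (\<Sum>j<N. q (exp (2 * of_real pi * \<i> * of_nat j / of_nat N) * z)) \<le> \<delta> * N"
    if N: "N \<ge> M" and z: "cmod z \<le> r" for N z
  proof -
    define w where "w j = exp (2 * of_real pi * \<i> * of_nat j / of_nat N)" for j
    have nw: "cmod (w j) = 1" for j by (simp add: w_def)
    define tail where "tail x = q x - (\<Sum>n<N. c n * x ^ n)" for x
    have tail: "cmod (tail x) \<le> \<delta>" if x: "cmod x \<le> r" for x
    proof -
      have s: "(\<lambda>n. c n * x ^ n) sums q x" using sums[of x] x r by simp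
      have le: "cmod (c n * x ^ n) \<le> cmod (c n) * r ^ n" for n
        using x by (auto simp: norm_mult norm_power intro!: mult_left_mono power_mono)
      have "(\<lambda>i. c (i + N) * x ^ (i + N)) sums tail x"
        using sums_split_initial_segment[OF s, of N] by (simp add: tail_def)
      then have "tail x = (\<Sum>i. c (i + N) * x ^ (i + N))" by (simp add: sums_iff)
      also have "cmod \<dots> \<le> (\<Sum>i. cmod (c (i + N)) * r ^ (i + N))"
        by (rule norm_suminf_le) (use le summable_ignore_initial_segment[OF sm, of N] in auto)
      also have "\<dots> \<le> \<delta>" using M[OF N] by simp
      finally show ?thesis .
    qed
    have "(\<Sum>j<N. \<Sum>n<N. c n * (w j * z) ^ n) = (\<Sum>n<N. c n * z ^ n * (\<Sum>j<N. w j ^ n))"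
      by (subst sum.swap) (simp add: sum_distrib_left power_mult_distrib mult_ac)
    also have "\<dots> = 0"
    proof (rule sum.neutral, intro ballI)
      fix n assume "n \<in> {..<N}"
      then show "c n * z ^ n * (\<Sum>j<N. w j ^ n) = 0"
        using c0 sum_roots_of_unity_power[of n N] by (cases "n = 0") (auto simp: w_def)
    qed
    finally have "(\<Sum>j<N. q (w j * z)) = (\<Sum>j<N. tail (w j * z))"
      by (simp add: tail_def sum_subtractf)
    also have "cmod \<dots> \<le> (\<Sum>j<N. \<delta>)"
      by (intro sum_norm_le tail) (simp add: norm_mult nw z)
    finally show ?thesis by (simp add: w_def mult.commute)
  qed
  then show ?thesis by (auto simp: eventually_sequentially)
qed

lemma measure_annulus:
  assumes "0 < e" "e < r"
  shows "measure lebesgue {z::complex. e < cmod z \<and> cmod z < r} = pi * (r^2 - e\<^sup>2)"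
proof -
  have "{z::complex. e < cmod z \<and> cmod z < r} = ball 0 r - cball 0 e" by auto
  moreover have "measure lebesgue (ball (0::complex) r - cball 0 e)
      = measure lebesgue (ball (0::complex) r) - measure lebesgue (cball (0::complex) e)"
    using assms by (intro measurable_measure_Diff) auto
  ultimately show ?thesis
    using assms by (simp add: content_ball content_cball eval_unit_ball_vol algebra_simps)
qed

text \<open>The image of the annulus under \<open>g\<close> is contained in an ellipse. On the small inner circle
  \<open>1/z = cnj z / e^2\<close>, so there \<open>g\<close> agrees up to \<open>O(e^2)\<close> with the real-linear map
  \<open>z \<mapsto> cnj z / e^2 + \<beta> z\<close>, whose inverse is \<open>T\<close>. Hence \<open>T \<circ> g\<close> maps the inner circle into a disc of
  radius \<open>\<rho> = e + O(e\<^sup>4)\<close>; the outer circle is mapped near \<open>0\<close>, and the maximum principle for the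
  real parts \<open>Re (c g)\<close> extends the inclusion to the whole annulus. Replacing \<open>g(z)\<close> by \<open>g(u z)\<close>
  does not change the image, which is why the same value \<open>I\<close> serves all rotations.\<close>

lemma annulus_image_area:
  fixes \<beta> e r H :: real
  assumes h: "h holomorphic_on ball 0 1"
    and inj: "inj_on (\<lambda>z. 1 / z + of_real \<beta> * z + z^2 * h z) (ball 0 1 - {0})"
    and r: "r < 1" and H: "\<And>z. cmod z \<le> r \<Longrightarrow> cmod (h z) \<le> H"
    and e: "0 < e" "e < r" "2 * \<bar>\<beta>\<bar> * e^2 \<le> 1" "2 * e * (1 / r + \<bar>\<beta>\<bar> + H) \<le> 1"
  defines "g \<equiv> \<lambda>z. 1 / z + of_real \<beta> * z + z^2 * h z"
  shows "\<exists>I. I * e ^ 4 \<le> pi * (e + 2 * e ^ 4 * H)^2 \<and>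
    (\<forall>u. cmod u = 1 \<longrightarrow> ((\<lambda>z. (cmod (deriv g (u * z)))^2) has_integral I) {z. e < cmod z \<and> cmod z < r})"
proof -
  define S where "S = {z::complex. e < cmod z \<and> cmod z < r}"
  have r0: "0 < r" using e by linarith
  have S: "S = ball 0 r - cball 0 e" by (auto simp: S_def)
  have opS: "open S" and boS: "bounded S" unfolding S by (auto intro: bounded_subset[OF bounded_ball])
  have clS: "closure S \<subseteq> cball 0 r - ball 0 e" unfolding S
    by (intro closure_minimal) auto
  have clS': "closure S \<subseteq> ball 0 1 - {0}" using clS e r by force
  have H0: "0 \<le> H" using H[of 0] r0 by (auto intro: order_trans[OF norm_ge_zero])
  have holg: "g holomorphic_on (ball 0 1 - {0})"
    unfolding g_def by (intro holomorphic_intros holomorphic_on_subset[OF h]) auto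
  define p where "p = 1 / e^2"
  have p0: "0 < p" using e by (simp add: p_def)
  have p: "2 * \<bar>\<beta>\<bar> \<le> p" using e by (simp add: p_def field_simps)
  \<comment> \<open>the real-linear map \<open>z \<mapsto> p cnj z + \<beta> z\<close> scales the axes by \<open>p + \<beta>\<close> and \<open>\<beta> - p\<close>\<close>
  define s t where "s = 1 / (p + \<beta>)" and "t = 1 / (\<beta> - p)"
  have pb: "p + \<beta> \<ge> p / 2" "p - \<beta> \<ge> p / 2" using p by linarith+
  have pb0: "p + \<beta> > 0" "p - \<beta> > 0" using pb p0 by linarith+
  have st0: "s \<noteq> 0" "t \<noteq> 0" using pb0 by (auto simp: s_def t_def)
  have st: "\<bar>s * t\<bar> = 1 / (p^2 - \<beta>\<^sup>2)"
  proof -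
    have "0 < (p + \<beta>) * (p - \<beta>)" using pb0 by simp
    moreover have "(p + \<beta>) * (p - \<beta>) = p^2 - \<beta>\<^sup>2" "(p + \<beta>) * (\<beta> - p) = - (p^2 - \<beta>\<^sup>2)"
      by algebra+
    ultimately show ?thesis by (simp add: s_def t_def)
  qed
  have s_le: "\<bar>s\<bar> \<le> 2 * e^2" "\<bar>t\<bar> \<le> 2 * e^2"
  proof -
    have "1 / (p + \<beta>) \<le> 1 / (p / 2)" "1 / (p - \<beta>) \<le> 1 / (p / 2)"
      using pb p0 by (intro divide_left_mono; simp)+
    moreover have "1 / (p / 2) = 2 * e^2" by (simp add: p_def)
    moreover have "\<bar>s\<bar> = 1 / (p + \<beta>)" "\<bar>t\<bar> = 1 / (p - \<beta>)"
      using pb0 by (simp_all add: s_def t_def)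
    ultimately show "\<bar>s\<bar> \<le> 2 * e^2" "\<bar>t\<bar> \<le> 2 * e^2" by simp_all
  qed
  define T where "T = (\<lambda>w. Complex (s * Re w) (t * Im w))"
  have T_add: "T (v + w) = T v + T w" for v w by (simp add: T_def complex_eq_iff algebra_simps)
  have T_le: "cmod (T w) \<le> 2 * e^2 * cmod w" for w
  proof (rule power2_le_imp_le)
    have "(cmod (T w))^2 = \<bar>s\<bar>\<^sup>2 * (Re w)^2 + \<bar>t\<bar>\<^sup>2 * (Im w)^2"
      by (simp add: T_def cmod_power2 power_mult_distrib)
    also have "\<dots> \<le> (2 * e^2)^2 * (Re w)^2 + (2 * e^2)^2 * (Im w)^2"
      using s_le by (intro add_mono mult_right_mono power_mono) auto
    also have "\<dots> = (2 * e^2 * cmod w)^2" by (simp add: cmod_power2 power_mult_distrib algebra_simps)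
    finally show "(cmod (T w))^2 \<le> (2 * e^2 * cmod w)^2" .
  qed simp
  define \<rho> where "\<rho> = e + 2 * e ^ 4 * H"
  have inner: "cmod (T (g z)) \<le> \<rho>" if z: "cmod z = e" for z
  proof -
    have z0: "z \<noteq> 0" using z e by auto
    have "1 / z = cnj z * of_real p"
      using z z0 complex_norm_square[of z] by (simp add: p_def field_simps)
    then have "T (g z) = T (cnj z * of_real p + of_real \<beta> * z) + T (z^2 * h z)"
      by (simp add: g_def T_add)
    also have "T (cnj z * of_real p + of_real \<beta> * z) = z"
      using pb0 by (simp add: T_def complex_eq_iff s_def t_def field_simps)
    finally have "cmod (T (g z)) \<le> cmod z + cmod (T (z^2 * h z))" by (simp add: norm_triangle_ineq)
    also have "\<dots> \<le> e + 2 * e^2 * cmod (z^2 * h z)" using T_le z by simp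
    also have "cmod (z^2 * h z) \<le> e^2 * H"
      using H[of z] z e by (simp add: norm_mult norm_power mult_left_mono)
    also have "e + 2 * e^2 * (e^2 * H) = \<rho>" by (simp add: \<rho>_def power_numeral_reduce)
    finally show ?thesis using e by (simp add: mult_left_mono)
  qed
  have outer: "cmod (T (g z)) \<le> \<rho>" if z: "cmod z = r" for z
  proof -
    have "cmod (g z) \<le> cmod (1 / z) + cmod (of_real \<beta> * z) + cmod (z^2 * h z)"
      unfolding g_def by (intro norm_triangle_le add_mono order_refl)
    also have "\<dots> \<le> 1 / r + \<bar>\<beta>\<bar> * 1 + 1 * H"
      unfolding norm_mult norm_divide norm_power
      using z r r0 H[of z] by (intro add_mono mult_mono) (auto simp: power_le_one)
    finally have "2 * e^2 * cmod (g z) \<le> e * (2 * e * (1 / r + \<bar>\<beta>\<bar> + H))"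
      using e by (simp add: power2_eq_square)
    also have "\<dots> \<le> e * 1" using e by (intro mult_left_mono) auto
    finally have "cmod (T (g z)) \<le> e" using T_le[of "g z"] by linarith
    moreover have "0 \<le> 2 * e ^ 4 * H" using e H0 by simp
    ultimately show ?thesis unfolding \<rho>_def by linarith
  qed
  have image: "T ` g ` S \<subseteq> cball 0 \<rho>"
  proof (clarsimp)
    fix z assume z: "z \<in> S"
    define v where "v = T (g z)"
    show "cmod (T (g z)) \<le> \<rho>"
    proof (cases "v = 0")
      case True
      then show ?thesis using e H0 by (simp add: v_def[symmetric] \<rho>_def)
    next
      case False
      define a where "a = v / of_real (cmod v)"
      have a: "cmod a = 1" using False by (simp add: a_def norm_divide)
      \<comment> \<open>the complex number that represents the functional \<open>w \<mapsto> inner a (T w)\<close> as a real part\<close>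
      define c where "c = Complex (s * Re a) (- (t * Im a))"
      have c: "Re (c * w) = inner a (T w)" for w
        by (simp add: c_def T_def inner_complex_def)
      have "Re (c * g z) \<le> \<rho>"
      proof (rule maximum_real_frontier[of "\<lambda>z. c * g z" S])
        show "(\<lambda>z. c * g z) holomorphic_on interior S"
          using clS' interior_subset[of S] closure_subset[of S]
          by (intro holomorphic_intros holomorphic_on_subset[OF holg]) auto
        show "continuous_on (closure S) (\<lambda>z. c * g z)"
          using clS' by (intro continuous_intros holomorphic_on_imp_continuous_on holomorphic_on_subset[OF holg])
        fix w assume "w \<in> frontier S"
        then have "w \<in> closure S" "w \<notin> S" using opS by (auto simp: frontier_def interior_open)
        then have "cmod w = e \<or> cmod w = r" using clS by (auto simp: S_def)
        then have "cmod (T (g w)) \<le> \<rho>" using inner outer by blast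
        moreover have "inner a (T (g w)) \<le> norm a * norm (T (g w))" by (rule norm_cauchy_schwarz)
        ultimately show "Re (c * g w) \<le> \<rho>" using a c by simp
      qed (use boS z in auto)
      moreover have "inner a v = cmod v"
        using False by (simp add: a_def inner_complex_def cmod_power2[symmetric] add_divide_distrib[symmetric]
            power2_eq_square[symmetric]) (simp add: power2_eq_square)
      ultimately show ?thesis using c by (simp add: v_def)
    qed
  qed
  define m where "m = measure lebesgue (T ` g ` S)"
  have S_sub: "S \<subseteq> ball 0 1 - {0}" using clS' closure_subset by blast
  have "compact (closure S)" using boS by (simp add: compact_closure)
  then have "bounded (g ` closure S)"
    using clS' by (intro compact_imp_bounded compact_continuous_image
        holomorphic_on_imp_continuous_on holomorphic_on_subset[OF holg])
  then have bog: "bounded (g ` S)" by (rule bounded_subset) (use closure_subset in blast)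
  have int: "((\<lambda>z. (cmod (deriv g (u * z)))^2) has_integral m * (p^2 - \<beta>\<^sup>2)) S"
    if u: "cmod u = 1" for u
  proof -
    have u0: "u \<noteq> 0" using u by auto
    have uS: "(*) u ` S = S"
    proof
      show "(*) u ` S \<subseteq> S" using u by (auto simp: S_def norm_mult)
      show "S \<subseteq> (*) u ` S"
      proof
        fix z assume "z \<in> S"
        then have "z / u \<in> S" "z = u * (z / u)" using u u0 by (auto simp: S_def norm_divide)
        then show "z \<in> (*) u ` S" by blast
      qed
    qed
    have gS: "(\<lambda>z. g (u * z)) ` S = g ` S" using uS by (metis image_image)
    have holS: "g holomorphic_on S" by (rule holomorphic_on_subset[OF holg S_sub])
    have hu: "(\<lambda>z. g (u * z)) holomorphic_on S"
      using holomorphic_on_compose[of "(*) u" S g] holS uS by (simp add: o_def holomorphic_intros)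
    have iu: "inj_on (\<lambda>z. g (u * z)) S"
      using inj_on_subset[OF inj S_sub] u0 uS unfolding inj_on_def g_def[symmetric]
      by (metis image_eqI mult_cancel_left)
    have area: "((\<lambda>z. \<bar>s * t\<bar> * (cmod (deriv (\<lambda>z. g (u * z)) z))^2) has_integral m) S"
      using area_stretched_holomorphic_image[OF opS boS hu iu _ st0] bog
      by (simp add: gS m_def T_def)
    have chain: "cmod (deriv (\<lambda>z. g (u * z)) z) = cmod (deriv g (u * z))" if z: "z \<in> S" for z
    proof -
      have "u * z \<in> S" using uS z by blast
      then have "(g has_field_derivative deriv g (u * z)) (at (u * z))"
        using holomorphic_derivI[OF holS opS] by blast
      moreover have "((\<lambda>z. u * z) has_field_derivative u) (at z)"
        by (auto intro!: derivative_eq_intros)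
      ultimately have "deriv (\<lambda>z. g (u * z)) z = deriv g (u * z) * u"
        by (intro DERIV_imp_deriv DERIV_chain')
      then show ?thesis by (simp add: norm_mult u)
    qed
    have one: "\<bar>s * t\<bar> * (p^2 - \<beta>\<^sup>2) = 1" using st st0 by (auto simp: abs_mult)
    show ?thesis
    proof (rule has_integral_eq[OF _ has_integral_mult_left[OF area, of "p\<^sup>2 - \<beta>\<^sup>2"]])
      fix z assume z: "z \<in> S"
      show "\<bar>s * t\<bar> * (cmod (deriv (\<lambda>z. g (u * z)) z))^2 * (p^2 - \<beta>\<^sup>2) = (cmod (deriv g (u * z)))^2"
        unfolding chain[OF z] using one by algebra
    qed
  qed
  have "m \<le> measure lebesgue (cball (0::complex) \<rho>)"
  proof -
    have "open (g ` S)"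
      using inj_on_subset[OF inj S_sub] by (intro open_mapping_thm3 holomorphic_on_subset[OF holg S_sub] opS) (simp add: g_def)
    moreover have "linear T" unfolding T_def by (rule linearI) (simp_all add: complex_eq_iff algebra_simps)
    moreover have "inj T" using st0 by (auto simp: inj_def T_def complex_eq_iff)
    ultimately have "open (T ` g ` S)"
      by (metis open_surjective_linear_image linear_injective_imp_surjective)
    then show ?thesis unfolding m_def
      using image by (intro measure_mono_fmeasurable) (auto simp: borel_open)
  qed
  also have "\<dots> = pi * \<rho>^2" using e H0 by (simp add: content_cball eval_unit_ball_vol \<rho>_def)
  finally have m: "m \<le> pi * \<rho>^2" .
  have "m * (p^2 - \<beta>\<^sup>2) * e ^ 4 \<le> m * p^2 * e ^ 4"
    using e by (intro mult_right_mono mult_left_mono) (auto simp: m_def)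
  also have "\<dots> = m" using e by (simp add: p_def power_divide flip: power_mult)
  finally have "m * (p^2 - \<beta>\<^sup>2) * e ^ 4 \<le> pi * (e + 2 * e ^ 4 * H)^2"
    using m unfolding \<rho>_def by linarith
  then show ?thesis using int unfolding S_def[symmetric] by blast
qed


text \<open>The leading term \<open>1/z\<close> of \<open>g\<close> maps the annulus to an annulus, whose area gives the integral of
  \<open>\<bar>1/z^2\<bar>\<^sup>2\<close>.\<close>

lemma inverse_area_annulus:
  assumes "0 < e" "e < r"
  shows "((\<lambda>z. 1 / cmod z ^ 4) has_integral pi * (1 / e^2 - 1 / r^2)) {z. e < cmod z \<and> cmod z < r}"
proof -
  define S where "S = {z::complex. e < cmod z \<and> cmod z < r}"
  have S: "S = ball 0 r - cball 0 e" by (auto simp: S_def)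
  have opS: "open S" and boS: "bounded S" unfolding S by (auto intro: bounded_subset[OF bounded_ball])
  have S0: "z \<noteq> 0" if "z \<in> S" for z using that assms by (auto simp: S_def)
  have image: "inverse ` S = {w. 1 / r < cmod w \<and> cmod w < 1 / e}"
  proof
    show "inverse ` S \<subseteq> {w. 1 / r < cmod w \<and> cmod w < 1 / e}"
    proof clarify
      fix z assume "z \<in> S"
      then have "e < cmod z" "cmod z < r" "0 < cmod z" "0 < r" using assms by (auto simp: S_def)
      then show "1 / r < cmod (inverse z) \<and> cmod (inverse z) < 1 / e"
        using assms by (simp add: norm_divide inverse_eq_divide frac_less2)
    qed
    show "{w. 1 / r < cmod w \<and> cmod w < 1 / e} \<subseteq> inverse ` S"
    proof
      fix w :: complex assume w: "w \<in> {w. 1 / r < cmod w \<and> cmod w < 1 / e}"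
      then have "0 < cmod w" using assms by (auto intro: less_trans[rotated])
      then have "inverse w \<in> S" using w assms by (auto simp: S_def norm_inverse norm_divide field_simps)
      then show "w \<in> inverse ` S" by (metis image_eqI inverse_inverse_eq)
    qed
  qed
  have "bounded (inverse ` S)"
    unfolding image by (rule bounded_subset[OF bounded_ball[of 0 "1 / e"]]) auto
  then have "((\<lambda>z. \<bar>1 * 1\<bar> * (cmod (deriv inverse z))^2) has_integral
      measure lebesgue ((\<lambda>w. Complex (1 * Re w) (1 * Im w)) ` inverse ` S)) S"
    using S0 by (intro area_stretched_holomorphic_image opS boS)
      (auto intro!: holomorphic_intros simp: inj_on_def)
  moreover have "measure lebesgue ((\<lambda>w. Complex (1 * Re w) (1 * Im w)) ` inverse ` S) = pi * (1 / e^2 - 1 / r^2)"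
    using measure_annulus[of "1 / r" "1 / e"] assms
    by (simp add: image frac_less2 power_divide)
  moreover have "\<bar>1 * 1\<bar> * (cmod (deriv inverse z))^2 = 1 / cmod z ^ 4" if "z \<in> S" for z
    using S0[OF that] by (simp add: norm_divide norm_power power_divide flip: power_mult)
  ultimately show ?thesis
    unfolding S_def[symmetric] by (metis (no_types, lifting) has_integral_eq)
qed

text \<open>Expansion of \<open>\<bar>g'\<bar>\<^sup>2\<close> for \<open>g' = -1/z^2 + \<beta> + k\<close>, discarding \<open>\<bar>k\<bar>\<^sup>2\<close>. The two cross terms are real parts of
  functions that are holomorphic and vanish at \<open>0\<close>, up to the radial factor \<open>1/\<bar>z\<bar>\<^sup>4\<close>.\<close>

lemma deriv_norm_lower_bound:
  fixes z k :: complex and \<beta> :: real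
  assumes "z \<noteq> 0"
  shows "1 / cmod z ^ 4 + \<beta>^2 + Re (- 2 * z^2 * (of_real \<beta> + k)) / cmod z ^ 4 + Re (2 * of_real \<beta> * k)
    \<le> (cmod (- 1 / z^2 + of_real \<beta> + k))^2"
proof -
  define a b where "a = - 1 / z^2" and "b = of_real \<beta> + k"
  have "cnj z = of_real ((cmod z)^2) / z" using assms complex_norm_square[of z] by (simp add: field_simps)
  then have "cnj a = - z\<^sup>2 / of_real (cmod z ^ 4)"
    using assms by (simp add: a_def power_divide flip: power_mult)
  then have "2 * (cnj a * b) = (- 2 * z^2 * b) / of_real (cmod z ^ 4)" by simp
  then have "2 * Re (cnj a * b) = Re (- 2 * z^2 * b) / cmod z ^ 4"
    by (metis Re_divide_of_real Re_complex_of_real mult_2 plus_complex.sel(1))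
  moreover have "(cmod (a + b))^2 = (cmod a)^2 + 2 * Re (cnj a * b) + (cmod b)^2"
    unfolding cmod_power2 by (simp add: power2_eq_square algebra_simps)
  moreover have "(cmod a)^2 = 1 / cmod z ^ 4"
    by (simp add: a_def norm_divide norm_power power_divide flip: power_mult)
  moreover have "\<beta>\<^sup>2 + Re (2 * of_real \<beta> * k) \<le> (cmod b)^2"
    unfolding cmod_power2 by (simp add: b_def power2_eq_square algebra_simps)
  moreover have "- 1 / z^2 + of_real \<beta> + k = a + b" by (simp add: a_def b_def)
  ultimately show ?thesis unfolding b_def[symmetric] by simp
qed

text \<open>Comparison of the upper bound from the ellipse with the lower bound from the expansion of \<open>\<bar>g'\<bar>\<^sup>2\<close>
  averaged over rotations, in which the cross terms disappear. The terms \<open>\<pi>/e^2\<close> cancel, and what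
  remains bounds \<open>\<beta>\<^sup>2\<close> times the area of the annulus.\<close>

lemma area_inequality_annulus:
  fixes \<beta> e r H :: real
  assumes h: "h holomorphic_on ball 0 1"
    and inj: "inj_on (\<lambda>z. 1 / z + of_real \<beta> * z + z^2 * h z) (ball 0 1 - {0})"
    and r: "r < 1" and H: "\<And>z. cmod z \<le> r \<Longrightarrow> cmod (h z) \<le> H"
    and e: "0 < e" "e < r" "2 * \<bar>\<beta>\<bar> * e^2 \<le> 1" "2 * e * (1 / r + \<bar>\<beta>\<bar> + H) \<le> 1"
  shows "\<beta>\<^sup>2 * (r^2 - e\<^sup>2) \<le> 1 / r^2 + 4 * e * H + 4 * e ^ 4 * H^2"
proof -
  define g where "g = (\<lambda>z. 1 / z + of_real \<beta> * z + z^2 * h z)"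
  define S where "S = {z::complex. e < cmod z \<and> cmod z < r}"
  obtain I where I: "I * e ^ 4 \<le> pi * (e + 2 * e ^ 4 * H)^2"
    and int: "\<And>u. cmod u = 1 \<Longrightarrow> ((\<lambda>z. (cmod (deriv g (u * z)))^2) has_integral I) S"
    using annulus_image_area[OF h inj r H e] unfolding g_def S_def by blast
  define k where "k z = 2 * z * h z + z^2 * deriv h z" for z
  have deriv_g: "deriv g z = - 1 / z^2 + of_real \<beta> + k z" if "z \<noteq> 0" "cmod z < 1" for z
  proof (rule DERIV_imp_deriv)
    have "(h has_field_derivative deriv h z) (at z)"
      using that by (intro holomorphic_derivI[OF h]) auto
    then show "(g has_field_derivative - 1 / z^2 + of_real \<beta> + k z) (at z)"
      unfolding g_def k_def using that
      by (auto intro!: derivative_eq_intros simp: power2_eq_square algebra_simps)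
  qed
  define q1 q2 where "q1 z = - 2 * z^2 * (of_real \<beta> + k z)" and "q2 z = 2 * of_real \<beta> * k z" for z
  have "k holomorphic_on ball 0 1"
    unfolding k_def by (intro holomorphic_intros h holomorphic_deriv) auto
  then have "q1 holomorphic_on ball 0 1" "q2 holomorphic_on ball 0 1"
    unfolding q1_def q2_def by (auto intro!: holomorphic_intros)
  moreover have "q1 0 = 0" "q2 0 = 0" by (simp_all add: q1_def q2_def k_def)
  ultimately have q: "q1 holomorphic_on ball 0 1" "q2 holomorphic_on ball 0 1" "q1 0 = 0" "q2 0 = 0"
    by auto
  have r0: "0 < r" using e by linarith
  have one: "((\<lambda>z. 1) has_integral pi * (r^2 - e\<^sup>2)) S"
  proof -
    have "S = ball 0 r - cball 0 e" by (auto simp: S_def)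
    then have "S \<in> lmeasurable" by (auto intro: fmeasurable.Diff)
    then show ?thesis
      using measure_annulus[OF e(1,2)] unfolding S_def[symmetric]
      by (metis has_integral_iff lmeasurable_iff_integrable_on lmeasure_integral)
  qed
  have le: "pi * (1 / e^2 - 1 / r^2) + (\<beta>^2 - \<delta> * (1 / e ^ 4 + 1)) * (pi * (r^2 - e\<^sup>2)) \<le> I"
    if \<delta>: "0 < \<delta>" for \<delta> :: real
  proof -
    define w where "w N j = exp (2 * of_real pi * \<i> * of_nat j / of_nat N)" for N j :: nat
    have nw: "cmod (w N j) = 1" for N j by (simp add: w_def)
    have "\<forall>\<^sub>F N in sequentially. (\<forall>z. cmod z \<le> r \<longrightarrow> cmod (\<Sum>j<N. q1 (w N j * z)) \<le> \<delta> * N) \<and>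
        (\<forall>z. cmod z \<le> r \<longrightarrow> cmod (\<Sum>j<N. q2 (w N j * z)) \<le> \<delta> * N) \<and> 0 < N"
      unfolding w_def
      by (intro eventually_conj roots_of_unity_mean q r0 r \<delta> eventually_gt_at_top)
    then obtain N where N: "0 < N"
      and mean: "\<And>z. cmod z \<le> r \<Longrightarrow> cmod (\<Sum>j<N. q1 (w N j * z)) \<le> \<delta> * N"
        "\<And>z. cmod z \<le> r \<Longrightarrow> cmod (\<Sum>j<N. q2 (w N j * z)) \<le> \<delta> * N"
      by (auto simp: eventually_sequentially)
    define A where "A z = (\<Sum>j<N. (cmod (deriv g (w N j * z)))^2)" for z
    define B where "B z = (1 / cmod z ^ 4 + (\<beta>^2 - \<delta> * (1 / e ^ 4 + 1)) * 1) * N" for z :: complex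
    have intA: "(A has_integral (\<Sum>j<N. I)) S"
      unfolding A_def by (intro has_integral_sum int nw) auto
    have intB: "(B has_integral (pi * (1 / e^2 - 1 / r^2) + (\<beta>^2 - \<delta> * (1 / e ^ 4 + 1)) * (pi * (r^2 - e\<^sup>2))) * N) S"
      unfolding B_def
      by (intro has_integral_mult_left has_integral_add has_integral_mult_right one
          inverse_area_annulus[OF e(1,2), folded S_def])
    have B_le_A: "B z \<le> A z" if z: "z \<in> S" for z
    proof -
      have z': "z \<noteq> 0" "cmod z \<le> r" "e \<le> cmod z" "cmod z < 1" using z e r by (auto simp: S_def)
      have "(\<Sum>j<N. 1 / cmod z ^ 4 + \<beta>^2 + Re (q1 (w N j * z)) / cmod z ^ 4 + Re (q2 (w N j * z))) \<le> A z"
        unfolding A_def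
      proof (rule sum_mono)
        fix j
        have "w N j * z \<noteq> 0" "cmod (w N j * z) = cmod z" using z' nw by (auto simp: norm_mult w_def)
        then show "1 / cmod z ^ 4 + \<beta>^2 + Re (q1 (w N j * z)) / cmod z ^ 4 + Re (q2 (w N j * z))
            \<le> (cmod (deriv g (w N j * z)))^2"
          using deriv_norm_lower_bound[of "w N j * z" \<beta> "k (w N j * z)"] z'
          by (simp add: deriv_g q1_def q2_def)
      qed
      also have "(\<Sum>j<N. 1 / cmod z ^ 4 + \<beta>^2 + Re (q1 (w N j * z)) / cmod z ^ 4 + Re (q2 (w N j * z)))
          = N * (1 / cmod z ^ 4 + \<beta>^2) + Re (\<Sum>j<N. q1 (w N j * z)) / cmod z ^ 4 + Re (\<Sum>j<N. q2 (w N j * z))"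
        by (simp add: sum.distrib sum_divide_distrib algebra_simps)
      finally have low: "N * (1 / cmod z ^ 4 + \<beta>^2) + Re (\<Sum>j<N. q1 (w N j * z)) / cmod z ^ 4
          + Re (\<Sum>j<N. q2 (w N j * z)) \<le> A z" .
      have "\<bar>Re (\<Sum>j<N. q1 (w N j * z))\<bar> \<le> \<delta> * N" "\<bar>Re (\<Sum>j<N. q2 (w N j * z))\<bar> \<le> \<delta> * N"
        using mean[OF z'(2)] abs_Re_le_cmod order_trans by blast+
      moreover have "\<bar>Re (\<Sum>j<N. q1 (w N j * z))\<bar> / cmod z ^ 4 \<le> \<delta> * N / e ^ 4"
        using calculation(1) z' e \<delta> by (intro frac_le power_mono) auto
      then have "\<bar>Re (\<Sum>j<N. q1 (w N j * z)) / cmod z ^ 4\<bar> \<le> \<delta> * N / e ^ 4"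
        by simp
      ultimately have "- (\<delta> * N / e ^ 4) - \<delta> * N \<le> Re (\<Sum>j<N. q1 (w N j * z)) / cmod z ^ 4
          + Re (\<Sum>j<N. q2 (w N j * z))" by linarith
      with low show ?thesis by (simp add: B_def algebra_simps)
    qed
    have "(pi * (1 / e^2 - 1 / r^2) + (\<beta>^2 - \<delta> * (1 / e ^ 4 + 1)) * (pi * (r^2 - e\<^sup>2))) * N \<le> (\<Sum>j<N. I)"
      by (rule has_integral_le[OF intB intA B_le_A])
    then show ?thesis using N by (simp add: mult.commute)
  qed
  have "I \<le> pi * (1 / e^2 + 4 * e * H + 4 * e ^ 4 * H^2)"
  proof -
    have "(e + 2 * e ^ 4 * H)^2 = (x^2 + 4 * e * H + 4 * e ^ 4 * H^2) * e ^ 4"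
      if "e * x = 1" for x
      using that by algebra
    from this[of "1 / e"] have "I * e ^ 4 \<le> pi * (1 / e^2 + 4 * e * H + 4 * e ^ 4 * H^2) * e ^ 4"
      using I e(1) by (simp add: power_one_over mult.assoc)
    then show ?thesis using e(1) by simp
  qed
  then have "pi * (1 / e^2 - 1 / r^2 + (\<beta>^2 - \<delta> * (1 / e ^ 4 + 1)) * (r^2 - e\<^sup>2))
      \<le> pi * (1 / e^2 + 4 * e * H + 4 * e ^ 4 * H^2)" if "0 < \<delta>" for \<delta>
    using le[OF that] by (simp add: algebra_simps)
  then have le': "(\<beta>^2 - \<delta> * (1 / e ^ 4 + 1)) * (r^2 - e\<^sup>2) \<le> 1 / r^2 + 4 * e * H + 4 * e ^ 4 * H^2" if "0 < \<delta>" for \<delta>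
    using that by (fastforce simp: mult_le_cancel_left_pos)
  have "((\<lambda>\<delta>. (\<beta>^2 - \<delta> * (1 / e ^ 4 + 1)) * (r^2 - e\<^sup>2)) \<longlongrightarrow> (\<beta>^2 - 0 * (1 / e ^ 4 + 1)) * (r^2 - e\<^sup>2)) (at_right 0)"
    by (intro tendsto_intros)
  then show ?thesis
    by (intro tendsto_upperbound[where F = "at_right (0::real)"])
      (auto simp: eventually_at_right_less intro!: eventually_mono[OF eventually_at_right_less] le')
qed

text \<open>In the inequality for annuli, first let the inner radius tend to \<open>0\<close>, then the outer one to \<open>1\<close>.\<close>

theorem area_theorem:
  fixes \<beta> :: real
  assumes h: "h holomorphic_on ball 0 1"
    and inj: "inj_on (\<lambda>z. 1 / z + of_real \<beta> * z + z^2 * h z) (ball 0 1 - {0})"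
  shows "\<bar>\<beta>\<bar> \<le> 1"
proof -
  have *: "\<beta>\<^sup>2 * r^2 \<le> 1 / r^2" if r: "0 < r" "r < 1" for r
  proof -
    have "continuous_on (cball 0 r) h"
      by (rule holomorphic_on_imp_continuous_on[OF holomorphic_on_subset[OF h]]) (use r in auto)
    then have "bounded (h ` cball 0 r)" by (intro compact_imp_bounded compact_continuous_image) auto
    then obtain H where "\<forall>x\<in>h ` cball 0 r. cmod x \<le> H" by (auto simp: bounded_iff)
    then have H: "\<And>z. cmod z \<le> r \<Longrightarrow> cmod (h z) \<le> H" by auto
    have "((\<lambda>e. 2 * \<bar>\<beta>\<bar> * e^2) \<longlongrightarrow> 2 * \<bar>\<beta>\<bar> * 0^2) (at_right 0)"
      "((\<lambda>e. 2 * e * (1 / r + \<bar>\<beta>\<bar> + H)) \<longlongrightarrow> 2 * 0 * (1 / r + \<bar>\<beta>\<bar> + H)) (at_right 0)"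
      by (intro tendsto_intros)+
    then have "\<forall>\<^sub>F e in at_right 0. 2 * \<bar>\<beta>\<bar> * e^2 < 1"
      "\<forall>\<^sub>F e in at_right 0. 2 * e * (1 / r + \<bar>\<beta>\<bar> + H) < 1"
      by (auto dest: order_tendstoD(2)[where a = 1])
    moreover have "\<forall>\<^sub>F e in at_right 0. 0 < e \<and> e < r"
      using eventually_at_right_real[OF r(1)] by (simp add: greaterThanLessThan_iff)
    ultimately have ev: "\<forall>\<^sub>F e in at_right 0. \<beta>\<^sup>2 * (r^2 - e\<^sup>2) \<le> 1 / r^2 + 4 * e * H + 4 * e ^ 4 * H^2"
      by eventually_elim (intro area_inequality_annulus[OF h inj r(2) H], auto)
    have "((\<lambda>e. 1 / r^2 + 4 * e * H + 4 * e ^ 4 * H^2) \<longlongrightarrow> 1 / r^2 + 4 * 0 * H + 4 * 0 ^ 4 * H^2) (at_right 0)"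
      "((\<lambda>e. \<beta>\<^sup>2 * (r^2 - e\<^sup>2)) \<longlongrightarrow> \<beta>\<^sup>2 * (r^2 - 0\<^sup>2)) (at_right 0)"
      by (intro tendsto_intros)+
    from tendsto_le[OF _ this ev] show ?thesis by simp
  qed
  have "((\<lambda>r::real. 1 / r^2) \<longlongrightarrow> 1 / 1^2) (at_left 1)" "((\<lambda>r. \<beta>\<^sup>2 * r^2) \<longlongrightarrow> \<beta>\<^sup>2 * 1^2) (at_left 1)"
    by (intro tendsto_intros; simp)+
  moreover have "\<forall>\<^sub>F r::real in at_left 1. r \<in> {0<..<1}"
    by (rule eventually_at_left_real) simp
  then have "\<forall>\<^sub>F r in at_left 1. \<beta>\<^sup>2 * r^2 \<le> 1 / r^2"
    by eventually_elim (use * in auto)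
  ultimately have "\<beta>\<^sup>2 * 1^2 \<le> 1 / 1^2" by (intro tendsto_le) auto
  then show ?thesis by (simp add: abs_square_le_1)
qed


section \<open>Taylor coefficients of univalent and of Schwarz functions\<close>

lemma fps_mult_nth_2: "fps_nth (A * B) 2 = fps_nth A 0 * fps_nth B 2 + fps_nth A 1 * fps_nth B 1 + fps_nth A 2 * fps_nth B 0"
  and fps_mult_nth_3: "fps_nth (A * B) 3 = fps_nth A 0 * fps_nth B 3 + fps_nth A 1 * fps_nth B 2
      + fps_nth A 2 * fps_nth B 1 + fps_nth A 3 * fps_nth B 0"
  by (simp_all add: fps_mult_nth numeral_2_eq_2 numeral_3_eq_3)

lemmas fps_mult_nth_upto_3 = fps_mult_nth_0 fps_mult_nth_1 fps_mult_nth_2 fps_mult_nth_3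

lemma fps_compose_nth_upto_3:
  fixes A B :: "'a :: comm_ring_1 fps"
  assumes "fps_nth B 0 = 0"
  shows "fps_nth (fps_compose A B) 1 = fps_nth A 1 * fps_nth B 1"
    and "fps_nth (fps_compose A B) 2 = fps_nth A 1 * fps_nth B 2 + fps_nth A 2 * fps_nth B 1 ^ 2"
    and "fps_nth (fps_compose A B) 3 = fps_nth A 1 * fps_nth B 3
      + 2 * fps_nth A 2 * fps_nth B 1 * fps_nth B 2 + fps_nth A 3 * fps_nth B 1 ^ 3"
proof -
  have 1: "{0..1::nat} = {0, 1}" "{0..2::nat} = {0, 1, 2}" "{0..3::nat} = {0, 1, 2, 3}" by auto
  have 2: "B ^ 2 = B * B" "B ^ 3 = B * (B * B)" by (simp_all add: power2_eq_square power3_eq_cube mult.assoc)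
  show "fps_nth (fps_compose A B) 1 = fps_nth A 1 * fps_nth B 1"
    "fps_nth (fps_compose A B) 2 = fps_nth A 1 * fps_nth B 2 + fps_nth A 2 * fps_nth B 1 ^ 2"
    "fps_nth (fps_compose A B) 3 = fps_nth A 1 * fps_nth B 3
      + 2 * fps_nth A 2 * fps_nth B 1 * fps_nth B 2 + fps_nth A 3 * fps_nth B 1 ^ 3"
    unfolding fps_compose_nth 1 2
    by (simp_all add: fps_mult_nth_upto_3[unfolded One_nat_def] assms power2_eq_square power3_eq_cube algebra_simps)
qed

lemma holomorphic_has_fps_expansion:
  assumes "f holomorphic_on ball 0 1"
  shows "f has_fps_expansion fps_expansion f 0"
  using assms by (intro has_fps_expansion_fps_expansion[of "ball 0 1"]) auto

lemma fps_eq_if_eq_on_ball: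
  assumes "f has_fps_expansion F" "g has_fps_expansion G" "\<And>z::complex. cmod z < 1 \<Longrightarrow> f z = g z"
  shows "F = G"
proof -
  have "eventually (\<lambda>z. z \<in> ball (0::complex) 1) (nhds 0)" by (intro eventually_nhds_in_open) auto
  then have "eventually (\<lambda>z. f z = g z) (nhds 0)"
    by eventually_elim (use assms(3) in auto)
  then have "f has_fps_expansion G"
    using assms(2) by (subst has_fps_expansion_cong[OF _ refl])
  then show ?thesis using assms(1) fps_expansion_unique_complex by blast
qed

lemma holomorphic_factor:
  fixes f :: "complex \<Rightarrow> complex"
  assumes "f holomorphic_on ball 0 1"
  obtains h where "h holomorphic_on ball 0 1" "\<And>z. f z = f 0 + z * h z"
proof
  let ?h = "\<lambda>z. if z = 0 then deriv f 0 else (f z - f 0) / (z - 0)"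
  show "?h holomorphic_on ball 0 1" by (rule pole_lemma_open[OF assms]) simp
  show "f z = f 0 + z * ?h z" for z by auto
qed

text \<open>The coefficient of \<open>z\<close> in the Laurent expansion of \<open>a\<^sub>1 / f(z)\<close> is \<open>(a\<^sub>2/a\<^sub>1)^2 - a\<^sub>3/a\<^sub>1\<close>, and
  \<open>a\<^sub>1 / f\<close> is univalent together with \<open>f\<close>.\<close>

theorem fekete_szego_univalent:
  fixes a1 a2 a3 :: real
  assumes f: "f holomorphic_on ball 0 1" "inj_on f (ball 0 1)" "f has_fps_expansion F"
    and F: "fps_nth F 0 = 0" "fps_nth F 1 = of_real a1" "fps_nth F 2 = of_real a2" "fps_nth F 3 = of_real a3"
  shows "\<bar>(a2 / a1)^2 - a3 / a1\<bar> \<le> 1"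
proof -
  have f0: "f 0 = 0" using has_fps_expansion_imp_0_eq_fps_nth_0[OF f(3)] F(1) by simp
  have fz: "f z \<noteq> 0" if "z \<noteq> 0" "cmod z < 1" for z
    using inj_onD[OF f(2), of z 0] that f0 by auto
  obtain k where k: "k holomorphic_on ball 0 1" "\<And>z. f z = z * k z"
    using holomorphic_factor[OF f(1)] f0 by auto
  have "F = fps_X * fps_expansion k 0"
    by (rule fps_eq_if_eq_on_ball[OF f(3)
          has_fps_expansion_mult[OF has_fps_expansion_fps_X holomorphic_has_fps_expansion[OF k(1)]]])
       (simp add: k)
  then have k0: "k 0 = of_real a1"
    using has_fps_expansion_imp_0_eq_fps_nth_0[OF holomorphic_has_fps_expansion[OF k(1)]] F(2) by simp
  have a1: "a1 \<noteq> 0"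
  proof -
    have "deriv f 0 \<noteq> 0"
      using holomorphic_injective_imp_regular[OF f(1) open_ball f(2)] by simp
    then show ?thesis using fps_nth_fps_expansion[OF f(3), of 1] F(2) by auto
  qed
  have kz: "k z \<noteq> 0" if "cmod z < 1" for z
    using fz[of z] k0 a1 that by (cases "z = 0") (auto simp: k)
  \<comment> \<open>\<open>a\<^sub>1 / f(z) = G(z) / z\<close> away from \<open>0\<close>\<close>
  define G where "G z = of_real a1 / k z" for z
  have holG: "G holomorphic_on ball 0 1"
    unfolding G_def using kz k(1) by (intro holomorphic_intros) auto
  obtain G1 where G1: "G1 holomorphic_on ball 0 1" "\<And>z. G z = G 0 + z * G1 z"
    using holomorphic_factor[OF holG] by blast
  obtain G2 where G2: "G2 holomorphic_on ball 0 1" "\<And>z. G1 z = G1 0 + z * G2 z"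
    using holomorphic_factor[OF G1(1)] by blast
  obtain h where h: "h holomorphic_on ball 0 1" "\<And>z. G2 z = G2 0 + z * h z"
    using holomorphic_factor[OF G2(1)] by blast
  have G0: "G 0 = 1" using a1 by (simp add: G_def k0)
  define H where "H = 1 + fps_X * (fps_const (G1 0) + fps_X * (fps_const (G2 0) + fps_X * fps_expansion h 0))"
  have "(\<lambda>z. 1 + z * (G1 0 + z * (G2 0 + z * h z))) has_fps_expansion H"
    unfolding H_def by (intro fps_expansion_intros holomorphic_has_fps_expansion h)
  moreover have G_eq: "G z = 1 + z * (G1 0 + z * (G2 0 + z * h z))" for z
    using G1(2)[of z] G2(2)[of z] h(2)[of z] G0 by simp
  ultimately have "G has_fps_expansion H" by presburger
  then have "F * H = fps_const (of_real a1) * fps_X"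
    by (intro fps_eq_if_eq_on_ball[OF has_fps_expansion_mult[OF f(3)]
          has_fps_expansion_mult[OF has_fps_expansion_const has_fps_expansion_fps_X]])
       (use kz in \<open>auto simp: k G_def\<close>)
  then have "fps_nth (F * H) 2 = 0" "fps_nth (F * H) 3 = 0"
    by (simp_all add: fps_X_def)
  moreover have "fps_nth H 0 = 1" "fps_nth H 1 = G1 0" "fps_nth H 2 = G2 0"
    unfolding H_def by (simp_all add: fps_mult_nth_upto_3 fps_X_def)
  ultimately have "of_real a2 + of_real a1 * G1 0 = 0"
      "of_real a3 + of_real a2 * G1 0 + of_real a1 * G2 0 = 0"
    by (simp_all add: fps_mult_nth_upto_3 F add_ac del: One_nat_def)
  then have "of_real (a1 * a1) * G2 0 = (of_real (a2 * a2 - a1 * a3) :: complex)"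
    unfolding of_real_mult of_real_diff by algebra
  then have G2_0: "G2 0 = of_real ((a2 / a1)^2 - a3 / a1)"
    using a1 by (simp add: field_simps power2_eq_square)
  have "inj_on (\<lambda>z. 1 / z + of_real ((a2 / a1)^2 - a3 / a1) * z + z^2 * h z) (ball 0 1 - {0})"
  proof (rule inj_onI)
    have eq: "1 / z + of_real ((a2 / a1)^2 - a3 / a1) * z + z^2 * h z = of_real a1 / f z - G1 0"
      if "z \<in> ball 0 1 - {0}" for z
    proof -
      have z: "z \<noteq> 0" using that by auto
      have "of_real a1 / f z = G z / z" using z by (simp add: k G_def)
      also have "\<dots> = 1 / z + G1 0 + G2 0 * z + z^2 * h z"
        using z by (simp add: G_eq field_simps power2_eq_square)
      finally show ?thesis by (simp add: G2_0)
    qed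
    fix z w assume z: "z \<in> ball 0 1 - {0}" and w: "w \<in> ball 0 1 - {0}"
      and e: "1 / z + of_real ((a2 / a1)^2 - a3 / a1) * z + z^2 * h z
            = 1 / w + of_real ((a2 / a1)^2 - a3 / a1) * w + w^2 * h w"
    then have "of_real a1 / f z = of_real a1 / f w" unfolding eq[OF z] eq[OF w] by simp
    then have "f z = f w" using a1 by (auto simp: frac_eq_eq fz)
    then show "z = w" using inj_onD[OF f(2)] z w by auto
  qed
  from area_theorem[OF h(1) this] show ?thesis .
qed

text \<open>One step of the Schur algorithm. The equation is written without a denominator, so that it also
  covers a constant \<open>v\<close> of modulus \<open>1\<close>, with \<open>m = 0\<close>.\<close>

lemma schwarz_step:
  assumes v: "v holomorphic_on ball 0 1" "\<And>z. cmod z < 1 \<Longrightarrow> cmod (v z) \<le> 1"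
  obtains m where "m holomorphic_on ball 0 1" "\<And>z. cmod z < 1 \<Longrightarrow> cmod (m z) \<le> 1"
    "\<And>z. cmod z < 1 \<Longrightarrow> v z = v 0 + z * m z * (1 - cnj (v 0) * v z)"
proof (cases "cmod (v 0) = 1")
  case True
  have "v constant_on ball 0 1"
    by (rule maximum_modulus_principle[OF v(1), of "ball 0 1" 0]) (use v(2) True in auto)
  then have const: "v z = v 0" if "cmod z < 1" for z
    using that unfolding constant_on_def by force
  show ?thesis by (rule that[of "\<lambda>_. 0"]) (auto dest: const)
next
  case False
  then have c: "cmod (v 0) < 1" using v(2)[of 0] by simp
  have lt: "cmod (v z) < 1" if z: "cmod z < 1" for z
  proof (rule ccontr)
    assume "\<not> cmod (v z) < 1"
    then have "cmod (v z) = 1" using v(2)[OF z] by simp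
    then have "v constant_on ball 0 1"
      by (intro maximum_modulus_principle[OF v(1), of "ball 0 1" z]) (use v(2) z in auto)
    then have "v z = v 0" using z unfolding constant_on_def by force
    with \<open>cmod (v z) = 1\<close> False show False by simp
  qed
  have nz: "1 - cnj (v 0) * v z \<noteq> 0" if z: "cmod z < 1" for z
  proof
    assume "1 - cnj (v 0) * v z = 0"
    then have "cmod (cnj (v 0) * v z) = 1" by simp
    moreover have "cmod (v 0) * cmod (v z) < 1 * 1"
      using c lt[OF z] by (intro mult_strict_mono') auto
    ultimately show False by (simp add: norm_mult)
  qed
  define M where "M z = (v z - v 0) / (1 - cnj (v 0) * v z)" for z
  have holM: "M holomorphic_on ball 0 1"
    unfolding M_def using nz by (intro holomorphic_intros v(1)) auto
  have M0: "M 0 = 0" by (simp add: M_def)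
  have M1: "cmod (M z) < 1" if "cmod z < 1" for z
    using Moebius_function_norm_lt_1[OF c lt[OF that], of 0] by (simp add: Moebius_function_simple M_def)
  obtain m where m: "m holomorphic_on ball 0 1" "\<And>z. cmod z < 1 \<Longrightarrow> M z = z * m z" "deriv M 0 = m 0"
    by (rule Schwarz3[OF holM M0]) auto
  show ?thesis
  proof (rule that[OF m(1)])
    fix z assume z: "cmod z < 1"
    show "cmod (m z) \<le> 1"
    proof (cases "z = 0")
      case True
      then show ?thesis using Schwarz_Lemma(2)[OF holM M0 M1, of 0] m(3) by simp
    next
      case False
      have "cmod (M z) \<le> cmod z" by (rule Schwarz_Lemma(1)[OF holM M0 M1 z])
      then show ?thesis using False m(2)[OF z] by (simp add: norm_mult)
    qed
    show "v z = v 0 + z * m z * (1 - cnj (v 0) * v z)"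
      using m(2)[OF z] nz[OF z] by (simp add: M_def field_simps)
  qed
qed

text \<open>Three steps of the Schur algorithm, read off as equations between power series.\<close>

theorem schwarz_coefficients:
  assumes w: "w holomorphic_on ball 0 1" "w 0 = 0" "\<And>z. cmod z < 1 \<Longrightarrow> cmod (w z) < 1"
    and W: "w has_fps_expansion W"
  shows "schwarz_triple (fps_nth W 1) (fps_nth W 2) (fps_nth W 3)"
proof -
  have w': "cmod (w z) \<le> 1" if "cmod z < 1" for z using w(3)[OF that] by simp
  obtain v where v: "v holomorphic_on ball 0 1" "\<And>z. cmod z < 1 \<Longrightarrow> cmod (v z) \<le> 1"
    "\<And>z. cmod z < 1 \<Longrightarrow> w z = z * v z"
    by (rule schwarz_step[OF w(1) w']) (auto simp: w(2))
  obtain m where m: "m holomorphic_on ball 0 1" "\<And>z. cmod z < 1 \<Longrightarrow> cmod (m z) \<le> 1"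
    "\<And>z. cmod z < 1 \<Longrightarrow> v z = v 0 + z * m z * (1 - cnj (v 0) * v z)"
    using schwarz_step[OF v(1,2)] by blast
  obtain y where y: "y holomorphic_on ball 0 1" "\<And>z. cmod z < 1 \<Longrightarrow> cmod (y z) \<le> 1"
    "\<And>z. cmod z < 1 \<Longrightarrow> m z = m 0 + z * y z * (1 - cnj (m 0) * m z)"
    using schwarz_step[OF m(1,2)] by blast
  define V M Y where "V = fps_expansion v 0" and "M = fps_expansion m 0" and "Y = fps_expansion y 0"
  have exp: "v has_fps_expansion V" "m has_fps_expansion M" "y has_fps_expansion Y"
    unfolding V_def M_def Y_def by (intro holomorphic_has_fps_expansion v m y)+
  have WV: "W = fps_X * V"
    by (rule fps_eq_if_eq_on_ball[OF W has_fps_expansion_mult[OF has_fps_expansion_fps_X exp(1)]])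
       (rule v(3))
  have VM: "V = fps_const (v 0) + fps_X * M * (1 - fps_const (cnj (v 0)) * V)"
    by (rule fps_eq_if_eq_on_ball[OF exp(1) _ m(3)]) (intro fps_expansion_intros exp)
  have MY: "M = fps_const (m 0) + fps_X * Y * (1 - fps_const (cnj (m 0)) * M)"
    by (rule fps_eq_if_eq_on_ball[OF exp(2) _ y(3)]) (intro fps_expansion_intros exp)
  define c where "c = v 0"
  have 0: "fps_nth V 0 = c" "fps_nth M 0 = m 0" "fps_nth Y 0 = y 0"
    using exp[THEN has_fps_expansion_imp_0_eq_fps_nth_0] by (simp_all add: c_def)
  have sq: "(of_real (cmod z))^2 = cnj z * z" for z
    using complex_norm_square[of z] by (simp add: mult.commute)
  have V1: "fps_nth V 1 = m 0 * (1 - of_real ((cmod c)^2))"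
    by (subst VM) (simp add: mult.assoc 0 sq c_def[symmetric])
  have M1: "fps_nth M 1 = y 0 * (1 - of_real ((cmod (m 0))^2))"
    by (subst MY) (simp add: mult.assoc 0 sq)
  have V2: "fps_nth V 2 = fps_nth M 1 * (1 - of_real ((cmod c)^2)) - m 0 * cnj c * fps_nth V 1"
    by (subst VM) (simp add: mult.assoc 0 sq[unfolded power2_eq_square] c_def[symmetric] numeral_2_eq_2 fps_mult_nth_1)
  have W_nth: "fps_nth W 1 = c" "fps_nth W 2 = fps_nth V 1" "fps_nth W 3 = fps_nth V 2"
    unfolding WV by (simp_all add: 0 numeral_2_eq_2 numeral_3_eq_3)
  show ?thesis
    unfolding schwarz_triple_def W_nth
  proof (intro conjI exI)
    show "cmod c \<le> 1" "cmod (m 0) \<le> 1" "cmod (y 0) \<le> 1"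
      using v(2)[of 0] m(2)[of 0] y(2)[of 0] by (simp_all add: c_def)
    show "fps_nth V 1 = of_real (1 - (cmod c)^2) * m 0" unfolding V1 by (simp add: mult.commute)
    show "fps_nth V 2 = of_real (1 - (cmod c)^2) * (of_real (1 - (cmod (m 0))^2) * y 0 - cnj c * (m 0)^2)"
      unfolding V2 V1 M1 by (simp add: algebra_simps power2_eq_square)
  qed
qed

text \<open>The functions \<open>\<Phi>\<close> and \<open>cnj \<circ> \<Phi> \<circ> cnj\<close> have the same image, the same value and the same derivative at
  \<open>0\<close>; by the Schwarz lemma the transition map \<open>\<sigma>\<close> between them is the identity.\<close>

lemma admissible_symmetric:
  assumes \<Phi>: "admissible \<Phi>" and z: "cmod z < 1"
  shows "cnj (\<Phi> (cnj z)) = \<Phi> z"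
proof -
  obtain \<Psi> where hol: "\<Phi> holomorphic_on ball 0 1" and \<Psi>: "\<Psi> holomorphic_on (\<Phi> ` ball 0 1)"
      "\<And>\<zeta>. cmod \<zeta> < 1 \<Longrightarrow> \<Psi> (\<Phi> \<zeta>) = \<zeta>" and \<Phi>0: "\<Phi> 0 = 1"
    and d: "deriv \<Phi> 0 \<in> \<real>" "Re (deriv \<Phi> 0) > 0" and sym: "cnj ` \<Phi> ` ball 0 1 = \<Phi> ` ball 0 1"
    using \<Phi> unfolding admissible_def by auto
  define \<Phi>' where "\<Phi>' = cnj \<circ> \<Phi> \<circ> cnj"
  have "cnj ` ball 0 1 = ball 0 1" by (auto simp: image_iff intro!: bexI[where x = "cnj x" for x])
  then have hol': "\<Phi>' holomorphic_on ball 0 1"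
    unfolding \<Phi>'_def using hol by (intro holomorphic_on_compose_cnj_cnj) auto
  have mem: "\<Phi>' x \<in> \<Phi> ` ball 0 1" if "cmod x < 1" for x
  proof -
    have "\<Phi>' x \<in> cnj ` \<Phi> ` ball 0 1" using that by (auto simp: \<Phi>'_def)
    then show ?thesis by (simp only: sym)
  qed
  define \<sigma> where "\<sigma> = \<Psi> \<circ> \<Phi>'"
  have hol\<sigma>: "\<sigma> holomorphic_on ball 0 1"
    unfolding \<sigma>_def by (rule holomorphic_on_compose_gen[OF hol' \<Psi>(1)]) (use mem in auto)
  have \<sigma>: "cmod (\<sigma> x) < 1" "\<Phi> (\<sigma> x) = \<Phi>' x" if x: "cmod x < 1" for x
    using mem[OF x] \<Psi>(2) by (auto simp: \<sigma>_def)
  have \<sigma>0: "\<sigma> 0 = 0" using \<Psi>(2)[of 0] by (simp add: \<sigma>_def \<Phi>'_def \<Phi>0)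
  have "deriv (\<Phi> \<circ> \<sigma>) 0 = deriv \<Phi> (\<sigma> 0) * deriv \<sigma> 0"
    by (rule deriv_chain) (use hol hol\<sigma> \<sigma>0 in \<open>auto intro!: holomorphic_on_imp_differentiable_at[of _ "ball 0 1"]\<close>)
  moreover have "deriv (\<Phi> \<circ> \<sigma>) 0 = deriv \<Phi>' 0"
  proof (rule deriv_cong_ev)
    have "eventually (\<lambda>x. x \<in> ball (0::complex) 1) (nhds 0)" by (intro eventually_nhds_in_open) auto
    then show "\<forall>\<^sub>F x in nhds 0. (\<Phi> \<circ> \<sigma>) x = \<Phi>' x" by eventually_elim (use \<sigma> in auto)
  qed simp
  moreover have "deriv \<Phi>' 0 = deriv \<Phi> 0"
  proof -
    have "(\<Phi> has_field_derivative deriv \<Phi> 0) (at (cnj 0))"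
      using holomorphic_derivI[OF hol, of 0] by simp
    then have "(\<Phi>' has_field_derivative cnj (deriv \<Phi> 0)) (at 0)"
      unfolding \<Phi>'_def by (metis complex_cnj_cnj has_field_derivative_cnj_cnj)
    then show ?thesis using d(1) by (simp add: DERIV_imp_deriv Reals_cnj_iff)
  qed
  moreover have "deriv \<Phi> 0 \<noteq> 0" using d(2) by auto
  ultimately have d1: "deriv \<sigma> 0 = 1" by (simp add: \<sigma>0)
  then obtain \<alpha> where \<alpha>: "\<And>x. cmod x < 1 \<Longrightarrow> \<sigma> x = \<alpha> * x"
    using Schwarz_Lemma(3)[OF hol\<sigma> \<sigma>0 \<sigma>(1), of 0] by auto
  have "deriv \<sigma> 0 = deriv (\<lambda>x. \<alpha> * x) 0"
  proof (rule deriv_cong_ev)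
    have "eventually (\<lambda>x. x \<in> ball (0::complex) 1) (nhds 0)" by (intro eventually_nhds_in_open) auto
    then show "\<forall>\<^sub>F x in nhds 0. \<sigma> x = \<alpha> * x" by eventually_elim (use \<alpha> in auto)
  qed simp
  then have "\<alpha> = 1" using d1 by simp
  then show ?thesis using \<sigma>(2)[OF z] \<alpha>[OF z] by (simp add: \<Phi>'_def)
qed

lemma admissible_taylor:
  assumes \<Phi>: "admissible \<Phi>"
  obtains P where "\<Phi> has_fps_expansion P" "\<And>n. fps_nth P n = of_real (taylor_coeff \<Phi> n)"
proof -
  have hol: "\<Phi> holomorphic_on ball 0 1" using \<Phi> by (simp add: admissible_def)
  define P where "P = fps_expansion \<Phi> 0"
  have P: "\<Phi> has_fps_expansion P" unfolding P_def by (rule holomorphic_has_fps_expansion[OF hol])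
  have sums: "(\<lambda>n. fps_nth P n * z ^ n) sums \<Phi> z" if "cmod z < 1" for z
    using holomorphic_power_series[OF hol, of z] that by (simp add: P_def fps_expansion_def)
  have "\<Phi> has_fps_expansion Abs_fps (\<lambda>n. cnj (fps_nth P n))"
  proof (rule has_fps_expansionI)
    have "eventually (\<lambda>x. x \<in> ball (0::complex) 1) (nhds 0)" by (intro eventually_nhds_in_open) auto
    then show "\<forall>\<^sub>F u in nhds 0. (\<lambda>n. fps_nth (Abs_fps (\<lambda>n. cnj (fps_nth P n))) n * u ^ n) sums \<Phi> u"
    proof eventually_elim
      case (elim u)
      then have u: "cmod u < 1" by simp
      have "(\<lambda>n. cnj (fps_nth P n * cnj u ^ n)) sums cnj (\<Phi> (cnj u))"
        using sums[of "cnj u"] u by (subst sums_cnj) simp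
      then show ?case using admissible_symmetric[OF \<Phi> u] by simp
    qed
  qed
  then have "P = Abs_fps (\<lambda>n. cnj (fps_nth P n))" by (rule fps_expansion_unique_complex[OF P])
  then have "cnj (fps_nth P n) = fps_nth P n" for n by (metis fps_nth_Abs_fps)
  then have "fps_nth P n \<in> \<real>" for n by (simp add: Reals_cnj_iff)
  then have "fps_nth P n = of_real (Re (fps_nth P n))" for n by (simp add: of_real_Re)
  then show ?thesis
    using P by (intro that[of P]) (auto simp: taylor_coeff_def fps_nth_fps_expansion[OF P, symmetric])
qed

text \<open>The map \<open>a \<mapsto> a - 1/a\<close> is injective on the right half-plane, so \<open>\<Phi> - 1/\<Phi>\<close> is univalent. Its
  coefficient inequality reads \<open>Y + B\<^sub>1\<^sup>2/4 - X\<^sup>2 \<le> 1\<close> with \<open>X = B\<^sub>2/B\<^sub>1\<close> and \<open>Y = B\<^sub>3/B\<^sub>1\<close>, and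
  the left-hand side exceeds \<open>q\<^sub>2\<close> by a positive definite quadratic form in \<open>X\<close> and \<open>B\<^sub>1\<close>.\<close>

lemma admissible_q2_less_1:
  fixes B1 B2 B3 :: real
  assumes \<Phi>: "admissible \<Phi>"
    and B: "B1 = taylor_coeff \<Phi> 1" "B2 = taylor_coeff \<Phi> 2" "B3 = taylor_coeff \<Phi> 3"
  shows "0 < B1" "- (2 * B1^4 + 3 * B1^2 * B2 - 2 * B1 * B3 + 3 * B2^2) / (2 * B1^2) < 1"
proof -
  have hol: "\<Phi> holomorphic_on ball 0 1" and \<Phi>0: "\<Phi> 0 = 1"
    and pos: "\<And>\<zeta>. cmod \<zeta> < 1 \<Longrightarrow> Re (\<Phi> \<zeta>) > 0"
    and d: "Re (deriv \<Phi> 0) > 0" and inj: "inj_on \<Phi> (ball 0 1)"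
    using \<Phi> unfolding admissible_def by (auto intro: inj_on_inverseI)
  show B1: "0 < B1" using d by (simp add: B taylor_coeff_def)
  obtain P where P: "\<Phi> has_fps_expansion P" "\<And>n. fps_nth P n = of_real (taylor_coeff \<Phi> n)"
    using admissible_taylor[OF \<Phi>] by blast
  have P0: "fps_nth P 0 = 1" using has_fps_expansion_imp_0_eq_fps_nth_0[OF P(1)] \<Phi>0 by simp
  have P123: "fps_nth P 1 = of_real B1" "fps_nth P 2 = of_real B2" "fps_nth P 3 = of_real B3"
    by (simp_all add: P B)
  have nz: "\<Phi> z \<noteq> 0" if "cmod z < 1" for z using pos[OF that] by auto
  \<comment> \<open>up to a factor this is \<open>w / (1 - w\<^sup>2)\<close> for the univalent \<open>w = (\<Phi> - 1)/(\<Phi> + 1)\<close>\<close>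
  define f where "f z = \<Phi> z - 1 / \<Phi> z" for z
  have holf: "f holomorphic_on ball 0 1" unfolding f_def using nz by (intro holomorphic_intros hol) auto
  have injf: "inj_on f (ball 0 1)"
  proof (rule inj_onI)
    fix z w :: complex assume z: "z \<in> ball 0 1" and w: "w \<in> ball 0 1" and e: "f z = f w"
    define a b where "a = \<Phi> z" and "b = \<Phi> w"
    have ab: "Re a > 0" "Re b > 0" "a \<noteq> 0" "b \<noteq> 0" using pos nz z w by (auto simp: a_def b_def)
    have "(a - b) * (a * b + 1) = 0"
      using e ab by (simp add: f_def a_def[symmetric] b_def[symmetric] field_simps)
    moreover have "a * b + 1 \<noteq> 0"
    proof
      assume "a * b + 1 = 0"
      then have "a = - (1 / b)" using ab by (simp add: field_simps eq_neg_iff_add_eq_0)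
      then have "Re a = - (Re b / (cmod b)^2)" by (simp add: Re_divide cmod_power2)
      moreover have "Re b / (cmod b)^2 > 0" using ab by simp
      ultimately show False using ab(1) by linarith
    qed
    ultimately show "z = w" using inj_onD[OF inj _ z w] by (simp add: a_def b_def)
  qed
  define F where "F = fps_expansion f 0"
  have F: "f has_fps_expansion F" unfolding F_def by (rule holomorphic_has_fps_expansion[OF holf])
  have "F * P = P * P - 1"
    by (rule fps_eq_if_eq_on_ball[OF has_fps_expansion_mult[OF F P(1)]
          has_fps_expansion_diff[OF has_fps_expansion_mult[OF P(1) P(1)] has_fps_expansion_1]])
       (use nz in \<open>auto simp: f_def left_diff_distrib\<close>)
  then have e: "fps_nth (F * P) n = fps_nth (P * P - 1) n" for n by simp
  have F0: "fps_nth F 0 = 0" using has_fps_expansion_imp_0_eq_fps_nth_0[OF F] by (simp add: f_def \<Phi>0)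
  have F1: "fps_nth F 1 = of_real (2 * B1)"
    using e[of 1] by (simp add: fps_mult_nth_1 F0 P0 P123 del: One_nat_def)
  have F2: "fps_nth F 2 = of_real (2 * B2 - B1\<^sup>2)"
    using e[of 2] by (simp add: fps_mult_nth_2 F0 F1 P0 P123 power2_eq_square algebra_simps del: One_nat_def)
  have F3: "fps_nth F 3 = of_real (2 * B3 - 2 * B1 * B2 + B1 ^ 3)"
    using e[of 3] by (simp add: fps_mult_nth_3 F0 F1 F2 P0 P123 power2_eq_square power3_eq_cube algebra_simps del: One_nat_def)
  have fs: "\<bar>((2 * B2 - B1\<^sup>2) / (2 * B1))^2 - (2 * B3 - 2 * B1 * B2 + B1 ^ 3) / (2 * B1)\<bar> \<le> 1"
    by (rule fekete_szego_univalent[OF holf injf F F0 F1 F2 F3])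
  define X Y where "X = B2 / B1" and "Y = B3 / B1"
  have X: "B2 = X * B1" and Y: "B3 = Y * B1" using B1 by (simp_all add: X_def Y_def)
  have "((2 * B2 - B1\<^sup>2) / (2 * B1))^2 = (X - B1 / 2)^2"
    using B1 by (simp add: X diff_divide_distrib power2_eq_square)
  moreover have "(2 * B3 - 2 * B1 * B2 + B1 ^ 3) / (2 * B1) = Y - X * B1 + B1^2 / 2"
    using B1 by (simp add: X Y field_simps power2_eq_square power3_eq_cube)
  ultimately have "Y - X * B1 + B1^2 / 2 - (X - B1 / 2)^2 \<le> 1" using fs by linarith
  then have le: "Y + B1^2 / 4 - X\<^sup>2 \<le> 1" by (simp add: power2_eq_square algebra_simps)
  have "- (2 * B1^4 + 3 * B1^2 * B2 - 2 * B1 * B3 + 3 * B2^2) / (2 * B1^2)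
      = - B1\<^sup>2 - 3 / 2 * (X * B1) + Y - 3 / 2 * X^2"
    using B1 by (simp add: X Y field_simps power2_eq_square power4_eq_xxxx)
  also have "\<dots> = (Y + B1^2 / 4 - X\<^sup>2) - ((X + 3 / 2 * B1)^2 / 2 + B1^2 / 8)"
    by (simp add: power2_eq_square algebra_simps)
  also have "\<dots> < 1"
  proof -
    have "0 < (X + 3 / 2 * B1)^2 / 2 + B1^2 / 8" using B1 by (intro add_nonneg_pos) auto
    with le show ?thesis by linarith
  qed
  finally show "- (2 * B1^4 + 3 * B1^2 * B2 - 2 * B1 * B3 + 3 * B2^2) / (2 * B1^2) < 1" .
qed


section \<open>Norming functionals\<close>

definition sublinear :: "('a::real_vector \<Rightarrow> real) \<Rightarrow> bool"
  where "sublinear p \<longleftrightarrow> (\<forall>x y. p (x + y) \<le> p x + p y) \<and> (\<forall>r x. 0 < r \<longrightarrow> p (r *\<^sub>R x) \<le> r * p x)"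

lemma sublinear_add: "sublinear p \<Longrightarrow> p (x + y) \<le> p x + p y"
  and sublinear_scale_le: "sublinear p \<Longrightarrow> 0 < r \<Longrightarrow> p (r *\<^sub>R x) \<le> r * p x"
  by (auto simp: sublinear_def)

lemma sublinear_0: assumes "sublinear p" shows "p 0 = 0"
  using sublinear_scale_le[OF assms, of 2 0] sublinear_scale_le[OF assms, of "1/2" 0] by simp

lemma sublinear_scale: assumes "sublinear p" "0 \<le> r" shows "p (r *\<^sub>R x) = r * p x"
proof (cases "r = 0")
  case False
  then have r: "0 < r" using assms(2) by simp
  have "p ((1 / r) *\<^sub>R r *\<^sub>R x) \<le> (1 / r) * p (r *\<^sub>R x)"
    using r by (intro sublinear_scale_le assms) auto
  then have "r * p x \<le> p (r *\<^sub>R x)" using r by (simp add: field_simps)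
  then show ?thesis using sublinear_scale_le[OF assms(1) r, of x] by simp
qed (simp add: sublinear_0 assms)

lemma sublinear_minus: assumes "sublinear p" shows "- p (- x) \<le> p x"
  using sublinear_add[OF assms, of x "- x"] sublinear_0[OF assms] by simp

text \<open>The largest sublinear functional \<open>q \<le> p\<close> with \<open>q(-y) \<le> -p(y)\<close>. A sublinear \<open>p\<close> that is minimal
  equals all its cuts and is therefore odd, hence linear.\<close>

definition sublinear_cut :: "('a::real_vector \<Rightarrow> real) \<Rightarrow> 'a \<Rightarrow> 'a \<Rightarrow> real"
  where "sublinear_cut p y x = (INF t\<in>{0..}. p (x + t *\<^sub>R y) - t * p y)"

lemma sublinear_cut_bdd:
  assumes "sublinear p"
  shows "bdd_below ((\<lambda>t. p (x + t *\<^sub>R y) - t * p y) ` {0..})"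
proof (rule bdd_belowI2)
  fix t :: real assume "t \<in> {0..}"
  then have "t * p y = p (t *\<^sub>R y)" using sublinear_scale[OF assms] by simp
  also have "\<dots> \<le> p (x + t *\<^sub>R y) + p (- x)"
    using sublinear_add[OF assms, of "x + t *\<^sub>R y" "- x"] by simp
  finally show "- p (- x) \<le> p (x + t *\<^sub>R y) - t * p y" by simp
qed

lemma sublinear_cut_le:
  assumes "sublinear p" "0 \<le> t"
  shows "sublinear_cut p y x \<le> p (x + t *\<^sub>R y) - t * p y"
  unfolding sublinear_cut_def using assms by (intro cINF_lower sublinear_cut_bdd) auto

lemma sublinear_cut_greatest:
  assumes "\<And>t. 0 \<le> t \<Longrightarrow> m \<le> p (x + t *\<^sub>R y) - t * p y"
  shows "m \<le> sublinear_cut p y x"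
  unfolding sublinear_cut_def using assms by (intro cINF_greatest) auto

lemma sublinear_sublinear_cut:
  assumes p: "sublinear p"
  shows "sublinear (sublinear_cut p y)"
  unfolding sublinear_def
proof (intro conjI allI impI)
  fix x1 x2
  have "sublinear_cut p y (x1 + x2) - (p (x2 + t *\<^sub>R y) - t * p y) \<le> sublinear_cut p y x1"
    if t: "0 \<le> t" for t
  proof (rule sublinear_cut_greatest)
    fix s :: real assume s: "0 \<le> s"
    have "sublinear_cut p y (x1 + x2) \<le> p (x1 + x2 + (s + t) *\<^sub>R y) - (s + t) * p y"
      using s t by (intro sublinear_cut_le p) auto
    also have "p (x1 + x2 + (s + t) *\<^sub>R y) \<le> p (x1 + s *\<^sub>R y) + p (x2 + t *\<^sub>R y)"
      using sublinear_add[OF p, of "x1 + s *\<^sub>R y" "x2 + t *\<^sub>R y"] by (simp add: algebra_simps)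
    finally show "sublinear_cut p y (x1 + x2) - (p (x2 + t *\<^sub>R y) - t * p y) \<le> p (x1 + s *\<^sub>R y) - s * p y"
      by (simp add: algebra_simps)
  qed
  then have "sublinear_cut p y (x1 + x2) - sublinear_cut p y x1 \<le> sublinear_cut p y x2"
    by (intro sublinear_cut_greatest) (auto simp: algebra_simps)
  then show "sublinear_cut p y (x1 + x2) \<le> sublinear_cut p y x1 + sublinear_cut p y x2" by simp
next
  fix r :: real and x assume r: "0 < r"
  have "sublinear_cut p y (r *\<^sub>R x) / r \<le> sublinear_cut p y x"
  proof (rule sublinear_cut_greatest)
    fix t :: real assume t: "0 \<le> t"
    have "sublinear_cut p y (r *\<^sub>R x) \<le> p (r *\<^sub>R x + (r * t) *\<^sub>R y) - (r * t) * p y"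
      using r t by (intro sublinear_cut_le p) auto
    also have "p (r *\<^sub>R x + (r * t) *\<^sub>R y) = r * p (x + t *\<^sub>R y)"
      using sublinear_scale[OF p, of r "x + t *\<^sub>R y"] r by (simp add: algebra_simps)
    finally show "sublinear_cut p y (r *\<^sub>R x) / r \<le> p (x + t *\<^sub>R y) - t * p y"
      using r by (simp add: field_simps)
  qed
  then show "sublinear_cut p y (r *\<^sub>R x) \<le> r * sublinear_cut p y x"
    using r by (simp add: field_simps)
qed

text \<open>Zorn's lemma: the pointwise infimum of a chain of sublinear functionals below \<open>N\<close> is finite, since
  \<open>p(x) \<ge> -N(-x)\<close>, and sublinear.\<close>

lemma exists_minimal_sublinear:
  assumes N: "sublinear N"
  shows "\<exists>p. sublinear p \<and> (\<forall>x. p x \<le> N x) \<and> (\<forall>q. sublinear q \<longrightarrow> (\<forall>x. q x \<le> p x) \<longrightarrow> q = p)"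
proof -
  define A where "A = {p. sublinear p \<and> (\<forall>x. p x \<le> N x)}"
  define P :: "('a \<Rightarrow> real) \<Rightarrow> ('a \<Rightarrow> real) \<Rightarrow> bool" where "P a b \<longleftrightarrow> (\<forall>x. b x \<le> a x)" for a b
  have "\<exists>m\<in>A. \<forall>a\<in>A. P m a \<longrightarrow> a = m"
  proof (rule predicate_Zorn)
    show "partial_order_on A (relation_of P A)"
      by (rule partial_order_on_relation_ofI) (auto simp: P_def fun_eq_iff intro: order_trans antisym)
    fix C assume C: "C \<in> Chains (relation_of P A)"
    then have CA: "C \<subseteq> A" and chain: "\<And>p q. p \<in> C \<Longrightarrow> q \<in> C \<Longrightarrow> P p q \<or> P q p"
      by (auto simp: Chains_def relation_of_def)
    show "\<exists>u\<in>A. \<forall>a\<in>C. P a u"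
    proof (cases "C = {}")
      case True
      then show ?thesis using N by (auto simp: A_def)
    next
      case False
      define u where "u x = (INF p\<in>C. p x)" for x
      have bdd: "bdd_below ((\<lambda>p. p x) ` C)" for x
      proof (rule bdd_belowI2)
        fix p assume "p \<in> C"
        then have "sublinear p" "p (- x) \<le> N (- x)" using CA by (auto simp: A_def)
        then show "- N (- x) \<le> p x" using sublinear_minus[of p x] by simp
      qed
      have le: "u x \<le> p x" if "p \<in> C" for p x unfolding u_def using that bdd by (rule cINF_lower[rotated])
      have greatest: "m \<le> u x" if "\<And>p. p \<in> C \<Longrightarrow> m \<le> p x" for m x
        unfolding u_def using False that by (rule cINF_greatest)
      have "sublinear u" unfolding sublinear_def
      proof (intro conjI allI impI)
        fix x y
        have two: "u (x + y) \<le> p x + q y" if p: "p \<in> C" and q: "q \<in> C" for p q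
        proof -
          obtain m where m: "m \<in> C" "m x \<le> p x" "m y \<le> q y"
            using chain[OF p q] p q unfolding P_def by blast
          have "u (x + y) \<le> m (x + y)" by (rule le[OF m(1)])
          also have "\<dots> \<le> m x + m y" using m(1) CA by (intro sublinear_add) (auto simp: A_def)
          finally show ?thesis using m by simp
        qed
        have "u (x + y) - q y \<le> u x" if "q \<in> C" for q
          by (rule greatest) (use two that in \<open>simp add: algebra_simps\<close>)
        then have "u (x + y) - u x \<le> u y" by (intro greatest) (simp add: algebra_simps)
        then show "u (x + y) \<le> u x + u y" by simp
      next
        fix r :: real and x assume r: "0 < r"
        have "u (r *\<^sub>R x) / r \<le> u x"
        proof (rule greatest)
          fix p assume p: "p \<in> C"
          then have "p (r *\<^sub>R x) = r * p x" using CA r by (intro sublinear_scale) (auto simp: A_def)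
          then show "u (r *\<^sub>R x) / r \<le> p x" using le[OF p, of "r *\<^sub>R x"] r by (simp add: field_simps)
        qed
        then show "u (r *\<^sub>R x) \<le> r * u x" using r by (simp add: field_simps)
      qed
      moreover have "u x \<le> N x" for x
      proof -
        obtain p where p: "p \<in> C" using False by blast
        then have "p x \<le> N x" using CA by (auto simp: A_def)
        then show ?thesis using le[OF p, of x] by linarith
      qed
      ultimately have "u \<in> A" by (simp add: A_def)
      then show ?thesis using le unfolding P_def by blast
    qed
  qed
  then obtain m where m: "sublinear m" "\<And>x. m x \<le> N x" and max: "\<And>q. q \<in> A \<Longrightarrow> P m q \<Longrightarrow> q = m"
    by (auto simp: A_def)
  have "q = m" if q: "sublinear q" "\<forall>x. q x \<le> m x" for q
  proof (rule max)
    have "q x \<le> N x" for x using q(2) m(2) order_trans by blast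
    then show "q \<in> A" using q(1) by (simp add: A_def)
    show "P m q" using q(2) by (simp add: P_def)
  qed
  with m show ?thesis by blast
qed

lemma minimal_sublinear_linear:
  assumes p: "sublinear p" and min: "\<And>q. sublinear q \<Longrightarrow> (\<And>x. q x \<le> p x) \<Longrightarrow> q = p"
  shows "linear p"
proof -
  have odd: "p (- y) = - p y" for y
  proof (rule antisym)
    have "sublinear_cut p y = p"
      by (rule min[OF sublinear_sublinear_cut[OF p]]) (use sublinear_cut_le[OF p, of 0] in auto)
    then show "p (- y) \<le> - p y"
      using sublinear_cut_le[OF p, of 1 y "- y"] sublinear_0[OF p] by simp
    show "- p y \<le> p (- y)" using sublinear_minus[OF p, of "- y"] by simp
  qed
  show ?thesis
  proof (rule linearI)
    fix x y
    have "- p (x + y) \<le> - p x - p y" using sublinear_add[OF p, of "- x" "- y"] odd[of "x + y"] by (simp add: odd)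
    then show "p (x + y) = p x + p y" using sublinear_add[OF p, of x y] by simp
  next
    fix r :: real and x
    show "p (r *\<^sub>R x) = r *\<^sub>R p x"
      using sublinear_scale[OF p, of r x] sublinear_scale[OF p, of "- r" x] odd[of "r *\<^sub>R x"]
      by (cases "0 \<le> r") auto
  qed
qed

text \<open>A minimal sublinear functional below the cut of the norm in direction \<open>x\<^sub>0\<close>; the cut makes its
  value at \<open>-x\<^sub>0\<close> at most \<open>-\<bar>x\<^sub>0\<bar>\<close>.\<close>

lemma real_norming_functional:
  fixes x0 :: "'a::real_normed_vector"
  shows "\<exists>u :: 'a \<Rightarrow> real. linear u \<and> (\<forall>x. u x \<le> norm x) \<and> u x0 = norm x0"
proof -
  have N: "sublinear (norm :: 'a \<Rightarrow> real)" by (auto simp: sublinear_def norm_triangle_ineq)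
  obtain u where u: "sublinear u" "\<And>x. u x \<le> sublinear_cut norm x0 x"
    and min: "\<And>q. sublinear q \<Longrightarrow> (\<And>x. q x \<le> u x) \<Longrightarrow> q = u"
    using exists_minimal_sublinear[OF sublinear_sublinear_cut[OF N, of x0]] by blast
  have lin: "linear u" by (rule minimal_sublinear_linear[OF u(1) min])
  have le: "u x \<le> norm x" for x
    using u(2)[of x] sublinear_cut_le[OF N, of 0 x0 x] by simp
  have "u (- x0) \<le> - norm x0"
    using u(2)[of "- x0"] sublinear_cut_le[OF N, of 1 x0 "- x0"] by simp
  then have "norm x0 \<le> u x0" using linear_neg[OF lin, of x0] by simp
  then have "u x0 = norm x0" using le[of x0] by simp
  with lin le show ?thesis by blast
qed

lemma scaleC_minus_left: "(- c) *\<^sub>C (x :: 'a::complex_normed_vector) = - (c *\<^sub>C x)"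
  and scaleC_zero_left: "0 *\<^sub>C (x :: 'a::complex_normed_vector) = 0"
  and scaleC_zero_right: "c *\<^sub>C (0 :: 'a::complex_normed_vector) = 0"
proof -
  show z: "0 *\<^sub>C x = 0" for x :: 'a using scaleC_of_real[of 0 x] by simp
  show "c *\<^sub>C (0 :: 'a) = 0" using norm_scaleC[of c "0::'a"] by simp
  have "(- c) *\<^sub>C x + c *\<^sub>C x = 0" using scaleC_add_left[of "- c" c x] z by simp
  then show "(- c) *\<^sub>C x = - (c *\<^sub>C x)" by (simp add: eq_neg_iff_add_eq_0)
qed

lemma scaleC_minus_right: "c *\<^sub>C (- x :: 'a::complex_normed_vector) = - (c *\<^sub>C x)"
  using scaleC_add_right[of c "- x" x] by (simp add: scaleC_zero_right eq_neg_iff_add_eq_0)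

lemma scaleC_diff_right: "c *\<^sub>C (x - y :: 'a::complex_normed_vector) = c *\<^sub>C x - c *\<^sub>C y"
  using scaleC_add_right[of c x "- y"] by (simp add: scaleC_minus_right)

lemma scaleC_scaleR: "c *\<^sub>C r *\<^sub>R x = r *\<^sub>R c *\<^sub>C (x :: 'a::complex_normed_vector)"
  by (simp add: scaleC_of_real[symmetric] scaleC_scaleC mult.commute)

lemma bounded_linear_scaleC_right: "bounded_linear (\<lambda>x :: 'a::complex_normed_vector. c *\<^sub>C x)"
  by (rule bounded_linear_intro[where K = "cmod c"])
     (auto simp: scaleC_add_right scaleC_scaleR norm_scaleC)

lemma bounded_linear_scaleC_left: "bounded_linear (\<lambda>c. c *\<^sub>C (x :: 'a::complex_normed_vector))"
  by (rule bounded_linear_intro[where K = "norm x"])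
     (auto simp: scaleC_add_left norm_scaleC scaleR_conv_of_real scaleC_scaleC[symmetric] scaleC_of_real scaleC_scaleR mult.commute)

text \<open>The Hahn--Banach theorem in the form of a norming functional. The complex functional
  \<open>u(x) - \<i> u(\<i> x)\<close> has the real part \<open>u\<close>, and its modulus at \<open>x\<close> is the value of \<open>u\<close> at a rotation
  of \<open>x\<close>.\<close>

theorem complex_norming_functional:
  fixes x0 :: "'a::complex_normed_vector"
  obtains l :: "'a \<Rightarrow>\<^sub>L complex" where "complex_homogeneous l"
    "\<And>x. cmod (l x) \<le> norm x" "l x0 = of_real (norm x0)"
proof -
  obtain u :: "'a \<Rightarrow> real" where lin: "linear u" and le: "\<And>x. u x \<le> norm x" and x0: "u x0 = norm x0"
    using real_norming_functional by blast
  define L where "L x = Complex (u x) (- u (\<i> *\<^sub>C x))" for x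
  have L_add: "L (x + y) = L x + L y" for x y
    by (simp add: L_def complex_eq_iff scaleC_add_right linear_add[OF lin])
  have L_R: "L (r *\<^sub>R x) = r *\<^sub>R L x" for r x
    by (simp add: L_def complex_eq_iff scaleC_scaleR linear_scale[OF lin])
  have L_i: "L (\<i> *\<^sub>C x) = \<i> * L x" for x
  proof -
    have "\<i> *\<^sub>C \<i> *\<^sub>C x = - x" by (simp add: scaleC_scaleC scaleC_minus_left scaleC_one)
    then show ?thesis by (simp add: L_def complex_eq_iff linear_neg[OF lin])
  qed
  have L_C: "L (c *\<^sub>C x) = c * L x" for c x
  proof -
    have "c *\<^sub>C x = Re c *\<^sub>R x + Im c *\<^sub>R \<i> *\<^sub>C x"
      by (subst complex_eq[of c]) (simp add: scaleC_add_left scaleC_of_real scaleC_scaleC[symmetric] scaleC_scaleR)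
    then show ?thesis
      by (subst (2) complex_eq[of c]) (simp add: L_add L_R L_i scaleR_conv_of_real algebra_simps)
  qed
  have L_le: "cmod (L x) \<le> norm x" for x
  proof -
    define c where "c = cis (- Arg (L x))"
    have "cis (- Arg (L x)) * L x = of_real (cmod (L x))"
      using rcis_cmod_Arg[of "L x"] by (metis cis_mult cis_zero add.left_inverse mult.left_commute mult.right_neutral rcis_def)
    then have "L (c *\<^sub>C x) = of_real (cmod (L x))" by (simp add: L_C c_def)
    then have "cmod (L x) = u (c *\<^sub>C x)" by (metis L_def Re_complex_of_real complex.sel(1))
    also have "\<dots> \<le> norm (c *\<^sub>C x)" by (rule le)
    finally show ?thesis by (simp add: norm_scaleC c_def)
  qed
  have bl: "bounded_linear L"
    by (rule bounded_linear_intro[where K = 1]) (auto simp: L_add L_R L_le)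
  have "L x0 = of_real (norm x0)"
  proof -
    have re: "Re (L x0) = norm x0" by (simp add: L_def x0)
    then have "(Im (L x0))^2 \<le> 0"
      using power_mono[OF L_le[of x0], of 2] by (simp add: cmod_power2)
    with re show ?thesis by (simp add: complex_eq_iff)
  qed
  then show ?thesis
    using L_C L_le by (intro that[of "Blinfun L"])
      (auto simp: bounded_linear_Blinfun_apply[OF bl] complex_homogeneous_def scaleC_complex_def)
qed

lemma support_functionals_nonempty:
  fixes z :: "'a::complex_normed_vector"
  assumes "z \<noteq> 0"
  shows "support_functionals z \<noteq> {}"
proof -
  obtain l :: "'a \<Rightarrow>\<^sub>L complex" where l: "complex_homogeneous l"
    "\<And>x. cmod (l x) \<le> norm x" "l z = of_real (norm z)"
    using complex_norming_functional[of z] by blast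
  have "norm l = 1"
    by (rule norm_blinfun_eqI[where x = z]) (use l assms in auto)
  with l have "l \<in> support_functionals z" by (auto simp: support_functionals_def)
  then show ?thesis by blast
qed

text \<open>Through this estimate, inequalities for functions of one complex variable carry over to maps with
  values in a normed space.\<close>

lemma norm_le_by_functionals:
  fixes y :: "'a::complex_normed_vector"
  assumes "\<And>l :: 'a \<Rightarrow>\<^sub>L complex. complex_homogeneous l \<Longrightarrow>
      (\<And>x. cmod (l x) \<le> norm x) \<Longrightarrow> cmod (l y) \<le> C"
  shows "norm y \<le> C"
proof -
  obtain l :: "'a \<Rightarrow>\<^sub>L complex" where l: "complex_homogeneous l"
    "\<And>x. cmod (l x) \<le> norm x" "l y = of_real (norm y)"
    using complex_norming_functional[of y] by blast
  show ?thesis using assms[OF l(1,2)] l(3) by simp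
qed

text \<open>Multiplication of the values by scalars makes the real-linear operators into a complex normed
  space, so that \<open>frechet F\<close> and its further derivatives again have a complex codomain.\<close>

instantiation blinfun :: (real_normed_vector, complex_normed_vector) complex_normed_vector
begin

definition scaleC_blinfun :: "complex \<Rightarrow> ('a \<Rightarrow>\<^sub>L 'b) \<Rightarrow> 'a \<Rightarrow>\<^sub>L 'b"
  where "scaleC_blinfun c L = Blinfun (\<lambda>x. c *\<^sub>C L x)"

lemma scaleC_blinfun_apply: "(c *\<^sub>C L) x = c *\<^sub>C L x"
  for L :: "'a \<Rightarrow>\<^sub>L 'b"
  unfolding scaleC_blinfun_def
  by (simp add: bounded_linear_Blinfun_apply
      bounded_linear_compose[OF bounded_linear_scaleC_right blinfun.bounded_linear_right])

instance
proof
  fix c d :: complex and L M :: "'a \<Rightarrow>\<^sub>L 'b" and r :: real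
  show "c *\<^sub>C (L + M) = c *\<^sub>C L + c *\<^sub>C M" "(c + d) *\<^sub>C L = c *\<^sub>C L + d *\<^sub>C L"
    "c *\<^sub>C d *\<^sub>C L = (c * d) *\<^sub>C L" "1 *\<^sub>C L = L" "of_real r *\<^sub>C L = r *\<^sub>R L"
    by (rule blinfun_eqI, simp add: scaleC_blinfun_apply blinfun.bilinear_simps
        scaleC_add_right scaleC_add_left scaleC_scaleC scaleC_one scaleC_of_real)+
  have le: "norm (a *\<^sub>C K) \<le> cmod a * norm K" for a :: complex and K :: "'a \<Rightarrow>\<^sub>L 'b"
    by (rule norm_blinfun_bound)
       (auto simp: scaleC_blinfun_apply norm_scaleC mult.assoc intro!: mult_left_mono norm_blinfun)
  show "norm (c *\<^sub>C L) = cmod c * norm L"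
  proof (cases "c = 0")
    case True
    then show ?thesis using le[of c L] by simp
  next
    case False
    have "inverse c *\<^sub>C c *\<^sub>C L = L"
      by (rule blinfun_eqI) (use False in \<open>simp add: scaleC_blinfun_apply scaleC_scaleC scaleC_one\<close>)
    then have "norm L \<le> cmod (inverse c) * norm (c *\<^sub>C L)" using le[of "inverse c" "c *\<^sub>C L"] by simp
    then have "cmod c * norm L \<le> norm (c *\<^sub>C L)" using False by (simp add: norm_inverse norm_divide field_simps)
    with le[of c L] show ?thesis by simp
  qed
qed

end

instance blinfun :: (real_normed_vector, complex_banach) complex_banach ..


section \<open>Cauchy estimates for maps between complex normed spaces\<close>

definition complex_diff_on ::
    "('a::complex_normed_vector \<Rightarrow> 'b::complex_normed_vector) \<Rightarrow> 'a set \<Rightarrow> bool"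
  where "complex_diff_on F S \<longleftrightarrow>
    (\<forall>z\<in>S. \<exists>L. (F has_derivative L) (at z) \<and> complex_homogeneous L)"

lemma holomorphic_on_ball_iff: "holomorphic_on_ball F \<longleftrightarrow> complex_diff_on F (ball 0 1)"
  by (simp add: holomorphic_on_ball_def complex_diff_on_def)

lemma complex_diff_on_subset:
  "complex_diff_on F S \<Longrightarrow> T \<subseteq> S \<Longrightarrow> complex_diff_on F T"
  by (auto simp: complex_diff_on_def)

lemma frechet_eq:
  assumes "(F has_derivative L) (at z)"
  shows "blinfun_apply (frechet F z) = L"
  using frechet_derivative_at[OF assms] has_derivative_bounded_linear[OF assms]
  by (simp add: frechet_def bounded_linear_Blinfun_apply)

lemma complex_diff_onD:
  assumes "complex_diff_on F S" "z \<in> S"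
  shows "(F has_derivative (frechet F z)) (at z)"
    and "complex_homogeneous ((frechet F z))"
  using assms frechet_eq[of F _ z] by (auto simp: complex_diff_on_def)

lemma complex_homogeneous_scaleC: "complex_homogeneous h \<Longrightarrow> h (c *\<^sub>C x) = c *\<^sub>C h x"
  by (simp add: complex_homogeneous_def)

lemma has_field_derivative_along_line:
  fixes l :: "'b::complex_normed_vector \<Rightarrow>\<^sub>L complex"
  assumes F: "complex_diff_on F S" "z + \<zeta> *\<^sub>C k \<in> S"
    and l: "complex_homogeneous l"
  shows "((\<lambda>\<zeta>. l (F (z + \<zeta> *\<^sub>C k))) has_field_derivative
      l ((frechet F (z + \<zeta> *\<^sub>C k)) k)) (at \<zeta>)"
proof -
  have "((\<lambda>\<zeta>. z + \<zeta> *\<^sub>C k) has_derivative (\<lambda>\<eta>. \<eta> *\<^sub>C k)) (at \<zeta>)"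
    using has_derivative_add[OF has_derivative_const
        bounded_linear_imp_has_derivative[OF bounded_linear_scaleC_left]] by simp
  from has_derivative_compose[OF this complex_diff_onD(1)[OF F]]
  have "((\<lambda>\<zeta>. l (F (z + \<zeta> *\<^sub>C k))) has_derivative
      (\<lambda>\<eta>. l ((frechet F (z + \<zeta> *\<^sub>C k)) (\<eta> *\<^sub>C k)))) (at \<zeta>)"
    by (rule bounded_linear.has_derivative[OF blinfun.bounded_linear_right])
  then show ?thesis
    unfolding has_field_derivative_def
    by (rule has_derivative_eq_rhs)
       (simp add: fun_eq_iff complex_homogeneous_scaleC[OF l] scaleC_complex_def
        complex_homogeneous_scaleC[OF complex_diff_onD(2)[OF F]])
qed

lemma holomorphic_along_line:
  fixes l :: "'b::complex_normed_vector \<Rightarrow>\<^sub>L complex"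
  assumes F: "complex_diff_on F (ball z \<rho>)" and k: "R * norm k \<le> \<rho>" "k \<noteq> 0"
    and l: "complex_homogeneous l"
  shows "(\<lambda>\<zeta>. l (F (z + \<zeta> *\<^sub>C k))) holomorphic_on ball 0 R"
    and "cmod \<zeta> < R \<Longrightarrow> z + \<zeta> *\<^sub>C k \<in> ball z \<rho>"
proof -
  show *: "z + \<zeta> *\<^sub>C k \<in> ball z \<rho>" if "cmod \<zeta> < R" for \<zeta>
  proof -
    have "cmod \<zeta> * norm k < R * norm k" using that k by simp
    then have "cmod \<zeta> * norm k < \<rho>" using k(1) by linarith
    then show ?thesis by (simp add: dist_norm norm_scaleC)
  qed
  show "(\<lambda>\<zeta>. l (F (z + \<zeta> *\<^sub>C k))) holomorphic_on ball 0 R"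
    unfolding holomorphic_on_def field_differentiable_def
    using has_field_derivative_along_line[OF F * l] has_field_derivative_at_within by fastforce
qed

text \<open>The second derivative is at most \<open>8M/R^2\<close> on the unit disc by the Cauchy inequality on discs of radius
  \<open>R/2\<close>, which stay inside the disc of radius \<open>R\<close>.\<close>

lemma taylor_remainder_order_1:
  assumes \<phi>: "\<phi> holomorphic_on ball 0 R" "\<And>\<zeta>. cmod \<zeta> < R \<Longrightarrow> cmod (\<phi> \<zeta>) \<le> M" and R: "4 \<le> R"
  shows "cmod (\<phi> 1 - \<phi> 0 - deriv \<phi> 0) \<le> 8 * M / R^2"
proof -
  define f where "f i = (deriv ^^ i) \<phi>" for i
  have "cmod (f 0 1 - (\<Sum>i\<le>1. f i 0 * (1 - 0) ^ i / (fact i))) \<le> 8 * M / R^2 * cmod (1 - 0) ^ (Suc 1) / fact 1"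
  proof (rule complex_Taylor)
    show "convex (cball (0::complex) 1)" by simp
    fix x :: complex assume x: "x \<in> cball 0 1"
    have xR: "cball x (R / 2) \<subseteq> ball 0 R"
    proof
      fix y assume "y \<in> cball x (R / 2)"
      then have "cmod (y - x) \<le> R / 2" by (simp add: dist_norm norm_minus_commute)
      moreover have "cmod y \<le> cmod (y - x) + cmod x" using norm_triangle_ineq[of "y - x" x] by simp
      ultimately show "y \<in> ball 0 R" using x R by simp
    qed
    have x': "x \<in> ball 0 R" using x R by simp
    show "(f i has_field_derivative f (Suc i) x) (at x within cball 0 1)" if "i \<le> 1" for i
      using holomorphic_derivI[OF holomorphic_higher_deriv[OF \<phi>(1) open_ball] open_ball x', of i]
      by (simp add: f_def has_field_derivative_at_within)
    have "cmod ((deriv ^^ 2) \<phi> x) \<le> fact 2 * M / (R / 2) ^ 2"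
    proof (rule Cauchy_inequality)
      show "\<phi> holomorphic_on ball x (R / 2)"
        by (rule holomorphic_on_subset[OF \<phi>(1)]) (use xR ball_subset_cball in blast)
      show "continuous_on (cball x (R / 2)) \<phi>"
        by (rule holomorphic_on_imp_continuous_on[OF holomorphic_on_subset[OF \<phi>(1) xR]])
      fix y assume "cmod (x - y) = R / 2"
      then have "y \<in> ball 0 R" using xR by (auto simp: dist_norm)
      then show "cmod (\<phi> y) \<le> M" using \<phi>(2) by simp
    qed (use R in simp)
    then show "cmod (f (Suc 1) x) \<le> 8 * M / R^2"
      by (simp add: f_def power_divide numeral_2_eq_2 fact_numeral field_simps)
  qed auto
  then show ?thesis by (simp add: f_def algebra_simps)
qed

lemma frechet_cauchy_bound:
  assumes F: "complex_diff_on F (ball z \<rho>)" and \<rho>: "0 < \<rho>"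
    and M: "\<And>x. x \<in> ball z \<rho> \<Longrightarrow> norm (F x) \<le> M"
  shows "norm ((frechet F z) k) \<le> 2 * M / \<rho> * norm k"
proof (cases "k = 0")
  case False
  define R where "R = \<rho> / norm k"
  have R: "R * norm k \<le> \<rho>" "0 < R" using False \<rho> by (auto simp: R_def)
  show ?thesis
  proof (rule norm_le_by_functionals)
    fix l :: "'b \<Rightarrow>\<^sub>L complex"
    assume l: "complex_homogeneous l" "\<And>x. cmod (l x) \<le> norm x"
    define \<phi> where "\<phi> = (\<lambda>\<zeta>. l (F (z + \<zeta> *\<^sub>C k)))"
    note line = holomorphic_along_line[OF F R(1) False l(1)]
    have "(\<phi> has_field_derivative l ((frechet F z) k)) (at 0)"
      using has_field_derivative_along_line[OF F _ l(1), where \<zeta> = 0 and k = k] \<rho>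
      by (simp add: \<phi>_def scaleC_zero_left)
    then have d: "deriv \<phi> 0 = l ((frechet F z) k)" by (rule DERIV_imp_deriv)
    have "cmod ((deriv ^^ 1) \<phi> 0) \<le> fact 1 * M / (R / 2) ^ 1"
    proof (rule Cauchy_inequality)
      show "\<phi> holomorphic_on ball 0 (R / 2)"
        unfolding \<phi>_def by (rule holomorphic_on_subset[OF line(1)]) (use R in auto)
      show "continuous_on (cball 0 (R / 2)) \<phi>"
        unfolding \<phi>_def by (rule holomorphic_on_imp_continuous_on[OF holomorphic_on_subset[OF line(1)]]) (use R in auto)
      fix \<zeta> assume "cmod (0 - \<zeta>) = R / 2"
      then have "z + \<zeta> *\<^sub>C k \<in> ball z \<rho>" using R by (intro line(2)) simp
      then show "cmod (\<phi> \<zeta>) \<le> M" unfolding \<phi>_def using l(2) M order_trans by blast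
    qed (use R in simp)
    then show "cmod (l ((frechet F z) k)) \<le> 2 * M / \<rho> * norm k"
      by (simp add: d R_def field_simps)
  qed
qed simp

text \<open>The remainder is quadratic uniformly in \<open>z\<close>, with a constant that only involves a bound for \<open>F\<close>.
  This is what makes complex differentiability stable under limits and under differentiation.\<close>

lemma frechet_remainder_bound:
  assumes F: "complex_diff_on F (ball z \<rho>)" and \<rho>: "0 < \<rho>"
    and M: "\<And>x. x \<in> ball z \<rho> \<Longrightarrow> norm (F x) \<le> M" and k: "norm k \<le> \<rho> / 4"
  shows "norm (F (z + k) - F z - (frechet F z) k) \<le> 8 * M / \<rho>^2 * (norm k)^2"
proof (cases "k = 0")
  case False
  define R where "R = \<rho> / norm k"
  have R: "R * norm k \<le> \<rho>" "4 \<le> R" using False k by (auto simp: R_def field_simps)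
  show ?thesis
  proof (rule norm_le_by_functionals)
    fix l :: "'b \<Rightarrow>\<^sub>L complex"
    assume l: "complex_homogeneous l" "\<And>x. cmod (l x) \<le> norm x"
    define \<phi> where "\<phi> = (\<lambda>\<zeta>. l (F (z + \<zeta> *\<^sub>C k)))"
    note line = holomorphic_along_line[OF F R(1) False l(1)]
    have "(\<phi> has_field_derivative l ((frechet F z) k)) (at 0)"
      using has_field_derivative_along_line[OF F _ l(1), where \<zeta> = 0 and k = k] \<rho>
      by (simp add: \<phi>_def scaleC_zero_left)
    then have d: "deriv \<phi> 0 = l ((frechet F z) k)" by (rule DERIV_imp_deriv)
    have "cmod (\<phi> 1 - \<phi> 0 - deriv \<phi> 0) \<le> 8 * M / R^2"
    proof (rule taylor_remainder_order_1[OF _ _ R(2)])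
      show "\<phi> holomorphic_on ball 0 R" unfolding \<phi>_def by (rule line(1))
      show "cmod (\<phi> \<zeta>) \<le> M" if "cmod \<zeta> < R" for \<zeta>
        unfolding \<phi>_def using l(2) M[OF line(2)[OF that]] order_trans by blast
    qed
    then show "cmod (l (F (z + k) - F z - (frechet F z) k))
        \<le> 8 * M / \<rho>^2 * (norm k)^2"
      using False unfolding d by (simp add: R_def \<phi>_def scaleC_one scaleC_zero_left blinfun.diff_right power_divide)
  qed
qed simp

lemma complex_diff_on_diff:
  assumes F: "complex_diff_on F S" and G: "complex_diff_on G S"
  shows "complex_diff_on (\<lambda>z. F z - G z) S"
    and "z \<in> S \<Longrightarrow> (frechet (\<lambda>z. F z - G z) z) h = (frechet F z) h - (frechet G z) h"
proof -
  have *: "((\<lambda>z. F z - G z) has_derivative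
      (\<lambda>h. (frechet F z) h - (frechet G z) h)) (at z)" if "z \<in> S" for z
    using complex_diff_onD(1)[OF F that] complex_diff_onD(1)[OF G that]
    by (rule has_derivative_diff)
  show "complex_diff_on (\<lambda>z. F z - G z) S"
    unfolding complex_diff_on_def complex_homogeneous_def
    using * complex_diff_onD(2)[OF F] complex_diff_onD(2)[OF G]
    by (fastforce simp: complex_homogeneous_scaleC scaleC_diff_right)
  show "z \<in> S \<Longrightarrow> (frechet (\<lambda>z. F z - G z) z) h = (frechet F z) h - (frechet G z) h"
    using frechet_eq[OF *] by simp
qed

lemma ball_center_shift:
  fixes z z0 :: "'a::real_normed_vector"
  assumes "z \<in> ball z0 \<rho>"
  shows "ball z \<rho> \<subseteq> ball z0 (2 * \<rho>)"
proof
  fix y assume "y \<in> ball z \<rho>"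
  then show "y \<in> ball z0 (2 * \<rho>)"
    using assms dist_triangle[of z0 y z] by simp
qed

text \<open>By the Cauchy estimate the derivatives of a uniformly convergent sequence converge uniformly on a
  smaller ball, in operator norm.\<close>

theorem complex_diff_on_uniform_limit:
  fixes H :: "nat \<Rightarrow> 'a::complex_normed_vector \<Rightarrow> 'b::complex_banach"
  assumes \<rho>: "0 < \<rho>" and H: "\<And>n. complex_diff_on (H n) (ball z0 (2 * \<rho>))"
    and lim: "uniform_limit (ball z0 (2 * \<rho>)) H G sequentially"
  shows "complex_diff_on G (ball z0 \<rho>)"
proof -
  have sub: "ball z0 \<rho> \<subseteq> ball z0 (2 * \<rho>)" using \<rho> by auto
  have "uniformly_Cauchy_on (ball z0 \<rho>) (\<lambda>n z. frechet (H n) z)"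
  proof (rule uniformly_Cauchy_onI)
    fix e :: real assume e: "0 < e"
    have "uniformly_Cauchy_on (ball z0 (2 * \<rho>)) H"
      using lim by (intro uniformly_convergent_Cauchy) (auto simp: uniformly_convergent_on_def)
    moreover have "0 < e * \<rho> / 4" using e \<rho> by simp
    ultimately obtain N where N: "\<And>x m n. x \<in> ball z0 (2 * \<rho>) \<Longrightarrow> m \<ge> N \<Longrightarrow> n \<ge> N \<Longrightarrow> dist (H m x) (H n x) < e * \<rho> / 4"
      unfolding uniformly_Cauchy_on_def by meson
    have "dist (frechet (H m) z) (frechet (H n) z) < e"
      if z: "z \<in> ball z0 \<rho>" and mn: "m \<ge> N" "n \<ge> N" for z m n
    proof -
      have z2: "z \<in> ball z0 (2 * \<rho>)" using z sub by blast
      have "norm (frechet (H m) z - frechet (H n) z) \<le> 2 * (e * \<rho> / 4) / \<rho>"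
      proof (rule norm_blinfun_bound)
        fix k
        have "norm ((frechet (\<lambda>z. H m z - H n z) z) k) \<le> 2 * (e * \<rho> / 4) / \<rho> * norm k"
        proof (rule frechet_cauchy_bound[OF _ \<rho>])
          show "complex_diff_on (\<lambda>z. H m z - H n z) (ball z \<rho>)"
            by (rule complex_diff_on_subset[OF complex_diff_on_diff(1)[OF H H] ball_center_shift[OF z]])
          show "norm (H m x - H n x) \<le> e * \<rho> / 4" if "x \<in> ball z \<rho>" for x
            using N[of x m n] ball_center_shift[OF z] that mn by (auto simp: dist_norm less_imp_le)
        qed
        then show "norm ((frechet (H m) z - frechet (H n) z) k) \<le> 2 * (e * \<rho> / 4) / \<rho> * norm k"
          using complex_diff_on_diff(2)[OF H H z2] by (simp add: blinfun.diff_left)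
      qed (use e \<rho> in auto)
      then show ?thesis using e \<rho> by (simp add: dist_norm)
    qed
    then show "\<exists>M. \<forall>x\<in>ball z0 \<rho>. \<forall>m\<ge>M. \<forall>n\<ge>M. dist (frechet (H m) x) (frechet (H n) x) < e" by blast
  qed
  then obtain D where D: "uniform_limit (ball z0 \<rho>) (\<lambda>n z. frechet (H n) z) D sequentially"
    using Cauchy_uniformly_convergent unfolding uniformly_convergent_on_def by blast
  have "\<exists>g. \<forall>x\<in>ball z0 \<rho>. (\<lambda>n. H n x) \<longlonglongrightarrow> g x \<and> (g has_derivative (D x)) (at x within ball z0 \<rho>)"
  proof (rule has_derivative_sequence)
    show "(H n has_derivative (frechet (H n) x)) (at x within ball z0 \<rho>)" if "x \<in> ball z0 \<rho>" for n x
      using complex_diff_onD(1)[OF H] that sub has_derivative_at_withinI by blast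
    show "(\<lambda>n. H n z0) \<longlonglongrightarrow> G z0"
      using \<rho> by (intro tendsto_uniform_limitI[OF lim]) auto
    fix e :: real assume e: "0 < e"
    show "\<forall>\<^sub>F n in sequentially. \<forall>x\<in>ball z0 \<rho>. \<forall>h. norm ((frechet (H n) x) h - (D x) h) \<le> e * norm h"
      using uniform_limitD[OF D e]
    proof eventually_elim
      case (elim n)
      show ?case
      proof (intro ballI allI)
        fix x h assume x: "x \<in> ball z0 \<rho>"
        have "norm ((frechet (H n) x - D x) h) \<le> norm (frechet (H n) x - D x) * norm h"
          by (rule norm_blinfun)
        also have "\<dots> \<le> e * norm h" using elim x by (intro mult_right_mono) (auto simp: dist_norm less_imp_le)
        finally show "norm ((frechet (H n) x) h - (D x) h) \<le> e * norm h"
          by (simp add: blinfun.diff_left)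
      qed
    qed
  qed (use \<rho> in auto)
  then obtain g where g: "\<And>x. x \<in> ball z0 \<rho> \<Longrightarrow> (\<lambda>n. H n x) \<longlonglongrightarrow> g x"
      "\<And>x. x \<in> ball z0 \<rho> \<Longrightarrow> (g has_derivative (D x)) (at x within ball z0 \<rho>)" by blast
  have gG: "g x = G x" if x: "x \<in> ball z0 \<rho>" for x
    using LIMSEQ_unique[OF g(1)[OF x] tendsto_uniform_limitI[OF lim]] x sub by blast
  show ?thesis unfolding complex_diff_on_def
  proof (intro ballI exI conjI)
    fix z assume z: "z \<in> ball z0 \<rho>"
    have "(g has_derivative (D z)) (at z)"
      using g(2)[OF z] z by (metis at_within_open open_ball)
    then show "(G has_derivative (D z)) (at z)"
      by (rule has_derivative_transform_within_open[OF _ open_ball z]) (use gG in auto)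
    show "complex_homogeneous ((D z))" unfolding complex_homogeneous_def
    proof (intro allI)
      fix c x
      have lim: "(\<lambda>n. (frechet (H n) z) y) \<longlonglongrightarrow> (D z) y" for y
        by (intro tendsto_intros tendsto_uniform_limitI[OF D z])
      have "(\<lambda>n. c *\<^sub>C (frechet (H n) z) x) \<longlonglongrightarrow> c *\<^sub>C (D z) x"
        by (rule bounded_linear.tendsto[OF bounded_linear_scaleC_right lim])
      moreover have "(frechet (H n) z) (c *\<^sub>C x) = c *\<^sub>C (frechet (H n) z) x" for n
        using complex_diff_onD(2)[OF H] z sub complex_homogeneous_scaleC by blast
      ultimately show "(D z) (c *\<^sub>C x) = c *\<^sub>C (D z) x"
        using LIMSEQ_unique[OF lim[of "c *\<^sub>C x"]] by simp
    qed
  qed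
qed


section \<open>Differentiability of the derivative\<close>

lemma complex_diff_on_locally_bounded:
  assumes F: "complex_diff_on F S" and S: "open S" "z0 \<in> S"
  obtains \<rho> M where "0 < \<rho>" "0 \<le> M" "ball z0 (4 * \<rho>) \<subseteq> S" "\<And>x. x \<in> ball z0 (4 * \<rho>) \<Longrightarrow> norm (F x) \<le> M"
proof -
  obtain e where e: "0 < e" "ball z0 e \<subseteq> S" using S open_contains_ball by blast
  have "isCont F z0" using complex_diff_onD(1)[OF F S(2)] has_derivative_continuous by blast
  then obtain d where d: "0 < d" "\<And>x. dist x z0 < d \<Longrightarrow> dist (F x) (F z0) < 1"
    unfolding continuous_at_eps_delta using zero_less_one by blast
  define \<rho> where "\<rho> = min d e / 4"
  show ?thesis
  proof
    show "0 < \<rho>" "ball z0 (4 * \<rho>) \<subseteq> S" using d e by (auto simp: \<rho>_def)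
    show "0 \<le> norm (F z0) + 1" by simp
    fix x assume "x \<in> ball z0 (4 * \<rho>)"
    then have "dist x z0 < d" by (auto simp: \<rho>_def dist_commute)
    then have "norm (F x - F z0) < 1" using d(2) by (simp add: dist_norm)
    then show "norm (F x) \<le> norm (F z0) + 1" using norm_triangle_ineq2[of "F x" "F z0"] by linarith
  qed
qed

text \<open>For a fixed direction \<open>k\<close>, the derivative is a locally uniform limit of difference quotients, which
  are differentiable themselves.\<close>

lemma complex_diff_on_frechet_apply:
  fixes F :: "'a::complex_normed_vector \<Rightarrow> 'b::complex_banach"
  assumes F: "complex_diff_on F S" and S: "open S"
  shows "complex_diff_on (\<lambda>z. (frechet F z) k) S"
proof -
  have "\<exists>L. ((\<lambda>z. (frechet F z) k) has_derivative L) (at z0) \<and> complex_homogeneous L"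
    if z0: "z0 \<in> S" for z0
  proof -
    obtain \<rho> M where \<rho>: "0 < \<rho>" and M0: "0 \<le> M" and sub: "ball z0 (4 * \<rho>) \<subseteq> S"
      and M: "\<And>x. x \<in> ball z0 (4 * \<rho>) \<Longrightarrow> norm (F x) \<le> M"
      using complex_diff_on_locally_bounded[OF F S z0] by blast
    obtain N :: nat where N: "2 * norm k / \<rho> \<le> N" using real_arch_simple by blast
    \<comment> \<open>the offset \<open>N\<close> keeps all steps \<open>t n k\<close> inside the ball on which \<open>F\<close> is bounded\<close>
    define t where "t n = 1 / real (Suc (n + N))" for n
    have t0: "0 < t n" for n by (simp add: t_def)
    have tk: "norm (t n *\<^sub>R k) \<le> 2 * \<rho> / 4" for n
    proof -
      have "2 * norm k \<le> real (Suc (n + N)) * \<rho>" 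
      proof -
        have "2 * norm k \<le> real N * \<rho>" using N \<rho> by (simp add: field_simps)
        also have "\<dots> \<le> real (Suc (n + N)) * \<rho>" using \<rho> by (intro mult_right_mono) auto
        finally show ?thesis .
      qed
      then show ?thesis by (simp add: t_def field_simps)
    qed
    have ball2: "ball z (2 * \<rho>) \<subseteq> ball z0 (4 * \<rho>)" if "z \<in> ball z0 (2 * \<rho>)" for z
      using ball_center_shift[OF that] by simp
    have shift: "z + t n *\<^sub>R k \<in> S" if z: "z \<in> ball z0 (2 * \<rho>)" for z n
    proof -
      have "z + t n *\<^sub>R k \<in> ball z (2 * \<rho>)" using tk[of n] \<rho> by (simp add: dist_norm)
      then show ?thesis using ball2[OF z] sub by blast
    qed
    define G where "G n z = (1 / t n) *\<^sub>R (F (z + t n *\<^sub>R k) - F z)" for n z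
    have "complex_diff_on (G n) (ball z0 (2 * \<rho>))" for n
      unfolding complex_diff_on_def
    proof (intro ballI exI conjI)
      fix z assume z: "z \<in> ball z0 (2 * \<rho>)"
      have zS: "z \<in> S" using z sub \<rho> by auto
      have "((\<lambda>z. z + t n *\<^sub>R k) has_derivative (\<lambda>h. h)) (at z)"
        by (auto intro!: derivative_eq_intros)
      from has_derivative_compose[OF this complex_diff_onD(1)[OF F shift[OF z]]]
      show "(G n has_derivative (\<lambda>h. (1 / t n) *\<^sub>R ((frechet F (z + t n *\<^sub>R k)) h
          - (frechet F z) h))) (at z)"
        unfolding G_def
        by (intro has_derivative_scaleR_right has_derivative_diff complex_diff_onD(1)[OF F zS])
      show "complex_homogeneous (\<lambda>h. (1 / t n) *\<^sub>R ((frechet F (z + t n *\<^sub>R k)) h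
          - (frechet F z) h))"
        using complex_homogeneous_scaleC[OF complex_diff_onD(2)[OF F zS]]
          complex_homogeneous_scaleC[OF complex_diff_onD(2)[OF F shift[OF z]]]
        by (simp add: complex_homogeneous_def scaleC_diff_right[symmetric] scaleC_scaleR)
    qed
    moreover have "uniform_limit (ball z0 (2 * \<rho>)) G (\<lambda>z. (frechet F z) k) sequentially"
    proof (rule uniform_limitI)
      fix e :: real assume e: "0 < e"
      define C where "C = 8 * M / (2 * \<rho>)^2 * (norm k)^2"
      have "(\<lambda>n. 1 / real (n + Suc N)) \<longlonglongrightarrow> 0"
        by (rule LIMSEQ_ignore_initial_segment[OF lim_1_over_n])
      moreover have "t = (\<lambda>n. 1 / real (n + Suc N))" by (simp add: t_def fun_eq_iff)
      ultimately have "t \<longlonglongrightarrow> 0" by simp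
      then have "(\<lambda>n. C * t n) \<longlonglongrightarrow> C * 0" by (intro tendsto_mult tendsto_const)
      then have "\<forall>\<^sub>F n in sequentially. C * t n < e" using e by (auto dest: order_tendstoD(2))
      then show "\<forall>\<^sub>F n in sequentially. \<forall>z\<in>ball z0 (2 * \<rho>). dist (G n z) ((frechet F z) k) < e"
      proof eventually_elim
        case (elim n)
        show ?case
        proof
          fix z assume z: "z \<in> ball z0 (2 * \<rho>)"
          have "norm (F (z + t n *\<^sub>R k) - F z - (frechet F z) (t n *\<^sub>R k))
              \<le> 8 * M / (2 * \<rho>)^2 * (norm (t n *\<^sub>R k))^2"
          proof (rule frechet_remainder_bound[OF _ _ _ tk])
            show "complex_diff_on F (ball z (2 * \<rho>))"
              using complex_diff_on_subset[OF F] ball2[OF z] sub by blast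
          qed (use \<rho> M ball2[OF z] in auto)
          also have "\<dots> = C * (t n)^2" by (simp add: C_def power_mult_distrib)
          finally have le: "norm (F (z + t n *\<^sub>R k) - F z - (frechet F z) (t n *\<^sub>R k)) \<le> C * (t n)^2" .
          have "G n z - (frechet F z) k
              = (1 / t n) *\<^sub>R (F (z + t n *\<^sub>R k) - F z - (frechet F z) (t n *\<^sub>R k))"
            using t0[of n] by (simp add: G_def blinfun.scaleR_right scaleR_diff_right)
          then have "norm (G n z - (frechet F z) k)
              = (1 / t n) * norm (F (z + t n *\<^sub>R k) - F z - (frechet F z) (t n *\<^sub>R k))"
            using t0[of n] by simp
          also have "\<dots> \<le> (1 / t n) * (C * (t n)^2)"
            using le t0[of n] by (intro mult_left_mono) auto
          also have "\<dots> = C * t n" using t0[of n] by (simp add: power2_eq_square)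
          finally show "dist (G n z) ((frechet F z) k) < e" using elim by (simp add: dist_norm)
        qed
      qed
    qed
    ultimately have "complex_diff_on (\<lambda>z. (frechet F z) k) (ball z0 \<rho>)"
      by (rule complex_diff_on_uniform_limit[OF \<rho>])
    then show ?thesis using \<rho> unfolding complex_diff_on_def by simp
  qed
  then show ?thesis unfolding complex_diff_on_def by blast
qed

text \<open>With \<open>G k = (\<lambda>z. frechet F z k)\<close>, the second derivative is \<open>B h k = frechet (G k) z\<^sub>0 h\<close>: it is linear in
  \<open>h\<close> as a derivative and in \<open>k\<close> because \<open>G\<close> is. The quadratic remainder bounds for the maps \<open>G k\<close> are
  proportional to \<open>\<bar>k\<bar>\<close> and thus give one in operator norm.\<close>

theorem complex_diff_on_frechet:
  fixes F :: "'a::complex_normed_vector \<Rightarrow> 'b::complex_banach"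
  assumes F: "complex_diff_on F S" and S: "open S"
  shows "complex_diff_on (frechet F) S"
proof -
  have "\<exists>L. (frechet F has_derivative L) (at z0) \<and> complex_homogeneous L" if z0: "z0 \<in> S" for z0
  proof -
    obtain \<rho> M where \<rho>: "0 < \<rho>" and M0: "0 \<le> M" and sub: "ball z0 (4 * \<rho>) \<subseteq> S"
      and M: "\<And>x. x \<in> ball z0 (4 * \<rho>) \<Longrightarrow> norm (F x) \<le> M"
      using complex_diff_on_locally_bounded[OF F S z0] by blast
    define G where "G k = (\<lambda>z. (frechet F z) k)" for k
    have sub2: "ball z0 (2 * \<rho>) \<subseteq> S" using sub \<rho> by (auto simp: subset_eq)
    have G: "complex_diff_on (G k) (ball z0 (2 * \<rho>))" for k
      unfolding G_def
      by (rule complex_diff_on_subset[OF complex_diff_on_frechet_apply[OF F S] sub2])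
    have z0': "z0 \<in> ball z0 (2 * \<rho>)" using \<rho> by simp
    note dG = complex_diff_onD[OF G z0']
    define M1 where "M1 = M / \<rho>"
    have M1: "0 \<le> M1" using M0 \<rho> by (simp add: M1_def)
    have G_le: "norm (G k z) \<le> M1 * norm k" if z: "z \<in> ball z0 (2 * \<rho>)" for k z
    proof -
      have b: "ball z (2 * \<rho>) \<subseteq> ball z0 (4 * \<rho>)" using ball_center_shift[OF z] by simp
      have "norm ((frechet F z) k) \<le> 2 * M / (2 * \<rho>) * norm k"
        by (rule frechet_cauchy_bound) (use complex_diff_on_subset[OF F] b sub \<rho> M in auto)
      then show ?thesis by (simp add: G_def M1_def)
    qed
    define b where "b h k = (frechet (G k) z0) h" for h k
    have b_le: "norm (b h k) \<le> M1 / \<rho> * norm h * norm k" for h k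
    proof -
      have "norm ((frechet (G k) z0) h) \<le> 2 * (M1 * norm k) / (2 * \<rho>) * norm h"
        by (rule frechet_cauchy_bound[OF G]) (use \<rho> G_le in auto)
      then show ?thesis by (simp add: b_def mult_ac)
    qed
    have b_add: "b h (k + k') = b h k + b h k'" for h k k'
    proof -
      have "G (k + k') = (\<lambda>z. G k z + G k' z)" by (simp add: G_def blinfun.add_right)
      then have "blinfun_apply (frechet (G (k + k')) z0)
          = (\<lambda>h. (frechet (G k) z0) h + (frechet (G k') z0) h)"
        using frechet_eq[OF has_derivative_add[OF dG(1) dG(1)]] by simp
      then show ?thesis by (simp add: b_def)
    qed
    have b_scale: "b h (r *\<^sub>R k) = r *\<^sub>R b h k" for h r k
    proof -
      have "G (r *\<^sub>R k) = (\<lambda>z. r *\<^sub>R G k z)" by (simp add: G_def blinfun.scaleR_right)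
      then have "blinfun_apply (frechet (G (r *\<^sub>R k)) z0) = (\<lambda>h. r *\<^sub>R (frechet (G k) z0) h)"
        using frechet_eq[OF has_derivative_scaleR_right[OF dG(1)]] by simp
      then show ?thesis by (simp add: b_def)
    qed
    define B where "B h = Blinfun (b h)" for h
    have B: "blinfun_apply (B h) = b h" for h unfolding B_def
    proof (rule bounded_linear_Blinfun_apply, rule bounded_linear_intro[where K = "M1 / \<rho> * norm h"])
      show "norm (b h k) \<le> norm k * (M1 / \<rho> * norm h)" for k
        using b_le[of h k] by (simp only: mult.commute)
    qed (simp_all add: b_add b_scale)
    have "bounded_linear B"
    proof (rule bounded_linear_intro[where K = "M1 / \<rho>"])
      show "B (h + h') = B h + B h'" "B (r *\<^sub>R h) = r *\<^sub>R B h" for h h' r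
        by (rule blinfun_eqI, simp add: B b_def blinfun.bilinear_simps)+
      show "norm (B h) \<le> norm h * (M1 / \<rho>)" for h
        by (rule norm_blinfun_bound) (use M1 \<rho> b_le[of h] in \<open>auto simp: B mult_ac\<close>)
    qed
    moreover have "norm (frechet F (z0 + h) - frechet F z0 - B h) \<le> 8 * M1 / (2 * \<rho>)^2 * (norm h)^2"
      if h: "norm h \<le> 2 * \<rho> / 4" for h
    proof (rule norm_blinfun_bound)
      fix k
      have "norm (G k (z0 + h) - G k z0 - (frechet (G k) z0) h)
          \<le> 8 * (M1 * norm k) / (2 * \<rho>)^2 * (norm h)^2"
        by (rule frechet_remainder_bound[OF G _ _ h]) (use \<rho> G_le in auto)
      then show "norm ((frechet F (z0 + h) - frechet F z0 - B h) k)
          \<le> 8 * M1 / (2 * \<rho>)^2 * (norm h)^2 * norm k"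
        by (simp add: G_def B b_def blinfun.diff_left mult_ac)
    qed (use M1 in simp)
    ultimately have "(frechet F has_derivative B) (at z0)"
    proof (intro has_derivativeI_sandwich[where e = "\<rho> / 2" and H = "\<lambda>y. 8 * M1 / (2 * \<rho>)^2 * norm (y - z0)"])
      fix y assume "y \<noteq> z0" "dist y z0 < \<rho> / 2"
        and le: "\<And>h. norm h \<le> 2 * \<rho> / 4 \<Longrightarrow>
          norm (frechet F (z0 + h) - frechet F z0 - B h) \<le> 8 * M1 / (2 * \<rho>)^2 * (norm h)^2"
      then show "norm (frechet F y - frechet F z0 - B (y - z0)) / norm (y - z0)
          \<le> 8 * M1 / (2 * \<rho>)^2 * norm (y - z0)"
        using le[of "y - z0"] by (simp add: dist_norm divide_le_eq power2_eq_square mult.assoc)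
    next
      have "((\<lambda>y. 8 * M1 / (2 * \<rho>)^2 * norm (y - z0)) \<longlongrightarrow> 8 * M1 / (2 * \<rho>)^2 * norm (z0 - z0)) (at z0)"
        by (intro tendsto_intros)
      then show "((\<lambda>y. 8 * M1 / (2 * \<rho>)^2 * norm (y - z0)) \<longlongrightarrow> 0) (at z0)" by simp
    qed (use \<rho> in auto)
    moreover have "complex_homogeneous B"
      unfolding complex_homogeneous_def
      by (intro allI, rule blinfun_eqI)
         (simp add: B b_def scaleC_blinfun_apply complex_homogeneous_scaleC[OF dG(2)])
    ultimately show ?thesis by blast
  qed
  then show ?thesis unfolding complex_diff_on_def by blast
qed

text \<open>Evaluation turns a functional on values into a functional on operators; thereby every further
  derivative along a line is covered by the same chain rule.\<close>

lemma evaluation_functional: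
  fixes l :: "'b::complex_normed_vector \<Rightarrow>\<^sub>L complex" and z :: "'a::real_normed_vector"
  assumes "complex_homogeneous l"
  obtains l' :: "('a \<Rightarrow>\<^sub>L 'b) \<Rightarrow>\<^sub>L complex" where "complex_homogeneous l'"
    "\<And>L. blinfun_apply l' L = blinfun_apply l (blinfun_apply L z)"
proof -
  have "bounded_linear (\<lambda>L. blinfun_apply l (blinfun_apply L z))"
    by (intro bounded_linear_compose[OF blinfun.bounded_linear_right blinfun.bounded_linear_left])
  then show ?thesis
    using assms by (intro that[of "Blinfun (\<lambda>L. blinfun_apply l (blinfun_apply L z))"])
      (auto simp: bounded_linear_Blinfun_apply complex_homogeneous_def scaleC_blinfun_apply)
qed

lemma higher_deriv_chain:
  fixes \<psi> :: "nat \<Rightarrow> complex \<Rightarrow> complex"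
  assumes "open U" and "\<And>i \<zeta>. i < n \<Longrightarrow> \<zeta> \<in> U \<Longrightarrow> (\<psi> i has_field_derivative \<psi> (Suc i) \<zeta>) (at \<zeta>)"
    and "\<zeta> \<in> U"
  shows "(deriv ^^ n) (\<psi> 0) \<zeta> = \<psi> n \<zeta>"
  using assms(2,3)
proof (induction n arbitrary: \<zeta>)
  case (Suc n)
  have "(deriv ^^ Suc n) (\<psi> 0) \<zeta> = deriv (\<psi> n) \<zeta>"
    unfolding funpow.simps comp_apply
  proof (rule deriv_cong_ev)
    show "\<forall>\<^sub>F \<zeta> in nhds \<zeta>. (deriv ^^ n) (\<psi> 0) \<zeta> = \<psi> n \<zeta>"
      using eventually_nhds_in_open[OF assms(1) Suc.prems(2)]
      by eventually_elim (rule Suc.IH, use Suc.prems in auto)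
  qed simp
  also have "\<dots> = \<psi> (Suc n) \<zeta>" by (rule DERIV_imp_deriv) (use Suc.prems in auto)
  finally show ?case .
qed simp

lemma diagonal_derivatives_along_line:
  fixes F :: "'a::complex_banach \<Rightarrow> 'b::complex_banach" and l :: "'b \<Rightarrow>\<^sub>L complex"
  assumes F: "complex_diff_on F (ball 0 1)" and u: "norm u = 1"
    and l: "complex_homogeneous l"
  defines "\<psi> \<equiv> \<lambda>\<zeta>. l (F (\<zeta> *\<^sub>C u))"
  shows "\<psi> holomorphic_on ball 0 1"
    and "l (D2_diag F u) = (deriv ^^ 2) \<psi> 0"
    and "l (D3_diag F u) = (deriv ^^ 3) \<psi> 0"
    and "l (D4_diag F u) = (deriv ^^ 4) \<psi> 0"
proof -
  note F1 = complex_diff_on_frechet[OF F open_ball]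
  note F2 = complex_diff_on_frechet[OF F1 open_ball]
  note F3 = complex_diff_on_frechet[OF F2 open_ball]
  obtain l1 where l1: "complex_homogeneous (blinfun_apply l1)"
    "\<And>L. blinfun_apply l1 L = blinfun_apply l (blinfun_apply L u)" using evaluation_functional[OF l] by blast
  obtain l2 where l2: "complex_homogeneous (blinfun_apply l2)"
    "\<And>L. blinfun_apply l2 L = blinfun_apply l1 (blinfun_apply L u)" using evaluation_functional[OF l1(1)] by blast
  obtain l3 where l3: "complex_homogeneous (blinfun_apply l3)"
    "\<And>L. blinfun_apply l3 L = blinfun_apply l2 (blinfun_apply L u)" using evaluation_functional[OF l2(1)] by blast
  define \<Psi> where "\<Psi> = (\<lambda>(i::nat) \<zeta>. if i = 0 then \<psi> \<zeta>
    else if i = 1 then l1 (frechet F (\<zeta> *\<^sub>C u))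
    else if i = 2 then l2 (frechet (frechet F) (\<zeta> *\<^sub>C u))
    else if i = 3 then l3 (frechet (frechet (frechet F)) (\<zeta> *\<^sub>C u))
    else l3 ((frechet (frechet (frechet (frechet F))) (\<zeta> *\<^sub>C u)) u))"
  have d: "(\<Psi> i has_field_derivative \<Psi> (Suc i) \<zeta>) (at \<zeta>)" if i: "i < 4" and \<zeta>: "\<zeta> \<in> ball 0 1" for i \<zeta>
  proof -
    have S: "0 + \<zeta> *\<^sub>C u \<in> ball 0 1" using \<zeta> u by (simp add: norm_scaleC)
    consider "i = 0" | "i = 1" | "i = 2" | "i = 3" using i by linarith
    then show ?thesis
    proof cases
      case 1
      then show ?thesis using has_field_derivative_along_line[OF F S l] by (simp add: \<Psi>_def \<psi>_def l1(2))
    next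
      case 2
      then show ?thesis using has_field_derivative_along_line[OF F1 S l1(1)] by (simp add: \<Psi>_def l2(2))
    next
      case 3
      then show ?thesis using has_field_derivative_along_line[OF F2 S l2(1)] by (simp add: \<Psi>_def l3(2))
    next
      case 4
      then show ?thesis using has_field_derivative_along_line[OF F3 S l3(1)] by (simp add: \<Psi>_def)
    qed
  qed
  show "\<psi> holomorphic_on ball 0 1"
    unfolding holomorphic_on_def field_differentiable_def
    using d[of 0] has_field_derivative_at_within by (fastforce simp: \<Psi>_def)
  have \<Psi>0: "\<Psi> 0 = \<psi>" by (simp add: \<Psi>_def fun_eq_iff)
  have "(deriv ^^ n) \<psi> 0 = \<Psi> n 0" if "n \<le> 4" for n
    using higher_deriv_chain[of "ball 0 1" n \<Psi> 0] d that by (simp add: \<Psi>0)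
  then show "l (D2_diag F u) = (deriv ^^ 2) \<psi> 0"
    "l (D3_diag F u) = (deriv ^^ 3) \<psi> 0"
    "l (D4_diag F u) = (deriv ^^ 4) \<psi> 0"
    by (simp_all add: \<Psi>_def D2_diag_def D3_diag_def D4_diag_def l1(2) l2(2) l3(2) scaleC_zero_left)
qed


section \<open>Maps of the form \<open>f(z) z\<close> on complex lines\<close>

lemma bounded_bilinear_scaleC: "bounded_bilinear (\<lambda>c (x :: 'a::complex_normed_vector). c *\<^sub>C x)"
proof
  show "\<exists>K. \<forall>c (x::'a). norm (c *\<^sub>C x) \<le> norm c * norm x * K"
    by (rule exI[of _ 1]) (simp add: norm_scaleC)
qed (simp_all add: scaleC_add_left scaleC_add_right scaleC_scaleR scaleR_conv_of_real
    scaleC_scaleC[symmetric] scaleC_of_real)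

lemma complex_diff_one_dim_type:
  assumes f: "complex_diff_on f S"
  shows "complex_diff_on (one_dim_type f) S"
    and "z \<in> S \<Longrightarrow> (frechet (one_dim_type f) z) h = f z *\<^sub>C h + (frechet f z) h *\<^sub>C z"
proof -
  have d: "(one_dim_type f has_derivative (\<lambda>h. f z *\<^sub>C h + (frechet f z) h *\<^sub>C z)) (at z)"
    if "z \<in> S" for z
    unfolding one_dim_type_def
    by (rule bounded_bilinear.FDERIV[OF bounded_bilinear_scaleC complex_diff_onD(1)[OF f that] has_derivative_ident])
  show "complex_diff_on (one_dim_type f) S"
    unfolding complex_diff_on_def
  proof (intro ballI exI conjI)
    fix z assume z: "z \<in> S"
    show "(one_dim_type f has_derivative (\<lambda>h. f z *\<^sub>C h + (frechet f z) h *\<^sub>C z)) (at z)"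
      by (rule d[OF z])
    show "complex_homogeneous (\<lambda>h. f z *\<^sub>C h + (frechet f z) h *\<^sub>C z)"
      using complex_homogeneous_scaleC[OF complex_diff_onD(2)[OF f z]]
      by (simp add: complex_homogeneous_def scaleC_complex_def scaleC_add_right scaleC_scaleC mult.commute)
  qed
  show "z \<in> S \<Longrightarrow> (frechet (one_dim_type f) z) h = f z *\<^sub>C h + (frechet f z) h *\<^sub>C z"
    using frechet_eq[OF d] by simp
qed

lemma boundedly_invertible_inj:
  assumes "boundedly_invertible L"
  shows "inj (L)"
proof -
  obtain G where "G o\<^sub>L L = id_blinfun" using assms by (auto simp: boundedly_invertible_def)
  then have "G (L x) = x" for x
    by (metis blinfun_apply_blinfun_compose id_blinfun.rep_eq)
  then show ?thesis by (rule inj_on_inverseI)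
qed

text \<open>On the line through \<open>z\<close> the equation \<open>DF(z) p = F(z)\<close> is scalar.\<close>

lemma inv_frechet_one_dim_type:
  fixes f :: "'a::complex_banach \<Rightarrow> complex"
  assumes f: "complex_diff_on f S" "z \<in> S" "z \<noteq> 0"
    and inv: "boundedly_invertible (frechet (one_dim_type f) z)"
  defines "a \<equiv> f z + (frechet f z) z"
  shows "a \<noteq> 0"
    and "inv ((frechet (one_dim_type f) z)) (one_dim_type f z) = (f z / a) *\<^sub>C z"
proof -
  let ?D = "(frechet (one_dim_type f) z)"
  have D: "?D (c *\<^sub>C z) = (c * a) *\<^sub>C z" for c
    using complex_homogeneous_scaleC[OF complex_diff_onD(2)[OF f(1,2)], of c z]
    by (simp add: complex_diff_one_dim_type(2)[OF f(1,2)] a_def scaleC_complex_def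
        scaleC_scaleC scaleC_add_left[symmetric] algebra_simps)
  note inj = boundedly_invertible_inj[OF inv]
  show a: "a \<noteq> 0"
  proof
    assume "a = 0"
    then have "?D z = ?D 0" using D[of 1] by (simp add: scaleC_one scaleC_zero_left)
    from injD[OF inj this] show False using f(3) by simp
  qed
  have "?D ((f z / a) *\<^sub>C z) = one_dim_type f z" using a by (simp add: D one_dim_type_def)
  then show "inv ?D (one_dim_type f z) = (f z / a) *\<^sub>C z" using inj by (metis inv_f_f)
qed

text \<open>A support functional at \<open>u\<close> yields one at every multiple of \<open>u\<close>, so the hypothesis can be applied
  along the whole line.\<close>

lemma support_functional_rotate:
  assumes l: "l \<in> support_functionals u" and u: "norm u = 1" and \<zeta>: "\<zeta> \<noteq> 0"
  shows "(cnj \<zeta> / of_real (cmod \<zeta>)) *\<^sub>C l \<in> support_functionals (\<zeta> *\<^sub>C u)"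
proof -
  have "cnj \<zeta> / of_real (cmod \<zeta>) * \<zeta> = of_real (cmod \<zeta>)"
    using \<zeta> complex_norm_square[of \<zeta>] by (simp add: field_simps power2_eq_square)
  then show ?thesis
    using l u \<zeta> complex_homogeneous_scaleC[of "blinfun_apply l"]
    by (auto simp: support_functionals_def complex_homogeneous_def scaleC_blinfun_apply
        scaleC_complex_def norm_scaleC norm_divide)
qed

text \<open>At \<open>z = \<zeta> u\<close> the quotient in the definition of the class is \<open>(f(z) + Df(z) z) / f(z)\<close>. It cannot be
  the default value \<open>0\<close> of a division by \<open>f(z) = 0\<close>, since \<open>\<Phi>\<close> has positive real part.\<close>

lemma starlike_factor_on_slice:
  fixes f :: "'a::complex_banach \<Rightarrow> complex"
  assumes \<Phi>: "admissible \<Phi>" and f: "starlike_factor \<Phi> f"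
    and u: "norm u = 1" and l: "l \<in> support_functionals u"
  defines "g \<equiv> \<lambda>\<zeta>. f (\<zeta> *\<^sub>C u)"
  shows "g holomorphic_on ball 0 1" and "g 0 = 1"
    and "cmod \<zeta> < 1 \<Longrightarrow> g \<zeta> \<noteq> 0"
    and "cmod \<zeta> < 1 \<Longrightarrow> 1 + \<zeta> * deriv g \<zeta> / g \<zeta> \<in> \<Phi> ` ball 0 1"
proof -
  have cf: "complex_diff_on f (ball 0 1)" and f0: "f 0 = 1"
    and inv: "\<And>z. z \<in> ball 0 1 \<Longrightarrow> boundedly_invertible (frechet (one_dim_type f) z)"
    and M: "(\<lambda>z. inv ((frechet (one_dim_type f) z)) (one_dim_type f z)) \<in> class_M \<Phi>"
    using f by (auto simp: starlike_factor_def holomorphic_on_ball_iff)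
  have \<Phi>0: "\<Phi> 0 = 1" and pos: "\<And>\<zeta>. cmod \<zeta> < 1 \<Longrightarrow> Re (\<Phi> \<zeta>) > 0"
    using \<Phi> by (auto simp: admissible_def)
  have ball: "\<zeta> *\<^sub>C u \<in> ball 0 1" if "cmod \<zeta> < 1" for \<zeta> using that u by (simp add: norm_scaleC)
  have id: "complex_homogeneous ((id_blinfun :: complex \<Rightarrow>\<^sub>L complex))"
    by (simp add: complex_homogeneous_def)
  have dg: "(g has_field_derivative (frechet f (\<zeta> *\<^sub>C u)) u) (at \<zeta>)" if "cmod \<zeta> < 1" for \<zeta>
    using has_field_derivative_along_line[OF cf _ id, of 0 \<zeta> u] ball[OF that] by (simp add: g_def)
  show "g holomorphic_on ball 0 1"
    unfolding holomorphic_on_def field_differentiable_def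
    using dg has_field_derivative_at_within by fastforce
  show g0: "g 0 = 1" by (simp add: g_def scaleC_zero_left f0)
  have key: "g \<zeta> \<noteq> 0 \<and> 1 + \<zeta> * deriv g \<zeta> / g \<zeta> \<in> \<Phi> ` ball 0 1" if \<zeta>: "cmod \<zeta> < 1" for \<zeta>
  proof (cases "\<zeta> = 0")
    case True
    then show ?thesis using g0 \<Phi>0 by (auto intro: image_eqI[of _ _ 0])
  next
    case False
    define z where "z = \<zeta> *\<^sub>C u"
    have nz: "norm z = cmod \<zeta>" using u by (simp add: z_def norm_scaleC)
    have z: "z \<in> ball 0 1" "z \<noteq> 0" using nz \<zeta> False by auto
    define a where "a = f z + (frechet f z) z"
    have a: "a \<noteq> 0"
      and p: "inv ((frechet (one_dim_type f) z)) (one_dim_type f z) = (f z / a) *\<^sub>C z"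
      unfolding a_def by (rule inv_frechet_one_dim_type[OF cf z inv[OF z(1)]])+
    define l' where "l' = (cnj \<zeta> / of_real (cmod \<zeta>)) *\<^sub>C l"
    have l': "l' \<in> support_functionals z" unfolding l'_def z_def by (rule support_functional_rotate[OF l u False])
    have "of_real (norm z) / l' ((f z / a) *\<^sub>C z) \<in> \<Phi> ` ball 0 1"
      using M l' z p unfolding class_M_def by fastforce
    moreover have "l' ((f z / a) *\<^sub>C z) = f z / a * of_real (norm z)"
      using l' by (simp add: support_functionals_def complex_homogeneous_def scaleC_complex_def)
    moreover have "of_real (norm z) / (f z / a * of_real (norm z)) = a / f z"
      using z(2) by simp
    ultimately have mem: "a / f z \<in> \<Phi> ` ball 0 1" by simp
    have "f z \<noteq> 0"
    proof
      assume "f z = 0"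
      then obtain \<xi> where "cmod \<xi> < 1" "\<Phi> \<xi> = 0" using mem by auto
      then show False using pos[of \<xi>] by simp
    qed
    moreover have "(frechet f z) z = \<zeta> * deriv g \<zeta>"
      using complex_homogeneous_scaleC[OF complex_diff_onD(2)[OF cf z(1)], of \<zeta> u]
        DERIV_imp_deriv[OF dg[OF \<zeta>]] by (simp add: z_def scaleC_complex_def)
    ultimately show ?thesis using mem by (simp add: a_def g_def z_def[symmetric] add_divide_distrib)
  qed
  show "cmod \<zeta> < 1 \<Longrightarrow> g \<zeta> \<noteq> 0" "cmod \<zeta> < 1 \<Longrightarrow> 1 + \<zeta> * deriv g \<zeta> / g \<zeta> \<in> \<Phi> ` ball 0 1"
    using key by blast+
qed

lemma coefficients_of_one_dim_type:
  fixes f :: "'a::complex_banach \<Rightarrow> complex"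
  assumes f: "complex_diff_on f (ball 0 1)"
    and u: "norm u = 1" and l: "l \<in> support_functionals u"
    and G: "(\<lambda>\<zeta>. f (\<zeta> *\<^sub>C u)) has_fps_expansion G"
  shows "A2 (one_dim_type f) l u = fps_nth G 1"
    and "A3 (one_dim_type f) l u = fps_nth G 2"
    and "A4 (one_dim_type f) l u = fps_nth G 3"
proof -
  have lh: "complex_homogeneous l" and lu: "l u = 1"
    using l u by (auto simp: support_functionals_def)
  define \<psi> where "\<psi> = (\<lambda>\<zeta>. l (one_dim_type f (\<zeta> *\<^sub>C u)))"
  note d = diagonal_derivatives_along_line[OF complex_diff_one_dim_type(1)[OF f] u lh, folded \<psi>_def]
  have "\<psi> \<zeta> = \<zeta> * f (\<zeta> *\<^sub>C u)" for \<zeta>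
    by (simp add: \<psi>_def one_dim_type_def complex_homogeneous_scaleC[OF lh] scaleC_complex_def lu)
  then have "\<psi> has_fps_expansion fps_X * G"
    using has_fps_expansion_mult[OF has_fps_expansion_fps_X G] by presburger
  note expansion = fps_nth_fps_expansion[OF this]
  have "(deriv ^^ Suc n) \<psi> 0 = fact (Suc n) * fps_nth G n" for n
    using expansion[of "Suc n"] by (simp add: field_simps del: fact_Suc funpow.simps)
  from this[of 1] this[of 2] this[of 3]
  show "A2 (one_dim_type f) l u = fps_nth G 1" "A3 (one_dim_type f) l u = fps_nth G 2"
    "A4 (one_dim_type f) l u = fps_nth G 3"
    by (simp_all add: A2_def A3_def A4_def d(2-4) u numeral_2_eq_2[symmetric] numeral_3_eq_3[symmetric]
        del: fact_Suc funpow.simps)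
qed

lemma coefficients_scale:
  fixes u :: "'a::complex_banach"
  assumes "0 < r" "norm u = 1"
  shows "A2 F l (r *\<^sub>R u) = A2 F l u" "A3 F l (r *\<^sub>R u) = A3 F l u" "A4 F l (r *\<^sub>R u) = A4 F l u"
  using assms
  by (simp_all add: A2_def A3_def A4_def D2_diag_def D3_diag_def D4_diag_def blinfun.bilinear_simps
      scaleR_conv_of_real power2_eq_square power3_eq_cube power4_eq_xxxx)


section \<open>The coefficient functional and its extremal function\<close>

text \<open>Comparison of the coefficients in \<open>\<zeta> g' = g (\<Phi> \<circ> w - 1)\<close>.\<close>

lemma subordination_coefficients:
  fixes G P W :: "complex fps"
  assumes g: "g has_fps_expansion G" "g 0 = 1" and \<Phi>: "\<Phi> has_fps_expansion P" "\<Phi> 0 = 1"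
    and w: "w has_fps_expansion W" "w 0 = 0"
    and eq: "\<And>\<zeta>. cmod \<zeta> < 1 \<Longrightarrow> \<zeta> * deriv g \<zeta> = g \<zeta> * (\<Phi> (w \<zeta>) - 1)"
  defines "b \<equiv> fps_nth P" and "c \<equiv> fps_nth W"
  shows "fps_nth G 1 = b 1 * c 1"
    and "fps_nth G 2 = (b 1 * c 2 + (b 1 ^ 2 + b 2) * c 1 ^ 2) / 2"
    and "fps_nth G 3 = (b 1 ^ 3 * c 1 ^ 3 + 3 * b 1 * c 1 * (b 1 * c 2 + b 2 * c 1 ^ 2)
      + 2 * (b 1 * c 3 + 2 * b 2 * c 1 * c 2 + b 3 * c 1 ^ 3)) / 6"
proof -
  define S where "S = fps_compose P W"
  have W0: "fps_nth W 0 = 0" using has_fps_expansion_imp_0_eq_fps_nth_0[OF w(1)] w(2) by simp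
  have G0: "fps_nth G 0 = 1" using has_fps_expansion_imp_0_eq_fps_nth_0[OF g(1)] g(2) by simp
  have P0: "fps_nth P 0 = 1" using has_fps_expansion_imp_0_eq_fps_nth_0[OF \<Phi>(1)] \<Phi>(2) by simp
  have "(\<lambda>\<zeta>. \<Phi> (w \<zeta>)) has_fps_expansion S"
    using has_fps_expansion_compose[OF \<Phi>(1) w(1) W0] by (simp add: S_def o_def)
  then have e: "fps_X * fps_deriv G = G * (S - 1)"
    by (intro fps_eq_if_eq_on_ball[OF
        has_fps_expansion_mult[OF has_fps_expansion_fps_X has_fps_expansion_deriv[OF g(1)]]
        has_fps_expansion_mult[OF g(1) has_fps_expansion_diff[OF _ has_fps_expansion_1]]])
       (auto intro: eq)
  have S0: "fps_nth S 0 = 1" by (simp add: S_def P0)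
  note S = fps_compose_nth_upto_3[OF W0, of P, folded S_def]
  have "fps_nth (fps_X * fps_deriv G) n = of_nat n * fps_nth G n" for n
    by (cases n) simp_all
  then have rec: "of_nat n * fps_nth G n = fps_nth (G * (S - 1)) n" for n using e by simp
  have G1: "fps_nth G 1 = fps_nth S 1"
    using rec[of 1] by (simp add: fps_mult_nth_1 G0 S0 del: One_nat_def)
  have G2: "2 * fps_nth G 2 = fps_nth S 2 + fps_nth G 1 * fps_nth S 1"
    using rec[of 2] by (simp add: fps_mult_nth_2 G0 S0 del: One_nat_def)
  have G3: "3 * fps_nth G 3 = fps_nth S 3 + fps_nth G 1 * fps_nth S 2 + fps_nth G 2 * fps_nth S 1"
    using rec[of 3] by (simp add: fps_mult_nth_3 G0 S0 del: One_nat_def)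
  show G1': "fps_nth G 1 = b 1 * c 1" unfolding G1 S b_def c_def ..
  have "fps_nth G 2 * 2 = b 1 * c 2 + (b 1 ^ 2 + b 2) * c 1 ^ 2"
    using G2 unfolding G1' S b_def[symmetric] c_def[symmetric] by algebra
  then show G2': "fps_nth G 2 = (b 1 * c 2 + (b 1 ^ 2 + b 2) * c 1 ^ 2) / 2" by simp
  have "fps_nth G 3 * 6 = b 1 ^ 3 * c 1 ^ 3 + 3 * b 1 * c 1 * (b 1 * c 2 + b 2 * c 1 ^ 2)
      + 2 * (b 1 * c 3 + 2 * b 2 * c 1 * c 2 + b 3 * c 1 ^ 3)"
    using G2 G3 unfolding G1' S b_def[symmetric] c_def[symmetric] by algebra
  then show "fps_nth G 3 = (b 1 ^ 3 * c 1 ^ 3 + 3 * b 1 * c 1 * (b 1 * c 2 + b 2 * c 1 ^ 2)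
      + 2 * (b 1 * c 3 + 2 * b 2 * c 1 * c 2 + b 3 * c 1 ^ 3)) / 6" by simp
qed

lemma starlike_coefficients:
  assumes \<Phi>: "admissible \<Phi>" "\<Phi> has_fps_expansion P"
    and g: "g holomorphic_on ball 0 1" "g 0 = 1" "\<And>\<zeta>. cmod \<zeta> < 1 \<Longrightarrow> g \<zeta> \<noteq> 0"
      "\<And>\<zeta>. cmod \<zeta> < 1 \<Longrightarrow> 1 + \<zeta> * deriv g \<zeta> / g \<zeta> \<in> \<Phi> ` ball 0 1"
    and G: "g has_fps_expansion G"
  defines "b \<equiv> fps_nth P"
  obtains c1 c2 c3 where "schwarz_triple c1 c2 c3"
    "fps_nth G 1 = b 1 * c1"
    "fps_nth G 2 = (b 1 * c2 + (b 1 ^ 2 + b 2) * c1 ^ 2) / 2"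
    "fps_nth G 3 = (b 1 ^ 3 * c1 ^ 3 + 3 * b 1 * c1 * (b 1 * c2 + b 2 * c1 ^ 2)
      + 2 * (b 1 * c3 + 2 * b 2 * c1 * c2 + b 3 * c1 ^ 3)) / 6"
proof -
  obtain \<Psi> where \<Psi>: "\<Psi> holomorphic_on (\<Phi> ` ball 0 1)" "\<And>\<zeta>. cmod \<zeta> < 1 \<Longrightarrow> \<Psi> (\<Phi> \<zeta>) = \<zeta>"
    and \<Phi>0: "\<Phi> 0 = 1"
    using \<Phi>(1) unfolding admissible_def by auto
  define S where "S \<zeta> = 1 + \<zeta> * deriv g \<zeta> / g \<zeta>" for \<zeta>
  have holS: "S holomorphic_on ball 0 1"
    unfolding S_def using g(3) by (intro holomorphic_intros g(1) holomorphic_deriv) auto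
  have mem: "S \<zeta> \<in> \<Phi> ` ball 0 1" if "cmod \<zeta> < 1" for \<zeta> using g(4)[OF that] by (simp add: S_def)
  define w where "w = \<Psi> \<circ> S"
  have holw: "w holomorphic_on ball 0 1"
    unfolding w_def by (rule holomorphic_on_compose_gen[OF holS \<Psi>(1)]) (use mem in auto)
  have w: "cmod (w \<zeta>) < 1" "\<Phi> (w \<zeta>) = S \<zeta>" if "cmod \<zeta> < 1" for \<zeta>
    using mem[OF that] \<Psi>(2) by (auto simp: w_def)
  have w0: "w 0 = 0" using \<Psi>(2)[of 0] by (simp add: w_def S_def \<Phi>0)
  have eq: "\<zeta> * deriv g \<zeta> = g \<zeta> * (\<Phi> (w \<zeta>) - 1)" if "cmod \<zeta> < 1" for \<zeta>
    using g(3)[OF that] w(2)[OF that] by (simp add: S_def)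
  note W = holomorphic_has_fps_expansion[OF holw]
  show ?thesis
    using that[OF schwarz_coefficients[OF holw w0 w(1) W]]
      subordination_coefficients[OF G g(2) \<Phi>(2) \<Phi>0 W w0 eq, folded b_def] by blast
qed

text \<open>The reason for the definitions of \<open>q\<^sub>1, \<dots>, q\<^sub>4\<close>.\<close>

lemma coefficient_product_identities:
  fixes b1 b2 b3 c1 c2 c3 Q1 Q2 Q3 Q4 :: complex
  assumes b1: "b1 \<noteq> 0"
    and Q: "2 * b1 * Q1 = - (3 * b1^2 + 2 * b2)"
      "2 * b1^2 * Q2 = - (2 * b1^4 + 3 * b1^2 * b2 - 2 * b1 * b3 + 3 * b2^2)"
      "2 * b1 * Q3 = 3 * b1^2 + 4 * b2" "2 * b1 * Q4 = b1^3 + 3 * b1 * b2 + 2 * b3"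
  defines "a2 \<equiv> b1 * c1" and "a3 \<equiv> (b1 * c2 + (b1^2 + b2) * c1^2) / 2"
    and "a4 \<equiv> (b1^3 * c1^3 + 3 * b1 * c1 * (b1 * c2 + b2 * c1^2)
      + 2 * (b1 * c3 + 2 * b2 * c1 * c2 + b3 * c1^3)) / 6"
  shows "a4 = b1 / 3 * (c3 + Q3 * c1 * c2 + Q4 * c1^3)"
    and "a2^2 - 2 * a3^2 + a2 * a4 = b1^2 * (c1^2 - c2^2 / 2 + c1 / 3 * (c3 + Q1 * c1 * c2 + Q2 * c1^3))"
    and "a2^3 - 2 * a2 * a3^2 - a2 * a4^2 + 2 * a3^2 * a4 = (a2 - a4) * (a2^2 - 2 * a3^2 + a2 * a4)"
proof -
  have a3: "2 * a3 = b1 * c2 + (b1^2 + b2) * c1^2"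
    and a4: "6 * a4 = b1^3 * c1^3 + 3 * b1 * c1 * (b1 * c2 + b2 * c1^2)
      + 2 * (b1 * c3 + 2 * b2 * c1 * c2 + b3 * c1^3)"
    by (simp_all add: a3_def a4_def)
  have "a4 * 3 = b1 * (c3 + Q3 * c1 * c2 + Q4 * c1^3)" using a4 Q(3,4) by algebra
  then show "a4 = b1 / 3 * (c3 + Q3 * c1 * c2 + Q4 * c1^3)" by simp
  have "(a2^2 - 2 * a3^2 + a2 * a4) * 6 = b1^2 * (6 * c1^2 - 3 * c2^2 + 2 * c1 * (c3 + Q1 * c1 * c2 + Q2 * c1^3))"
    using a3 a4 Q(1,2) unfolding a2_def by algebra
  then have "a2^2 - 2 * a3^2 + a2 * a4 = b1^2 * (6 * c1^2 - 3 * c2^2 + 2 * c1 * (c3 + Q1 * c1 * c2 + Q2 * c1^3)) / 6"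
    by (rule eq_divide_imp[rotated]) simp
  then show "a2^2 - 2 * a3^2 + a2 * a4 = b1^2 * (c1^2 - c2^2 / 2 + c1 / 3 * (c3 + Q1 * c1 * c2 + Q2 * c1^3))"
    by (simp add: field_simps)
  show "a2^3 - 2 * a2 * a3^2 - a2 * a4^2 + 2 * a3^2 * a4 = (a2 - a4) * (a2^2 - 2 * a3^2 + a2 * a4)"
    by algebra
qed

text \<open>The terms besides the Prokhorov--Szynal expression satisfy
  \<open>t\<^sup>2 + (1 - t\<^sup>2)^2/2 \<le> 1\<close> for \<open>t = \<bar>c\<^sub>1\<bar> \<le> 1\<close>.\<close>

lemma schwarz_triple_second_factor:
  fixes q1 q2 :: real
  assumes c: "schwarz_triple c1 c2 c3" and q: "(q1, q2) \<in> Theta3 \<union> Theta4 \<union> Theta5 \<union> Theta6 \<union> Theta7"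
  shows "cmod (c1^2 - c2^2 / 2 + c1 / 3 * (c3 + of_real q1 * c1 * c2 + of_real q2 * c1^3)) \<le> 1 + \<bar>q2\<bar> / 3"
proof -
  define t where "t = cmod c1"
  have t: "0 \<le> t" "t \<le> 1" and c2: "cmod c2 \<le> 1 - t\<^sup>2"
  proof -
    obtain x where x: "t \<le> 1" "cmod x \<le> 1" "c2 = of_real (1 - t\<^sup>2) * x"
      using c by (auto simp: schwarz_triple_def t_def)
    show "0 \<le> t" "t \<le> 1" using x by (auto simp: t_def)
    then have "0 \<le> 1 - t\<^sup>2" by (simp add: power_le_one)
    then show "cmod c2 \<le> 1 - t\<^sup>2"
      unfolding x(3) norm_mult norm_of_real using x(2) by (simp add: mult_left_le)
  qed
  let ?P = "c3 + of_real q1 * c1 * c2 + of_real q2 * c1^3"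
  have "cmod (c1^2 - c2^2 / 2 + c1 / 3 * ?P) \<le> cmod (c1^2) + cmod (c2^2 / 2) + cmod (c1 / 3 * ?P)"
    by (intro order_trans[OF norm_triangle_ineq] add_mono norm_triangle_ineq4 order_refl)
  also have "\<dots> = t^2 + (cmod c2)^2 / 2 + t / 3 * cmod ?P"
    by (simp add: norm_mult norm_power norm_divide t_def)
  also have "\<dots> \<le> t^2 + (1 - t\<^sup>2)^2 / 2 + 1 / 3 * \<bar>q2\<bar>"
    using t c2 prokhorov_szynal[OF c q] by (intro add_mono mult_mono divide_right_mono power_mono) auto
  also have "t\<^sup>2 + (1 - t\<^sup>2)^2 / 2 \<le> 1"
  proof -
    have "1 - (t^2 + (1 - t\<^sup>2)^2 / 2) = (1 - t\<^sup>2 * t^2) / 2" by (simp add: field_simps power2_eq_square)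
    moreover have "t\<^sup>2 * t^2 \<le> 1" using t by (simp add: power_le_one mult_le_one)
    ultimately show ?thesis by simp
  qed
  finally show ?thesis by simp
qed

lemma theta_second_coordinate:
  assumes "(a, b) \<in> Theta5 \<union> Theta6 \<union> Theta7"
  shows "1 \<le> b"
proof -
  have "4 \<le> a^2" if "2 \<le> \<bar>a\<bar>" using power_mono[OF that, of 2] by simp
  then show ?thesis using assms by (auto simp: Theta5_def Theta6_def Theta7_def)
qed

lemma theta34_second_coordinate: "(a, b) \<in> Theta3 \<union> Theta4 \<Longrightarrow> b \<le> -1"
  by (auto simp: Theta3_def Theta4_def intro: order_trans[where y = "-(2/3) * (\<bar>a\<bar> + 1)"])

text \<open>The solution of \<open>\<zeta> g' = g (\<Phi>(\<i> \<zeta>) - 1)\<close> is the exponential of a primitive of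
  \<open>(\<Phi>(\<i> \<zeta>) - 1)/\<zeta>\<close>.\<close>

lemma extremal_factor:
  assumes \<Phi>: "admissible \<Phi>"
  obtains g where "g holomorphic_on ball 0 1" "g 0 = 1" "\<And>\<zeta>. g \<zeta> \<noteq> 0"
    "\<And>\<zeta>. cmod \<zeta> < 1 \<Longrightarrow> \<zeta> * deriv g \<zeta> = g \<zeta> * (\<Phi> (\<i> * \<zeta>) - 1)"
proof -
  have hol: "\<Phi> holomorphic_on ball 0 1" and \<Phi>0: "\<Phi> 0 = 1" using \<Phi> by (auto simp: admissible_def)
  have "(\<lambda>\<zeta>. \<Phi> (\<i> * \<zeta>)) holomorphic_on ball 0 1"
    by (rule holomorphic_on_compose_gen[of "\<lambda>\<zeta>. \<i> * \<zeta>" _ \<Phi>, unfolded o_def, OF _ hol])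
       (auto intro!: holomorphic_intros simp: norm_mult)
  then obtain k where k: "k holomorphic_on ball 0 1" "\<And>\<zeta>. \<Phi> (\<i> * \<zeta>) = 1 + \<zeta> * k \<zeta>"
    using holomorphic_factor[of "\<lambda>\<zeta>. \<Phi> (\<i> * \<zeta>)"] \<Phi>0 by auto
  obtain K where K: "\<And>\<zeta>. \<zeta> \<in> ball 0 1 \<Longrightarrow> (K has_field_derivative k \<zeta>) (at \<zeta> within ball 0 1)"
    using holomorphic_convex_primitive'[OF convex_ball open_ball k(1)] by blast
  define g where "g \<zeta> = exp (K \<zeta> - K 0)" for \<zeta>
  have d: "(g has_field_derivative g \<zeta> * k \<zeta>) (at \<zeta>)" if "cmod \<zeta> < 1" for \<zeta>
  proof -
    have "(K has_field_derivative k \<zeta>) (at \<zeta>)"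
      using K[of \<zeta>] that at_within_open[of \<zeta> "ball 0 1"] by simp
    then show ?thesis unfolding g_def by (auto intro!: derivative_eq_intros)
  qed
  show ?thesis
  proof
    show "g holomorphic_on ball 0 1"
      unfolding holomorphic_on_def field_differentiable_def
      using d has_field_derivative_at_within by fastforce
    show "g 0 = 1" "g \<zeta> \<noteq> 0" for \<zeta> by (simp_all add: g_def)
    show "\<zeta> * deriv g \<zeta> = g \<zeta> * (\<Phi> (\<i> * \<zeta>) - 1)" if "cmod \<zeta> < 1" for \<zeta>
      using DERIV_imp_deriv[OF d[OF that]] by (simp add: k(2))
  qed
qed

text \<open>For \<open>f = g \<circ> l\<close> the derivative \<open>DF(z)\<close> is a multiple of the identity plus an operator of rank one
  with range spanned by \<open>z\<close>; it is inverted explicitly by \<open>E\<close>. The mapping in the hypothesis is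
  \<open>z / \<Phi>(\<i> l(z))\<close>.\<close>

lemma starlike_factor_of_functional:
  fixes u :: "'a::complex_banach" and l :: "'a \<Rightarrow>\<^sub>L complex"
  assumes \<Phi>: "admissible \<Phi>" and u: "norm u = 1" and l: "l \<in> support_functionals u"
    and g: "g holomorphic_on ball 0 1" "g 0 = 1" "\<And>\<zeta>. g \<zeta> \<noteq> 0"
      "\<And>\<zeta>. cmod \<zeta> < 1 \<Longrightarrow> \<zeta> * deriv g \<zeta> = g \<zeta> * (\<Phi> (\<i> * \<zeta>) - 1)"
  shows "starlike_factor \<Phi> (\<lambda>z. g (l z))"
proof -
  have hol\<Phi>: "\<Phi> holomorphic_on ball 0 1" and \<Phi>0: "\<Phi> 0 = 1"
    and pos: "\<And>\<zeta>. cmod \<zeta> < 1 \<Longrightarrow> Re (\<Phi> \<zeta>) > 0"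
    using \<Phi> by (auto simp: admissible_def)
  have lh: "l (c *\<^sub>C x) = c * l x" for c x
    using l by (simp add: support_functionals_def complex_homogeneous_def scaleC_complex_def)
  have l_lt: "cmod (l z) < 1" if "z \<in> ball 0 1" for z
    using norm_blinfun[of l z] l that by (simp add: support_functionals_def)
  have compose: "complex_diff_on (\<lambda>z. h (l z)) (ball 0 1)"
    "z \<in> ball 0 1 \<Longrightarrow> (frechet (\<lambda>z. h (l z)) z) k
        = deriv h (l z) * l k"
    if h: "h holomorphic_on ball 0 1" for h z k
  proof -
    have d: "((\<lambda>z. h (l z)) has_derivative
        (\<lambda>k. deriv h (l z) * l k)) (at z)" if z: "z \<in> ball 0 1" for z
    proof (rule has_derivative_compose[OF bounded_linear_imp_has_derivative[OF blinfun.bounded_linear_right]])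
      show "(h has_derivative (*) (deriv h (l z))) (at (l z))"
        using holomorphic_derivI[OF h open_ball, of "l z"] l_lt[OF z]
        by (simp add: has_field_derivative_def)
    qed
    have "complex_homogeneous (\<lambda>k. deriv h (l z) * l k)" for z
      by (simp add: complex_homogeneous_def lh scaleC_complex_def)
    then show "complex_diff_on (\<lambda>z. h (l z)) (ball 0 1)"
      unfolding complex_diff_on_def using d by blast
    show "z \<in> ball 0 1 \<Longrightarrow> (frechet (\<lambda>z. h (l z)) z) k
        = deriv h (l z) * l k"
      using frechet_eq[OF d] by simp
  qed
  define f where "f = (\<lambda>z. g (l z))"
  note f = compose[OF g(1), folded f_def]
  define \<omega> where "\<omega> z = \<Phi> (\<i> * l z)" for z
  have \<omega>: "\<omega> z \<noteq> 0" "\<omega> z \<in> \<Phi> ` ball 0 1" if "z \<in> ball 0 1" for z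
    using l_lt[OF that] pos[of "\<i> * l z"] by (auto simp: \<omega>_def norm_mult)
  have f_nz: "f z \<noteq> 0" for z by (simp add: f_def g(3))
  have a: "f z + deriv g (l z) * l z = f z * \<omega> z" if "z \<in> ball 0 1" for z
    using g(4)[OF l_lt[OF that]] by (simp add: f_def \<omega>_def algebra_simps)
  have D: "(frechet (one_dim_type f) z) h
      = f z *\<^sub>C h + (deriv g (l z) * l h) *\<^sub>C z" if "z \<in> ball 0 1" for z h
    using complex_diff_one_dim_type(2)[OF f(1) that] f(2)[OF that] by simp
  have inv: "boundedly_invertible (frechet (one_dim_type f) z)" if z: "z \<in> ball 0 1" for z
  proof -
    define d where "d = deriv g (l z)"
    define E where "E k = (1 / f z) *\<^sub>C (k - (d * l k / (f z * \<omega> z)) *\<^sub>C z)" for k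
    have "bounded_linear (\<lambda>k. d * l k / (f z * \<omega> z))"
      by (intro bounded_linear_divide[THEN bounded_linear_compose] bounded_linear_const_mult blinfun.bounded_linear_right)
    then have "bounded_linear E" unfolding E_def
      by (intro bounded_linear_compose[OF bounded_linear_scaleC_right] bounded_linear_sub bounded_linear_ident
          bounded_linear_compose[OF bounded_linear_scaleC_left])
    then have E: "blinfun_apply (Blinfun E) = E" by (rule bounded_linear_Blinfun_apply)
    have fw: "f z * \<omega> z \<noteq> 0" using f_nz \<omega>(1)[OF z] by simp
    have dl: "d * l z = f z * \<omega> z - f z" using a[OF z] by (simp add: d_def algebra_simps)
    have "Blinfun E o\<^sub>L frechet (one_dim_type f) z = id_blinfun"
    proof (rule blinfun_eqI)
      fix h
      have "d * (f z * l h + d * l h * l z) / (f z * \<omega> z) = d * l h"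
      proof -
        have "d * (f z * l h + d * l h * l z) = d * l h * (f z * \<omega> z)"
          using dl by algebra
        then show ?thesis unfolding nonzero_divide_eq_eq[OF fw] .
      qed
      then have "E (f z *\<^sub>C h + (d * l h) *\<^sub>C z) = (1 / f z) *\<^sub>C f z *\<^sub>C h"
        by (simp add: E_def blinfun.add_right lh)
      then show "(Blinfun E o\<^sub>L frechet (one_dim_type f) z) h = id_blinfun h"
        using f_nz by (simp add: E D[OF z] d_def[symmetric] scaleC_scaleC scaleC_one)
    qed
    moreover have "frechet (one_dim_type f) z o\<^sub>L Blinfun E = id_blinfun"
    proof (rule blinfun_eqI)
      fix k
      define \<kappa> where "\<kappa> = d * l k / (f z * \<omega> z)"
      have lE: "l (E k) = (1 / f z) * (l k - \<kappa> * l z)"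
        by (simp add: E_def lh blinfun.diff_right \<kappa>_def)
      have "d * l (E k) = (d * l k - \<kappa> * (d * l z)) / f z"
        by (simp add: lE algebra_simps diff_divide_distrib)
      also have "\<dots> = \<kappa>" unfolding dl using fw by (simp add: \<kappa>_def field_simps)
      finally have "d * l (E k) = \<kappa>" .
      moreover have "f z *\<^sub>C E k = k - \<kappa> *\<^sub>C z"
        using f_nz by (simp add: E_def \<kappa>_def scaleC_scaleC scaleC_one)
      ultimately show "(frechet (one_dim_type f) z o\<^sub>L Blinfun E) k = id_blinfun k"
        by (simp add: E D[OF z] d_def[symmetric])
    qed
    ultimately show ?thesis unfolding boundedly_invertible_def by blast
  qed
  define p where "p = (\<lambda>z. inv ((frechet (one_dim_type f) z)) (one_dim_type f z))"
  have p: "p z = (1 / \<omega> z) *\<^sub>C z" if z: "z \<in> ball 0 1" for z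
  proof (cases "z = 0")
    case True
    have "(frechet (one_dim_type f) 0) 0 = one_dim_type f 0"
      by (simp add: one_dim_type_def scaleC_zero_right)
    then have "p 0 = 0"
      unfolding p_def using boundedly_invertible_inj[OF inv[of 0]] by (metis centre_in_ball inv_f_f zero_less_one)
    then show ?thesis using True by (simp add: scaleC_zero_right)
  next
    case False
    have "f z + (frechet f z) z = f z * \<omega> z" using a[OF z] f(2)[OF z] by simp
    then show ?thesis
      using inv_frechet_one_dim_type(2)[OF f(1) z False inv[OF z]] f_nz by (simp add: p_def)
  qed
  have holq: "(\<lambda>\<zeta>. 1 / \<Phi> (\<i> * \<zeta>)) holomorphic_on ball 0 1"
  proof -
    have "(\<lambda>\<zeta>. \<Phi> (\<i> * \<zeta>)) holomorphic_on ball 0 1"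
      by (rule holomorphic_on_compose_gen[of "\<lambda>\<zeta>. \<i> * \<zeta>" _ \<Phi>, unfolded o_def, OF _ hol\<Phi>])
         (auto intro!: holomorphic_intros simp: norm_mult)
    moreover have "\<Phi> (\<i> * \<zeta>) \<noteq> 0" if "\<zeta> \<in> ball 0 1" for \<zeta>
      using pos[of "\<i> * \<zeta>"] that by (auto simp: norm_mult)
    ultimately show ?thesis by (intro holomorphic_intros)
  qed
  define r where "r = (\<lambda>z. 1 / \<omega> z)"
  have r: "complex_diff_on r (ball 0 1)" using compose(1)[OF holq] by (simp add: r_def \<omega>_def)
  have pr: "p z = one_dim_type r z" if "z \<in> ball 0 1" for z using p[OF that] by (simp add: one_dim_type_def r_def)
  have dp: "(p has_derivative (frechet (one_dim_type r) z)) (at z)" if z: "z \<in> ball 0 1" for z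
    by (rule has_derivative_transform_within_open[OF complex_diff_onD(1)[OF complex_diff_one_dim_type(1)[OF r] z]
          open_ball z]) (simp add: pr)
  have "p \<in> class_M \<Phi>"
    unfolding class_M_def mem_Collect_eq
  proof (intro conjI ballI)
    show "holomorphic_on_ball p"
      unfolding holomorphic_on_ball_def
      using dp complex_diff_onD(2)[OF complex_diff_one_dim_type(1)[OF r]] by blast
    show "p 0 = 0" using p[of 0] by (simp add: scaleC_zero_right)
    show "frechet p 0 = id_blinfun"
    proof (rule blinfun_eqI)
      fix h
      have "(frechet p 0) h = (frechet (one_dim_type r) 0) h"
        using frechet_eq[OF dp[of 0]] by simp
      also have "\<dots> = h"
        using complex_diff_one_dim_type(2)[OF r, of 0 h]
        by (simp add: r_def \<omega>_def \<Phi>0 scaleC_one scaleC_zero_right)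
      finally show "(frechet p 0) h = id_blinfun h" by simp
    qed
    fix z :: 'a and l' assume z: "z \<in> ball 0 1 - {0}" and l': "l' \<in> support_functionals z"
    have "l' (p z) = 1 / \<omega> z * of_real (norm z)"
      using l' z p[of z] by (simp add: support_functionals_def complex_homogeneous_def scaleC_complex_def)
    then have "of_real (norm z) / l' (p z) = \<omega> z" using z by simp
    then show "of_real (norm z) / l' (p z) \<in> \<Phi> ` ball 0 1" using \<omega>(2)[of z] z by simp
  qed
  then have "starlike_factor \<Phi> f"
    using f(1) inv g(2) by (simp add: starlike_factor_def holomorphic_on_ball_iff p_def f_def)
  then show ?thesis by (simp add: f_def)
qed

theorem theorem5:
  fixes \<Phi> :: "complex \<Rightarrow> complex"
    and B1 B2 B3 q1 q2 q3 q4 bound :: real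
  assumes "(UNIV :: 'a::complex_banach set) \<noteq> {0}"
    and "admissible \<Phi>"
    and "B1 = taylor_coeff \<Phi> 1"
    and "B2 = taylor_coeff \<Phi> 2"
    and "B3 = taylor_coeff \<Phi> 3"
    and "q1 = - (3 * B1^2 + 2 * B2) / (2 * B1)"
    and "q2 = - (2 * B1^4 + 3 * B1^2 * B2 - 2 * B1 * B3 + 3 * B2^2) / (2 * B1^2)"
    and "q3 = (3 * B1^2 + 4 * B2) / (2 * B1)"
    and "q4 = (B1^3 + 3 * B1 * B2 + 2 * B3) / (2 * B1)"
    and "(q1, q2) \<in> Theta3 \<union> Theta4 \<union> Theta5 \<union> Theta6 \<union> Theta7"
    and "(q3, q4) \<in> Theta5 \<union> Theta6 \<union> Theta7"
    and "bound = (B1^3 + 3 * B1 * B2 + 2 * B3 + 6 * B1) *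
           \<bar>2 * B1^4 + 3 * B1^2 * B2 + 6 * B1^2 - 2 * B1 * B3 + 3 * B2^2\<bar> / 36"
  shows "(\<forall>f :: 'a \<Rightarrow> complex. starlike_factor \<Phi> f \<longrightarrow>
            (\<forall>z. z \<noteq> 0 \<longrightarrow> (\<forall>l\<in>support_functionals z.
               cmod (coeff_functional (one_dim_type f) l z) \<le> bound)))
       \<and> (\<exists>f :: 'a \<Rightarrow> complex. starlike_factor \<Phi> f \<and>
            (\<exists>z. z \<noteq> 0 \<and> (\<exists>l\<in>support_functionals z.
               cmod (coeff_functional (one_dim_type f) l z) = bound)))"
proof -
  note \<Phi> = assms(2) and q12 = assms(10) and q34 = assms(11)
  have B1: "0 < B1" and "q2 < 1"
    using admissible_q2_less_1[OF \<Phi> assms(3-5)] assms(7) by auto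
  then have q2: "q2 \<le> -1" using q12 theta_second_coordinate[of q1 q2] theta34_second_coordinate[of q1 q2] by fastforce
  have q4: "1 \<le> q4" using q34 by (rule theta_second_coordinate)
  obtain P where P: "\<Phi> has_fps_expansion P" "\<And>n. fps_nth P n = of_real (taylor_coeff \<Phi> n)"
    using admissible_taylor[OF \<Phi>] by blast
  define b where "b = fps_nth P"
  have b: "b 1 = of_real B1" "b 2 = of_real B2" "b 3 = of_real B3" by (simp_all add: b_def P(2) assms(3-5))
  have r: "2 * B1 * q1 = - (3 * B1^2 + 2 * B2)"
      "2 * B1^2 * q2 = - (2 * B1^4 + 3 * B1^2 * B2 - 2 * B1 * B3 + 3 * B2^2)"
      "2 * B1 * q3 = 3 * B1^2 + 4 * B2" "2 * B1 * q4 = B1^3 + 3 * B1 * B2 + 2 * B3"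
    using B1 by (simp_all add: assms(6-9))
  have bq: "2 * b 1 * of_real q1 = - (3 * b 1^2 + 2 * b 2)"
      "2 * b 1^2 * of_real q2 = - (2 * b 1^4 + 3 * b 1^2 * b 2 - 2 * b 1 * b 3 + 3 * b 2^2)"
      "2 * b 1 * of_real q3 = 3 * b 1^2 + 4 * b 2" "2 * b 1 * of_real q4 = b 1^3 + 3 * b 1 * b 2 + 2 * b 3"
    unfolding b using r[THEN arg_cong[of _ _ complex_of_real]] by simp_all
  have b1: "b 1 \<noteq> 0" using B1 unfolding b by simp
  have bound: "bound = (B1 * (1 + q4 / 3)) * (B1^2 * (1 - q2 / 3))"
  proof -
    have e1: "2 * B1^4 + 3 * B1^2 * B2 + 6 * B1^2 - 2 * B1 * B3 + 3 * B2^2 = 2 * B1^2 * (3 - q2)"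
      using r(2) by (simp add: algebra_simps)
    have e2: "\<bar>2 * B1^2 * (3 - q2)\<bar> = 2 * B1^2 * (3 - q2)" using q2 by (intro abs_of_nonneg) auto
    have e3: "B1^3 + 3 * B1 * B2 + 2 * B3 + 6 * B1 = 2 * B1 * (3 + q4)"
      using r(4) by (simp add: algebra_simps)
    show ?thesis unfolding assms(12) e1 e2 e3 by (simp add: field_simps)
  qed
  have upper: "cmod (coeff_functional (one_dim_type f) l z) \<le> bound"
    if f: "starlike_factor \<Phi> f" and z: "z \<noteq> 0" and l: "l \<in> support_functionals z"
    for f :: "'a \<Rightarrow> complex" and z l
  proof -
    define u where "u = z /\<^sub>R norm z"
    have u: "norm u = 1" and zu: "z = norm z *\<^sub>R u" using z by (simp_all add: u_def)
    have lu: "l \<in> support_functionals u"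
      using l z u by (simp add: support_functionals_def u_def blinfun.scaleR_right scaleR_conv_of_real)
    define g where "g = (\<lambda>\<zeta>. f (\<zeta> *\<^sub>C u))"
    have g: "g holomorphic_on ball 0 1" "g 0 = 1" "\<And>\<zeta>. cmod \<zeta> < 1 \<Longrightarrow> g \<zeta> \<noteq> 0"
      "\<And>\<zeta>. cmod \<zeta> < 1 \<Longrightarrow> 1 + \<zeta> * deriv g \<zeta> / g \<zeta> \<in> \<Phi> ` ball 0 1"
      unfolding g_def by (fact starlike_factor_on_slice[OF \<Phi> f u lu])+
    define G where "G = fps_expansion g 0"
    have G: "g has_fps_expansion G" unfolding G_def by (rule holomorphic_has_fps_expansion[OF g(1)])
    obtain c1 c2 c3 where c: "schwarz_triple c1 c2 c3"
      and a: "fps_nth G 1 = b 1 * c1" "fps_nth G 2 = (b 1 * c2 + (b 1 ^ 2 + b 2) * c1 ^ 2) / 2"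
        "fps_nth G 3 = (b 1 ^ 3 * c1 ^ 3 + 3 * b 1 * c1 * (b 1 * c2 + b 2 * c1 ^ 2)
          + 2 * (b 1 * c3 + 2 * b 2 * c1 * c2 + b 3 * c1 ^ 3)) / 6"
      unfolding b_def using starlike_coefficients[OF \<Phi> P(1) g G] by blast
    have cf: "complex_diff_on f (ball 0 1)"
      using f by (simp add: starlike_factor_def holomorphic_on_ball_iff)
    note id = coefficient_product_identities[OF b1 bq, of c1 c2 c3, folded a]
    have "coeff_functional (one_dim_type f) l z = coeff_functional (one_dim_type f) l u"
      using coefficients_scale[of "norm z" u "one_dim_type f" l] z u zu by (simp add: coeff_functional_def)
    also have "\<dots> = (fps_nth G 1 - fps_nth G 3) * (fps_nth G 1 ^ 2 - 2 * fps_nth G 2 ^ 2 + fps_nth G 1 * fps_nth G 3)"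
      unfolding coeff_functional_def coefficients_of_one_dim_type[OF cf u lu G[unfolded g_def]] id(3) ..
    also have "cmod \<dots> \<le> (B1 * (1 + q4 / 3)) * (B1^2 * (1 - q2 / 3))"
      unfolding norm_mult[of "fps_nth G 1 - fps_nth G 3"]
    proof (rule mult_mono)
      have c1: "cmod c1 \<le> 1" using c by (simp add: schwarz_triple_def)
      have "cmod (fps_nth G 1 - fps_nth G 3) \<le> cmod (fps_nth G 1) + cmod (fps_nth G 3)" by (rule norm_triangle_ineq4)
      also have "\<dots> = B1 * cmod c1 + B1 / 3 * cmod (c3 + of_real q3 * c1 * c2 + of_real q4 * c1^3)"
        using B1 by (subst id(1), subst a(1)) (simp add: b norm_mult norm_divide del: One_nat_def)
      also have "\<dots> \<le> B1 * 1 + B1 / 3 * \<bar>q4\<bar>"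
        using B1 c1 q34 by (intro add_mono mult_left_mono prokhorov_szynal[OF c]) auto
      finally show "cmod (fps_nth G 1 - fps_nth G 3) \<le> B1 * (1 + q4 / 3)"
        using q4 by (simp add: algebra_simps)
      have "cmod (fps_nth G 1 ^ 2 - 2 * fps_nth G 2 ^ 2 + fps_nth G 1 * fps_nth G 3)
          = B1^2 * cmod (c1^2 - c2^2 / 2 + c1 / 3 * (c3 + of_real q1 * c1 * c2 + of_real q2 * c1^3))"
        unfolding id(2) using B1 by (simp add: b norm_mult norm_power del: One_nat_def)
      also have "\<dots> \<le> B1^2 * (1 + \<bar>q2\<bar> / 3)"
        by (intro mult_left_mono schwarz_triple_second_factor[OF c q12]) simp
      finally show "cmod (fps_nth G 1 ^ 2 - 2 * fps_nth G 2 ^ 2 + fps_nth G 1 * fps_nth G 3) \<le> B1^2 * (1 - q2 / 3)"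
        using q2 by simp
    qed (use B1 q4 in auto)
    finally show ?thesis by (simp add: bound)
  qed
  have "\<exists>f :: 'a \<Rightarrow> complex. starlike_factor \<Phi> f \<and>
      (\<exists>z. z \<noteq> 0 \<and> (\<exists>l\<in>support_functionals z. cmod (coeff_functional (one_dim_type f) l z) = bound))"
  proof -
    obtain v :: 'a where v: "v \<noteq> 0" using assms(1) by auto
    define u where "u = v /\<^sub>R norm v"
    have u: "norm u = 1" "u \<noteq> 0" using v by (auto simp: u_def)
    obtain l where l: "l \<in> support_functionals u" using support_functionals_nonempty[OF u(2)] by blast
    have lu: "l (\<zeta> *\<^sub>C u) = \<zeta>" for \<zeta>
      using l u by (simp add: support_functionals_def complex_homogeneous_def scaleC_complex_def)
    obtain g where g: "g holomorphic_on ball 0 1" "g 0 = 1" "\<And>\<zeta>. g \<zeta> \<noteq> 0"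
      "\<And>\<zeta>. cmod \<zeta> < 1 \<Longrightarrow> \<zeta> * deriv g \<zeta> = g \<zeta> * (\<Phi> (\<i> * \<zeta>) - 1)"
      using extremal_factor[OF \<Phi>] by blast
    define f where "f = (\<lambda>z. g (l z))"
    have f: "starlike_factor \<Phi> f" unfolding f_def by (rule starlike_factor_of_functional[OF \<Phi> u(1) l g])
    then have cf: "complex_diff_on f (ball 0 1)"
      by (simp add: starlike_factor_def holomorphic_on_ball_iff)
    define G where "G = fps_expansion g 0"
    have G: "g has_fps_expansion G" unfolding G_def by (rule holomorphic_has_fps_expansion[OF g(1)])
    have Gf: "(\<lambda>\<zeta>. f (\<zeta> *\<^sub>C u)) has_fps_expansion G" using G by (simp add: f_def lu)
    have W: "(\<lambda>\<zeta>. \<i> * \<zeta>) has_fps_expansion fps_const \<i> * fps_X" by (intro fps_expansion_intros)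
    have \<Phi>0: "\<Phi> 0 = 1" using \<Phi> by (simp add: admissible_def)
    have Wn: "fps_nth (fps_const \<i> * fps_X) 1 = \<i>" "fps_nth (fps_const \<i> * fps_X) 2 = 0"
      "fps_nth (fps_const \<i> * fps_X) 3 = 0" by (simp_all add: fps_X_def)
    have a: "fps_nth G 1 = b 1 * \<i>" "fps_nth G 2 = (b 1 * 0 + (b 1 ^ 2 + b 2) * \<i> ^ 2) / 2"
      "fps_nth G 3 = (b 1 ^ 3 * \<i> ^ 3 + 3 * b 1 * \<i> * (b 1 * 0 + b 2 * \<i> ^ 2)
        + 2 * (b 1 * 0 + 2 * b 2 * \<i> * 0 + b 3 * \<i> ^ 3)) / 6"
      using subordination_coefficients[OF G g(2) P(1) \<Phi>0 W mult_zero_right, folded b_def, unfolded Wn] g(4)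
      by blast+
    note id = coefficient_product_identities[OF b1 bq, of \<i> 0 0, folded a]
    have "coeff_functional (one_dim_type f) l u
        = (fps_nth G 1 - fps_nth G 3) * (fps_nth G 1 ^ 2 - 2 * fps_nth G 2 ^ 2 + fps_nth G 1 * fps_nth G 3)"
      unfolding coeff_functional_def coefficients_of_one_dim_type[OF cf u(1) l Gf] id(3) ..
    also have "fps_nth G 1 - fps_nth G 3 = \<i> * of_real (B1 * (1 + q4 / 3))"
      by (subst id(1), subst a(1)) (simp add: b power3_eq_cube algebra_simps del: One_nat_def)
    also have "fps_nth G 1 ^ 2 - 2 * fps_nth G 2 ^ 2 + fps_nth G 1 * fps_nth G 3 = - of_real (B1^2 * (1 - q2 / 3))"
      unfolding id(2) by (simp add: b power3_eq_cube algebra_simps del: One_nat_def)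
    finally have "cmod (coeff_functional (one_dim_type f) l u) = \<bar>B1 * (1 + q4 / 3)\<bar> * \<bar>B1^2 * (1 - q2 / 3)\<bar>"
      by (simp only: norm_mult norm_minus_cancel norm_of_real norm_ii mult_1)
    also have "\<dots> = bound" unfolding bound using B1 q4 q2 by (simp add: abs_mult)
    finally show ?thesis using f l u(2) by blast
  qed
  with upper show ?thesis by blast
qed

end
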